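(* Let $T$ be a triangle and $n$ a positive integer. (a) If $T$ is right angled, then $h(n,T)\le \frac{n^3}{16}$, and if moreover $4\mid n$ then $h(n,T)=\frac{n^3}{16}$. (b) If $T$ is of type $(120^\circ,30^\circ,30^\circ)$, then $h(n,T)\le\frac{4}{81}n^3$, and if moreover $9\mid n$ then $h(n,T)=\frac{4}{81}n^3$. (c) If $T$ is of type $\left(\frac{4\cdot 180}{7}^\circ,\frac{2\cdot 180}{7}^\circ,\frac{180}{7}^\circ\right)$, then $h(n,T)\le\frac{2}{49}n^3$, and if moreover $7\mid n$ then $h(n,T)=\frac{2}{49}n^3$. (d) If $T$ is of type $(108^\circ,36^\circ,36^\circ)$ or $(72^\circ,72^\circ,36^\circ)$, then $h(n,T)\le\frac{n^3}{25}$, and if moreover $5\mid n$ then $h(n,T)=\frac{n^3}{25}$. (e) If $T$ is not right angled and not of any of the types $(120^\circ,30^\circ,30^\circ)$, $\left(\frac{4\cdot 180}{7}^\circ,\frac{2\cdot 180}{7}^\circ,\frac{180}{7}^\circ\right)$, $(108^\circ,36^\circ,36^\circ)$, $(72^\circ,72^\circ,36^\circ)$, then $h(n,T)\le\frac{n^3}{27}$, and if moreover $3\mid n$ then $h(n,T)=\frac{n^3}{27}$.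
   Context: Let $T$ be a triangle with side lengths $a,b,c$, let $\varepsilon>0$ and $\varepsilon'=\varepsilon\cdot\min\{a,b,c\}$. A triangle $A'B'C'$ is $\varepsilon$-congruent to $T$ if there exist points $A,B,C\in\mathbb{R}^2$ such that $ABC$ is congruent to $T$ and $A',B',C'$ lie in the closed disks of radius $\varepsilon'$ around $A,B,C$ respectively. $h(n,T,\varepsilon)$ denotes the maximum, over all point sets $P\subseteq\mathbb{R}^2$ with $|P|=n$, of the number of 3-element subsets of $P$ forming a triangle $\varepsilon$-congruent to $T$, and $h(n,T):=\min_{\varepsilon>0}h(n,T,\varepsilon)$. A triangle is of type $(\alpha,\beta,\gamma)$ if $\alpha\ge\beta\ge\gamma$ are its interior angles (in degrees). *)

theory Defs
  imports "HOL-Analysis.Analysis" "HOL-Library.Multiset"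
begin

type_synonym point = "real^2"

type_synonym tri = "point \<times> point \<times> point"

definition is_triangle :: "tri \<Rightarrow> bool" where
  "is_triangle T = (case T of (A, B, C) \<Rightarrow> \<not> collinear {A, B, C})"

definition vertex_angle :: "point \<Rightarrow> point \<Rightarrow> point \<Rightarrow> real" where
  "vertex_angle P Q R = arccos (((Q - P) \<bullet> (R - P)) / (norm (Q - P) * norm (R - P)))"

definition tri_angles :: "tri \<Rightarrow> real multiset" where
  "tri_angles T = (case T of (A, B, C) \<Rightarrow>
     {# vertex_angle A B C, vertex_angle B C A, vertex_angle C A B #})"

definition deg :: "real \<Rightarrow> real" where
  "deg x = x * pi / 180"

definition of_type :: "tri \<Rightarrow> real \<Rightarrow> real \<Rightarrow> real \<Rightarrow> bool" where
  "of_type T \<alpha> \<beta> \<gamma> \<longleftrightarrow> \<alpha> \<ge> \<beta> \<and> \<beta> \<ge> \<gamma> \<and> tri_angles T = {# deg \<alpha>, deg \<beta>, deg \<gamma> #}"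

definition right_angled :: "tri \<Rightarrow> bool" where
  "right_angled T \<longleftrightarrow> pi / 2 \<in># tri_angles T"

definition congruent_to :: "point \<Rightarrow> point \<Rightarrow> point \<Rightarrow> tri \<Rightarrow> bool" where
  "congruent_to A B C T = (case T of (A0, B0, C0) \<Rightarrow>
     dist A B = dist A0 B0 \<and> dist B C = dist B0 C0 \<and> dist C A = dist C0 A0)"

definition min_side :: "tri \<Rightarrow> real" where
  "min_side T = (case T of (A0, B0, C0) \<Rightarrow> min (dist B0 C0) (min (dist C0 A0) (dist A0 B0)))"

definition eps_congruent :: "point \<Rightarrow> point \<Rightarrow> point \<Rightarrow> tri \<Rightarrow> real \<Rightarrow> bool" where
  "eps_congruent A' B' C' T \<epsilon> \<longleftrightarrow>
     (\<exists>A B C. congruent_to A B C T \<and>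
        A' \<in> cball A (\<epsilon> * min_side T) \<and> B' \<in> cball B (\<epsilon> * min_side T) \<and>
        C' \<in> cball C (\<epsilon> * min_side T))"

definition count_eps :: "point set \<Rightarrow> tri \<Rightarrow> real \<Rightarrow> nat" where
  "count_eps P T \<epsilon> = card {S. S \<subseteq> P \<and> card S = 3 \<and>
      (\<exists>A' B' C'. S = {A', B', C'} \<and> eps_congruent A' B' C' T \<epsilon>)}"

definition h_eps :: "nat \<Rightarrow> tri \<Rightarrow> real \<Rightarrow> nat" where
  "h_eps n T \<epsilon> = Max {count_eps P T \<epsilon> | P. finite P \<and> card P = n}"

definition h :: "nat \<Rightarrow> tri \<Rightarrow> nat" where
  "h n T = Inf ((\<lambda>\<epsilon>. h_eps n T \<epsilon>) ` {0<..})"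

end

theory Submission
  imports Defs
begin

text \<open>By the pigeonhole principle, for arbitrarily small \<open>\<epsilon>\<close> the extremal point sets realise one fixed 3-uniform
  hypergraph on \<open>n\<close> vertices, so \<open>h n T / n ^ 3\<close> is at most the maximum of its Lagrange polynomial
  \<open>\<Sum>e. \<Prod>i\<in>e. w i\<close> on the simplex. In the support of a maximiser with minimal support every two vertices lie in a common edge;
  hence the corresponding points stay bounded up to translation and converge to a planar configuration in which every edge is an exact copy
  of \<open>T\<close> and every distance is a side length of \<open>T\<close>.

  If the pairs containing a vertex of maximal weight lie in few edges, the Lagrange multiplier condition at that vertex already gives
  \<open>1 / 27\<close> (or \<open>1 / 16\<close> for right triangles). Otherwise two or three copies share a side, and the vanishing of the Cayley-Menger
  determinants of quadruples forces the points into a regular heptagon or, in the right-angled case, yields five vertices of a regular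
  hexagon. For isosceles \<open>T\<close> the configuration is a two-distance set, which has at most four points or is a regular pentagon.
  Conversely, blowing up the vertices of an optimal configuration into small clusters gives the lower bounds.\<close>

section \<open>Lagrange polynomials of 3-uniform hypergraphs\<close>

text \<open>Each constant is the maximum of the polynomial for one small hypergraph:
  \<open>1 / 27\<close> for a single edge, \<open>1 / 16\<close> for all four triples of a
  rectangle, \<open>4 / 81\<close> for the three triples through the centre of an equilateral
  triangle, \<open>2 / 49\<close> for the 14 triples of heptagon vertices with three different
  distances, \<open>1 / 25\<close> for five cyclically consecutive triples of a pentagon. The
  maximising weights are rational, and the divisibility conditions make the cluster sizes integers.
  The obstacle in the upper bound is that the support of a maximiser is not bounded in advance and a
  classification of planar three-distance sets would be long. For scalene triangles only the pairs
  at one vertex of maximal weight are therefore inspected; a single pair in two (for right triangles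
  three) copies gives enough points to start from. Covering then supplies more: any two support
  points span another copy, so every new distance has only three possible values and every quadruple
  gives a polynomial equation in them. Squared distances keep all of these conditions
  algebraic.\<close>

definition hsum :: "'a set set \<Rightarrow> ('a \<Rightarrow> real) \<Rightarrow> real" where
  "hsum E w = (\<Sum>e\<in>E. \<Prod>i\<in>e. w i)"

definition hlink :: "'a set set \<Rightarrow> ('a \<Rightarrow> real) \<Rightarrow> 'a \<Rightarrow> real" where
  "hlink E w p = (\<Sum>e\<in>{e\<in>E. p \<in> e}. \<Prod>i\<in>e - {p}. w i)"

text \<open>Sequential compactness of a finite product. It serves both the weights on the simplex
  and the points in the limit of configurations.\<close>

lemma finite_bounded_subseq:
  fixes f :: "nat \<Rightarrow> 'i \<Rightarrow> 'b::heine_borel"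
  assumes "finite S" and "\<And>i. i \<in> S \<Longrightarrow> bounded (range (\<lambda>k. f k i))"
  shows "\<exists>r l. strict_mono (r :: nat \<Rightarrow> nat) \<and> (\<forall>i\<in>S. (\<lambda>k. f (r k) i) \<longlonglongrightarrow> l i)"
  using assms
proof (induction S rule: finite_induct)
  case empty
  show ?case by (auto intro: exI[of _ id] strict_monoI)
next
  case (insert a S)
  then obtain r l where r: "strict_mono (r :: nat \<Rightarrow> nat)" and l: "\<forall>i\<in>S. (\<lambda>k. f (r k) i) \<longlonglongrightarrow> l i"
    by auto
  have "bounded (range (\<lambda>k. f (r k) a))"
    using insert.prems[of a] by (rule bounded_subset) auto
  then obtain l' r' where r': "strict_mono (r' :: nat \<Rightarrow> nat)" and l': "((\<lambda>k. f (r k) a) \<circ> r') \<longlonglongrightarrow> l'"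
    using bounded_imp_convergent_subsequence by blast
  have "(\<lambda>k. f ((r \<circ> r') k) i) \<longlonglongrightarrow> (l(a := l')) i" if "i \<in> insert a S" for i
  proof (cases "i = a")
    case True
    then show ?thesis using l' by (simp add: o_def)
  next
    case False
    then have "(\<lambda>k. f (r k) i) \<longlonglongrightarrow> l i" using that l by auto
    then show ?thesis using False LIMSEQ_subseq_LIMSEQ[OF _ r', of "\<lambda>k. f (r k) i"] by (simp add: o_def)
  qed
  moreover have "strict_mono (r \<circ> r')" using r r' by (rule strict_mono_o)
  ultimately show ?case by blast
qed

text \<open>Moving weight \<open>t\<close> from \<open>q\<close> to \<open>p\<close> changes the
  polynomial by a quadratic in \<open>t\<close>: the linear coefficient is the difference of the
  links, the quadratic one is minus the weight carried by the edges through both vertices. The first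
  yields the multiplier condition, the vanishing of the second the covering property.\<close>

lemma hsum_shift:
  assumes E: "finite E" "\<And>e. e \<in> E \<Longrightarrow> finite e" and pq: "p \<noteq> q"
  shows "hsum E (w(p := w p + t, q := w q - t)) =
    hsum E w + t * (hlink E w p - hlink E w q) - t\<^sup>2 * (\<Sum>e\<in>{e\<in>E. p \<in> e \<and> q \<in> e}. \<Prod>i\<in>e - {p, q}. w i)"
proof -
  let ?w = "w(p := w p + t, q := w q - t)"
  have one: "(\<Prod>i\<in>e. ?w i) = (\<Prod>i\<in>e. w i) + t * ((if p \<in> e then \<Prod>i\<in>e - {p}. w i else 0) - (if q \<in> e then \<Prod>i\<in>e - {q}. w i else 0))
      - t\<^sup>2 * (if p \<in> e \<and> q \<in> e then \<Prod>i\<in>e - {p, q}. w i else 0)" if e: "e \<in> E" for e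
  proof -
    have fe: "finite e" using E e by auto
    have rest: "(\<Prod>i\<in>A. ?w i) = (\<Prod>i\<in>A. w i)" if "p \<notin> A" "q \<notin> A" for A
      using that by (intro prod.cong) auto
    consider "p \<in> e" "q \<in> e" | "p \<in> e" "q \<notin> e" | "p \<notin> e" "q \<in> e" | "p \<notin> e" "q \<notin> e" by blast
    then show ?thesis
    proof cases
      case 1
      have eq: "e = insert p (insert q (e - {p, q}))" "e - {p} = insert q (e - {p, q})" "e - {q} = insert p (e - {p, q})"
        using 1 pq by auto
      have "(\<Prod>i\<in>e. v i) = v p * (v q * (\<Prod>i\<in>e - {p, q}. v i))" for v :: "'a \<Rightarrow> real"
        by (subst eq(1), subst prod.insert) (use fe pq in auto)
      moreover have "(\<Prod>i\<in>e - {p}. w i) = w q * (\<Prod>i\<in>e - {p, q}. w i)"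
        by (subst eq(2), subst prod.insert) (use fe pq in auto)
      moreover have "(\<Prod>i\<in>e - {q}. w i) = w p * (\<Prod>i\<in>e - {p, q}. w i)"
        by (subst eq(3), subst prod.insert) (use fe pq in auto)
      ultimately show ?thesis using 1 pq rest[of "e - {p, q}"] by (simp add: algebra_simps power2_eq_square)
    next
      case 2
      have "(\<Prod>i\<in>e. v i) = v p * (\<Prod>i\<in>e - {p}. v i)" for v :: "'a \<Rightarrow> real"
        using 2 fe by (simp add: prod.remove)
      then show ?thesis using 2 pq rest[of "e - {p}"] by (simp add: algebra_simps)
    next
      case 3
      have "(\<Prod>i\<in>e. v i) = v q * (\<Prod>i\<in>e - {q}. v i)" for v :: "'a \<Rightarrow> real"
        using 3 fe by (simp add: prod.remove)
      then show ?thesis using 3 pq rest[of "e - {q}"] by (simp add: algebra_simps)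
    next
      case 4
      then show ?thesis using rest[of e] by simp
    qed
  qed
  have "hsum E ?w = (\<Sum>e\<in>E. (\<Prod>i\<in>e. w i) + t * ((if p \<in> e then \<Prod>i\<in>e - {p}. w i else 0) - (if q \<in> e then \<Prod>i\<in>e - {q}. w i else 0))
      - t\<^sup>2 * (if p \<in> e \<and> q \<in> e then \<Prod>i\<in>e - {p, q}. w i else 0))"
    unfolding hsum_def by (intro sum.cong) (use one in auto)
  then show ?thesis using E(1)
    by (simp add: hsum_def hlink_def sum.distrib sum_subtractf sum_distrib_left[symmetric] sum.inter_filter[symmetric])
qed

text \<open>Euler's identity for a homogeneous polynomial of degree \<open>k\<close>, the links
  being its partial derivatives.\<close>

lemma sum_weighted_hlink:
  assumes "finite S" "E \<subseteq> Pow S" "\<And>e. e \<in> E \<Longrightarrow> card e = k"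
  shows "(\<Sum>p\<in>S. w p * hlink E w p) = real k * hsum E w"
proof -
  have fE: "finite E" using assms by (meson finite_Pow_iff finite_subset)
  have "(\<Sum>p\<in>S. w p * hlink E w p) = (\<Sum>p\<in>S. \<Sum>e\<in>{e\<in>E. p \<in> e}. \<Prod>i\<in>e. w i)"
  proof (intro sum.cong refl)
    fix p
    have "w p * (\<Prod>i\<in>e - {p}. w i) = (\<Prod>i\<in>e. w i)" if "e \<in> E" "p \<in> e" for e
      using that assms by (metis (no_types) PowD finite_subset prod.remove subsetD)
    then show "w p * hlink E w p = (\<Sum>e\<in>{e\<in>E. p \<in> e}. \<Prod>i\<in>e. w i)"
      by (simp add: hlink_def sum_distrib_left)
  qed
  also have "\<dots> = (\<Sum>e\<in>E. \<Sum>p\<in>{p\<in>S. p \<in> e}. \<Prod>i\<in>e. w i)"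
    by (rule sum.swap_restrict) (use assms fE in auto)
  also have "\<dots> = (\<Sum>e\<in>E. real k * (\<Prod>i\<in>e. w i))"
  proof (intro sum.cong refl)
    fix e assume e: "e \<in> E"
    then have "{p\<in>S. p \<in> e} = e" using assms by auto
    then show "(\<Sum>p\<in>{p\<in>S. p \<in> e}. \<Prod>i\<in>e. w i) = real k * (\<Prod>i\<in>e. w i)" using assms e by simp
  qed
  finally show ?thesis by (simp add: hsum_def sum_distrib_left)
qed

lemma hsum_attains_max:
  assumes S: "finite S" "S \<noteq> {}" and E: "E \<subseteq> Pow S"
  shows "\<exists>w. (\<forall>i\<in>S. 0 \<le> w i) \<and> sum w S = 1 \<and> 
     (\<forall>v. (\<forall>i\<in>S. 0 \<le> v i) \<and> sum v S = 1 \<longrightarrow> hsum E v \<le> hsum E w)"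
proof -
  define D where "D = {w :: 'a \<Rightarrow> real. (\<forall>i\<in>S. 0 \<le> w i) \<and> sum w S = 1}"
  define m where "m = Sup (hsum E ` D)"
  have le1: "w i \<le> 1" if "w \<in> D" "i \<in> S" for w i
    using that member_le_sum[of i S w] S by (auto simp: D_def)
  have bd: "hsum E w \<le> card E" if "w \<in> D" for w
  proof -
    have "(\<Prod>i\<in>e. w i) \<le> 1" if "e \<in> E" for e
      using that E le1[OF \<open>w \<in> D\<close>] \<open>w \<in> D\<close> by (intro prod_le_1) (auto simp: D_def)
    then have "hsum E w \<le> (\<Sum>e\<in>E. 1)" unfolding hsum_def by (intro sum_mono)
    then show ?thesis by simp
  qed
  have bdd: "bdd_above (hsum E ` D)" using bd by (intro bdd_aboveI2) auto
  have "(\<lambda>_. 1 / card S) \<in> D" using S by (auto simp: D_def)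
  then have ne: "hsum E ` D \<noteq> {}" by auto
  have "\<exists>w\<in>D. m - 1 / Suc k < hsum E w" for k
  proof -
    have "\<exists>y\<in>hsum E ` D. m - 1 / Suc k < y"
      unfolding m_def by (rule less_cSupD[OF ne]) (simp add: m_def)
    then show ?thesis by auto
  qed
  then obtain f where f: "\<And>k. f k \<in> D" "\<And>k. m - 1 / Suc k < hsum E (f k)" by metis
  have "bounded (range (\<lambda>k. f k i))" if "i \<in> S" for i
    unfolding bounded_iff using f(1) that le1 by (intro exI[of _ 1]) (fastforce simp: D_def)
  then obtain r l where r: "strict_mono (r :: nat \<Rightarrow> nat)" and l: "\<And>i. i \<in> S \<Longrightarrow> (\<lambda>k. f (r k) i) \<longlonglongrightarrow> l i"
    using finite_bounded_subseq[OF S(1), of f] by blast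
  have "0 \<le> l i" if "i \<in> S" for i
    using l[OF that] by (rule LIMSEQ_le_const) (use f that in \<open>auto simp: D_def\<close>)
  moreover have "(\<lambda>k. sum (f (r k)) S) \<longlonglongrightarrow> sum l S" using l by (intro tendsto_sum)
  then have "sum l S = 1" using f(1) by (simp add: D_def LIMSEQ_const_iff)
  moreover have "(\<lambda>k. hsum E (f (r k))) \<longlonglongrightarrow> hsum E l"
    unfolding hsum_def using l E by (intro tendsto_sum tendsto_prod) auto
  moreover have "(\<lambda>k. m - 1 / Suc (r k)) \<longlonglongrightarrow> m"
    using LIMSEQ_subseq_LIMSEQ[OF tendsto_diff[OF tendsto_const LIMSEQ_inverse_real_of_nat] r, of m]
    by (simp add: o_def inverse_eq_divide)
  ultimately have "m \<le> hsum E l" "\<forall>i\<in>S. 0 \<le> l i" "sum l S = 1"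
    using LIMSEQ_le[of "\<lambda>k. m - 1 / Suc (r k)" m "\<lambda>k. hsum E (f (r k))"] f(2) less_imp_le by blast+
  moreover have "hsum E v \<le> m" if "v \<in> D" for v
    unfolding m_def using bdd that by (auto intro: cSup_upper)
  ultimately show ?thesis unfolding D_def by fastforce
qed

text \<open>The argument of Motzkin and Straus for graphs, one uniformity higher: among the
  maximisers one with the fewest non-zero weights is taken. Edges leaving its support contribute
  nothing, and the value at uniform weights compares the number of edges with the maximum.\<close>

lemma lagrangian_reduction:
  assumes S0: "finite S0" "S0 \<noteq> {}" and E0: "E0 \<subseteq> Pow S0" and card3: "\<And>e. e \<in> E0 \<Longrightarrow> card e = 3"
  obtains S w where "S \<subseteq> S0" "\<And>i. i \<in> S \<Longrightarrow> 0 < w i" "sum w S = 1"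
    "\<And>i j. \<lbrakk>i \<in> S; j \<in> S; i \<noteq> j\<rbrakk> \<Longrightarrow> \<exists>e\<in>{e\<in>E0. e \<subseteq> S}. i \<in> e \<and> j \<in> e"
    "\<And>i. i \<in> S \<Longrightarrow> hlink {e\<in>E0. e \<subseteq> S} w i = 3 * hsum {e\<in>E0. e \<subseteq> S} w"
    "real (card E0) \<le> real (card S0) ^ 3 * hsum {e\<in>E0. e \<subseteq> S} w"
proof -
  define D where "D = {w :: 'a \<Rightarrow> real. (\<forall>i\<in>S0. 0 \<le> w i) \<and> sum w S0 = 1}"
  define opt where "opt w \<longleftrightarrow> w \<in> D \<and> (\<forall>v\<in>D. hsum E0 v \<le> hsum E0 w)" for w
  have fE0: "finite E0" using assms by (meson finite_Pow_iff finite_subset)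
  have fe: "finite e" if "e \<in> E0" for e using card3[OF that] card.infinite by force
  have "\<exists>w. opt w" using hsum_attains_max[OF S0 E0] by (auto simp: opt_def D_def)
  then obtain w where w: "opt w" and least: "\<And>v. opt v \<Longrightarrow> card {i\<in>S0. w i \<noteq> 0} \<le> card {i\<in>S0. v i \<noteq> 0}"
    using ex_has_least_nat[of opt _ "\<lambda>w. card {i\<in>S0. w i \<noteq> 0}"] by blast
  define S where "S = {i\<in>S0. w i \<noteq> 0}"
  define E where "E = {e\<in>E0. e \<subseteq> S}"
  have wD: "w \<in> D" and wmax: "\<And>v. v \<in> D \<Longrightarrow> hsum E0 v \<le> hsum E0 w" using w by (auto simp: opt_def)
  have S_sub: "S \<subseteq> S0" by (auto simp: S_def)
  have fS: "finite S" using S0 S_sub finite_subset by blast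
  have pos: "0 < w i" if "i \<in> S" for i using that wD by (force simp: S_def D_def)
  have sum1: "sum w S = 1"
    using wD S0 unfolding D_def S_def by (simp add: sum.mono_neutral_left[of S0 "{i\<in>S0. w i \<noteq> 0}" w])
  have zero: "\<exists>i\<in>e. i \<notin> S \<and> w i = 0" if "e \<in> E0" "e \<notin> E" for e
    using that E0 by (auto simp: E_def S_def)
  have hsumE: "hsum E0 w = hsum E w"
    unfolding hsum_def
  proof (rule sum.mono_neutral_right[OF fE0])
    show "\<forall>e\<in>E0 - E. (\<Prod>i\<in>e. w i) = 0" using zero fe by (metis DiffE prod_zero)
  qed (auto simp: E_def)
  have linkE: "hlink E0 w p = hlink E w p" if "p \<in> S" for p
    unfolding hlink_def
  proof (rule sum.mono_neutral_right)
    show "\<forall>e\<in>{e \<in> E0. p \<in> e} - {e \<in> E. p \<in> e}. (\<Prod>i\<in>e - {p}. w i) = 0"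
    proof
      fix e assume e: "e \<in> {e \<in> E0. p \<in> e} - {e \<in> E. p \<in> e}"
      then obtain i where "i \<in> e" "i \<notin> S" "w i = 0" using zero[of e] by auto
      then have "i \<in> e - {p}" using that by auto
      then show "(\<Prod>i\<in>e - {p}. w i) = 0" using fe e \<open>w i = 0\<close> by (intro prod_zero) auto
    qed
  qed (use fE0 in \<open>auto simp: E_def\<close>)
  have shift_D: "w(p := w p + t, q := w q - t) \<in> D" if "p \<in> S" "q \<in> S" "p \<noteq> q" "- w p \<le> t" "t \<le> w q" for p q t
  proof -
    have pq: "p \<in> S0" "q \<in> S0" using that S_sub by auto
    have "sum v S0 = v p + (v q + sum v (S0 - {p} - {q}))" for v :: "'a \<Rightarrow> real"
      using pq that(3) S0(1) by (simp add: sum.remove[of S0 p] sum.remove[of "S0 - {p}" q])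
    then have "sum (w(p := w p + t, q := w q - t)) S0 = sum w S0" using that(3) by simp
    then show ?thesis using wD that by (auto simp: D_def)
  qed
  define C where "C p q = (\<Sum>e\<in>{e\<in>E0. p \<in> e \<and> q \<in> e}. \<Prod>i\<in>e - {p, q}. w i)" for p q
  have shift: "t * (hlink E w p - hlink E w q) - t\<^sup>2 * C p q \<le> 0"
    if "p \<in> S" "q \<in> S" "p \<noteq> q" "- w p \<le> t" "t \<le> w q" for p q t
    using wmax[OF shift_D[OF that]] hsum_shift[OF fE0 fe that(3), where w = w and t = t] that linkE
    by (simp add: C_def)
  have C0: "0 \<le> C p q" for p q
    unfolding C_def using E0 wD by (intro sum_nonneg prod_nonneg) (auto simp: D_def)
  have le: "hlink E w p \<le> hlink E w q" if pq: "p \<in> S" "q \<in> S" for p q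
  proof (rule ccontr)
    assume neg: "\<not> ?thesis"
    then have ne: "p \<noteq> q" by auto
    define d where "d = hlink E w p - hlink E w q"
    \<comment> \<open>A step so small that the quadratic loss stays below the linear gain
      \<open>t * d\<close>, capped at \<open>w q\<close> to remain in the simplex; the
      \<open>+ 1\<close> keeps the denominator positive.\<close>
    define t where "t = min (w q) (d / (2 * (C p q + 1)))"
    have d: "d > 0" using neg by (simp add: d_def)
    then have t: "0 < t" "t \<le> w q" "t \<le> d / (2 * (C p q + 1))" using pos[OF pq(2)] C0[of p q] by (auto simp: t_def)
    have "t * C p q \<le> d / (2 * (C p q + 1)) * C p q" using t C0 by (intro mult_right_mono) auto
    also have "\<dots> < d" using d C0[of p q] by (simp add: field_simps) (smt (verit) mult_nonneg_nonneg)
    finally have "t * (t * C p q) < t * d" using t by simp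
    then show False using shift[OF pq ne, of t] t pos[OF pq(1)] by (simp add: d_def power2_eq_square algebra_simps)
  qed
  then have eq: "hlink E w p = hlink E w q" if "p \<in> S" "q \<in> S" for p q using that by (simp add: antisym)
  have E_sub: "E \<subseteq> Pow S" by (auto simp: E_def)
  have kkt: "hlink E w i = 3 * hsum E w" if i: "i \<in> S" for i
  proof -
    have "3 * hsum E w = (\<Sum>p\<in>S. w p * hlink E w p)"
      using sum_weighted_hlink[OF fS E_sub, of 3 w] card3 by (simp add: E_def)
    also have "\<dots> = (\<Sum>p\<in>S. w p * hlink E w i)" using eq[OF i] by (intro sum.cong) auto
    also have "\<dots> = hlink E w i" using sum1 by (simp add: sum_distrib_right[symmetric])
    finally show ?thesis by simp
  qed
  have cover: "\<exists>e\<in>E. p \<in> e \<and> q \<in> e" if pq: "p \<in> S" "q \<in> S" "p \<noteq> q" for p q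
  proof (rule ccontr)
    assume no: "\<not> ?thesis"
    have "C p q = 0" unfolding C_def
    proof (rule sum.neutral, rule ballI)
      fix e assume e: "e \<in> {e \<in> E0. p \<in> e \<and> q \<in> e}"
      then obtain i where "i \<in> e" "i \<notin> S" "w i = 0" using zero[of e] no by auto
      then have "i \<in> e - {p, q}" using pq by auto
      then show "(\<Prod>i\<in>e - {p, q}. w i) = 0" using fe e \<open>w i = 0\<close> by (intro prod_zero) auto
    qed
    \<comment> \<open>With equal links and no edge through both vertices, moving all of the weight
      of \<open>q\<close> to \<open>p\<close> keeps the maximum but removes \<open>q\<close> from
      the support.\<close>
    define v where "v = w(p := w p + w q, q := w q - w q)"
    have "hsum E0 v = hsum E0 w"
      unfolding v_def using hsum_shift[OF fE0 fe pq(3), where w = w and t = "w q"] \<open>C p q = 0\<close> eq[OF pq(1,2)] linkE pq by (simp add: C_def)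
    moreover have "v \<in> D" unfolding v_def by (rule shift_D[OF pq]) (use pos[OF pq(1)] pos[OF pq(2)] in auto)
    ultimately have "opt v" using wmax by (simp add: opt_def)
    then have "card S \<le> card {i\<in>S0. v i \<noteq> 0}" using least by (simp add: S_def)
    moreover have "{i\<in>S0. v i \<noteq> 0} \<subseteq> S - {q}" using pq by (auto simp: v_def S_def)
    then have "card {i\<in>S0. v i \<noteq> 0} < card S" using fS pq by (intro psubset_card_mono) auto
    ultimately show False by simp
  qed
  have bound: "real (card E0) \<le> real (card S0) ^ 3 * hsum E w"
  proof -
    define n where "n = real (card S0)"
    have n: "n > 0" using S0 by (auto simp: n_def card_gt_0_iff)
    have "(\<lambda>_. 1 / n) \<in> D" using S0 n by (auto simp: D_def n_def)
    then have "hsum E0 (\<lambda>_. 1 / n) \<le> hsum E w" using wmax hsumE by simp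
    moreover have "hsum E0 (\<lambda>_. 1 / n) = card E0 * (1 / n) ^ 3" using card3 by (simp add: hsum_def)
    ultimately show ?thesis using n unfolding n_def[symmetric] by (simp add: field_simps)
  qed
  show thesis
    by (rule that[of S w]) (use S_sub pos sum1 cover kkt bound in \<open>auto simp: E_def\<close>)
qed

text \<open>The maximisers supplied by \<open>lagrangian_reduction\<close>: by minimality of the support every two vertices are covered
  by an edge, and \<open>stationary\<close> is the Lagrange multiplier condition.\<close>

locale weighted_hypergraph =
  fixes S :: "'a set" and E :: "'a set set" and w :: "'a \<Rightarrow> real"
  assumes finite_S: "finite S" and E_sub: "E \<subseteq> Pow S" and card_edge: "e \<in> E \<Longrightarrow> card e = 3"
    and w_pos: "i \<in> S \<Longrightarrow> 0 < w i" and w_sum: "sum w S = 1"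
    and cover: "\<lbrakk>i \<in> S; j \<in> S; i \<noteq> j\<rbrakk> \<Longrightarrow> \<exists>e\<in>E. i \<in> e \<and> j \<in> e"
    and stationary: "i \<in> S \<Longrightarrow> hlink E w i = 3 * hsum E w"
begin

lemma finite_E: "finite E"
  using finite_S E_sub by (meson finite_Pow_iff finite_subset)

lemma edge_sub: "e \<in> E \<Longrightarrow> e \<subseteq> S"
  using E_sub by auto

lemma S_ne: "S \<noteq> {}"
  using w_sum by auto

lemma edge_through:
  assumes "e \<in> E" "v \<in> e"
  obtains a b where "e = {v, a, b}" "v \<noteq> a" "v \<noteq> b" "a \<noteq> b" "a \<in> S" "b \<in> S"
proof -
  have "card (e - {v}) = 2" using card_edge[OF assms(1)] assms(2) by simp
  then obtain a b where ab: "e - {v} = {a, b}" "a \<noteq> b" by (auto simp: card_2_iff)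
  then have "e = {v, a, b}" "v \<noteq> a" "v \<noteq> b" using assms by auto
  then show thesis using that ab edge_sub[OF assms(1)] by auto
qed

lemma edge_through2:
  assumes "e \<in> E" "u \<in> e" "v \<in> e" "u \<noteq> v"
  obtains r where "e = {u, v, r}" "r \<noteq> u" "r \<noteq> v" "r \<in> S"
proof -
  obtain a b where ab: "e = {u, a, b}" "u \<noteq> a" "u \<noteq> b" "a \<noteq> b" "a \<in> S" "b \<in> S"
    using assms(1,2) by (rule edge_through)
  then have "v = a \<or> v = b" using assms(3,4) by auto
  then show thesis
  proof
    assume "v = a"
    then show thesis using ab by (intro that[of b]) auto
  next
    assume "v = b"
    then show thesis using ab by (intro that[of a]) auto
  qed
qed

lemma third_point:
  assumes "i \<in> S" "j \<in> S" "i \<noteq> j"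
  obtains k where "k \<in> S" "k \<noteq> i" "k \<noteq> j" "{i, j, k} \<in> E"
proof -
  obtain e where e: "e \<in> E" "i \<in> e" "j \<in> e" using cover assms by blast
  then obtain k where "e = {i, j, k}" "k \<noteq> i" "k \<noteq> j" "k \<in> S" using assms(3) by (rule edge_through2)
  then show thesis using that e by blast
qed

section \<open>Bounds on the link of a vertex from its codegrees\<close>

lemma codegree_sum:
  assumes v: "v \<in> S" and deg: "\<And>u. \<lbrakk>u \<in> S; u \<noteq> v\<rbrakk> \<Longrightarrow> card {e\<in>E. u \<in> e \<and> v \<in> e} \<le> k"
  shows "(\<Sum>e\<in>{e\<in>E. v \<in> e}. sum w (e - {v})) \<le> real k * (1 - w v)"
proof -
  have "(\<Sum>e\<in>{e\<in>E. v \<in> e}. sum w (e - {v})) = (\<Sum>e\<in>{e\<in>E. v \<in> e}. \<Sum>u\<in>{u\<in>S - {v}. u \<in> e}. w u)"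
    using E_sub by (intro sum.cong) auto
  also have "\<dots> = (\<Sum>u\<in>S - {v}. \<Sum>e\<in>{e\<in>{e\<in>E. v \<in> e}. u \<in> e}. w u)"
    by (rule sum.swap_restrict) (use finite_S finite_E in auto)
  also have "\<dots> \<le> (\<Sum>u\<in>S - {v}. real k * w u)"
  proof (intro sum_mono)
    fix u assume u: "u \<in> S - {v}"
    have "{e\<in>{e\<in>E. v \<in> e}. u \<in> e} = {e\<in>E. u \<in> e \<and> v \<in> e}" by auto
    then show "(\<Sum>e\<in>{e\<in>{e\<in>E. v \<in> e}. u \<in> e}. w u) \<le> real k * w u"
      using deg[of u] u w_pos[of u] by simp
  qed
  also have "\<dots> = real k * (1 - w v)"
    using w_sum v finite_S by (simp add: sum_distrib_left[symmetric] sum_diff1)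
  finally show ?thesis .
qed

text \<open>Both weights in a link pair are at most \<open>w v\<close>, so their product is at most
  \<open>w v / 2\<close> times their sum; the sums are counted by
  \<open>codegree_sum\<close>.\<close>

lemma hlink_le_codegree:
  assumes v: "v \<in> S" and max: "\<And>u. u \<in> S \<Longrightarrow> w u \<le> w v"
    and deg: "\<And>u. \<lbrakk>u \<in> S; u \<noteq> v\<rbrakk> \<Longrightarrow> card {e\<in>E. u \<in> e \<and> v \<in> e} \<le> k"
  shows "hlink E w v \<le> real k * w v * (1 - w v) / 2"
proof -
  have "hlink E w v \<le> (\<Sum>e\<in>{e\<in>E. v \<in> e}. w v / 2 * sum w (e - {v}))"
    unfolding hlink_def
  proof (intro sum_mono)
    fix e assume "e \<in> {e\<in>E. v \<in> e}"
    then have "e \<in> E" "v \<in> e" by auto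
    then obtain a b where e: "e = {v, a, b}" "v \<noteq> a" "v \<noteq> b" "a \<noteq> b" "a \<in> S" "b \<in> S"
      by (rule edge_through)
    then have eq: "e - {v} = {a, b}" by auto
    have "w a * w b \<le> w v * w b" "w a * w b \<le> w a * w v"
      using max[OF e(5)] max[OF e(6)] w_pos[OF e(5)] w_pos[OF e(6)] by (auto intro: mult_right_mono mult_left_mono)
    then show "prod w (e - {v}) \<le> w v / 2 * sum w (e - {v})"
      using e(4) by (simp add: eq algebra_simps)
  qed
  also have "\<dots> = w v / 2 * (\<Sum>e\<in>{e\<in>E. v \<in> e}. sum w (e - {v}))" by (simp add: sum_distrib_left)
  also have "\<dots> \<le> w v / 2 * (real k * (1 - w v))"
    using codegree_sum[OF v deg] w_pos[OF v] by (intro mult_left_mono) auto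
  finally show ?thesis by (simp add: algebra_simps)
qed

text \<open>With codegree one the link pairs are disjoint, so their sums add up to at most
  \<open>1 - w v\<close>. The rest is \<open>4 * a * b \<le> (a + b)^2\<close> and the bound of a
  sum of squares by the square of the sum.\<close>

lemma hlink_le_matching:
  assumes v: "v \<in> S"
    and deg: "\<And>u. \<lbrakk>u \<in> S; u \<noteq> v\<rbrakk> \<Longrightarrow> card {e\<in>E. u \<in> e \<and> v \<in> e} \<le> 1"
  shows "hlink E w v \<le> (1 - w v)\<^sup>2 / 4"
proof -
  let ?L = "{e\<in>E. v \<in> e}" and ?t = "\<Sum>e\<in>{e\<in>E. v \<in> e}. sum w (e - {v})"
  have nn: "0 \<le> sum w (e - {v})" if "e \<in> ?L" for e
    using that edge_sub w_pos by (intro sum_nonneg) (auto simp: less_imp_le subset_iff)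
  have le: "sum w (e - {v}) \<le> ?t" if "e \<in> ?L" for e
    using that nn finite_E by (intro member_le_sum) auto
  have "hlink E w v \<le> (\<Sum>e\<in>?L. ?t / 4 * sum w (e - {v}))"
    unfolding hlink_def
  proof (intro sum_mono)
    fix e assume eL: "e \<in> ?L"
    then have "e \<in> E" "v \<in> e" by auto
    then obtain a b where e: "e = {v, a, b}" "v \<noteq> a" "v \<noteq> b" "a \<noteq> b" "a \<in> S" "b \<in> S"
      by (rule edge_through)
    then have eq: "e - {v} = {a, b}" by auto
    have "4 * (w a * w b) \<le> (w a + w b) * (w a + w b)"
      using zero_le_power2[of "w a - w b"] by (simp add: power2_eq_square algebra_simps)
    also have "\<dots> \<le> ?t * (w a + w b)"
      using le[OF eL] nn[OF eL] e(4) by (intro mult_right_mono) (auto simp: eq)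
    finally show "prod w (e - {v}) \<le> ?t / 4 * sum w (e - {v})" using e(4) by (simp add: eq)
  qed
  also have "\<dots> = ?t / 4 * ?t" by (rule sum_distrib_left[symmetric])
  also have "\<dots> = ?t\<^sup>2 / 4" by (simp add: power2_eq_square)
  also have "\<dots> \<le> (1 - w v)\<^sup>2 / 4"
    using codegree_sum[OF v deg] sum_nonneg[of ?L "\<lambda>e. sum w (e - {v})"] nn by (intro divide_right_mono power_mono) auto
  finally show ?thesis .
qed

lemma max_vertex: obtains v where "v \<in> S" "\<And>u. u \<in> S \<Longrightarrow> w u \<le> w v"
proof -
  have "Max (w ` S) \<in> w ` S" using finite_S S_ne by (intro Max_in) auto
  then obtain v where "v \<in> S" "w v = Max (w ` S)" by auto
  then show thesis using that[of v] Max_ge[of "w ` S"] finite_S by auto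
qed

lemma w_le_1: "v \<in> S \<Longrightarrow> w v \<le> 1"
  using member_le_sum[of v S w] finite_S w_sum w_pos by (simp add: less_imp_le)

lemma third_points_of_codegree:
  assumes uv: "u \<noteq> v" and "k \<le> card {e\<in>E. u \<in> e \<and> v \<in> e}"
  obtains R where "card R = k" "\<forall>r\<in>R. r \<in> S \<and> r \<noteq> u \<and> r \<noteq> v \<and> {u, v, r} \<in> E"
proof -
  let ?F = "{e\<in>E. u \<in> e \<and> v \<in> e}" and ?R = "{r\<in>S. r \<noteq> u \<and> r \<noteq> v \<and> {u, v, r} \<in> E}"
  have "?F \<subseteq> (\<lambda>r. {u, v, r}) ` ?R"
  proof
    fix e assume e: "e \<in> ?F"
    then have "e \<in> E" "u \<in> e" "v \<in> e" by auto
    then obtain r where "e = {u, v, r}" "r \<noteq> u" "r \<noteq> v" "r \<in> S"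
      using uv by (rule edge_through2)
    then show "e \<in> (\<lambda>r. {u, v, r}) ` ?R" using e by auto
  qed
  then have "card ?F \<le> card ?R" using finite_S by (intro surj_card_le) auto
  then obtain R where R: "R \<subseteq> ?R" "card R = k"
    using obtain_subset_with_card_n[of k ?R] assms(2) by (auto dest: order_trans)
  then show thesis using that[of R] by blast
qed

text \<open>Compare \<open>stationary\<close> at a vertex of maximal weight \<open>m\<close> with both bounds on its link: the smaller of
  \<open>m (1 - m) / 2\<close> and \<open>(1 - m)\<^sup>2 / 4\<close> is at most \<open>1 / 9\<close>.\<close>

lemma codegree_one_bound:
  obtains "hsum E w \<le> 1 / 27"
  | u v r s where "u \<in> S" "v \<in> S" "r \<in> S" "s \<in> S" "distinct [u, v, r, s]" "{u, v, r} \<in> E" "{u, v, s} \<in> E"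
proof -
  obtain v where v: "v \<in> S" "\<And>u. u \<in> S \<Longrightarrow> w u \<le> w v"
    by (rule max_vertex) (rule that)
  show thesis
  proof (cases "\<exists>u\<in>S. u \<noteq> v \<and> 2 \<le> card {e\<in>E. u \<in> e \<and> v \<in> e}")
    case True
    then obtain u where u: "u \<in> S" "u \<noteq> v" and deg: "2 \<le> card {e\<in>E. u \<in> e \<and> v \<in> e}" by blast
    obtain R where R: "card R = 2" "\<forall>r\<in>R. r \<in> S \<and> r \<noteq> u \<and> r \<noteq> v \<and> {u, v, r} \<in> E"
      using u(2) deg by (rule third_points_of_codegree)
    obtain r s where "R = {r, s}" "r \<noteq> s" using R(1) by (auto simp: card_2_iff)
    then show thesis using u v bspec[OF R(2), of r] bspec[OF R(2), of s] by (intro that(2)[of u v r s]) auto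
  next
    case False
    have deg: "card {e\<in>E. u \<in> e \<and> v \<in> e} \<le> 1" if "u \<in> S" "u \<noteq> v" for u
    proof -
      have "\<not> 2 \<le> card {e\<in>E. u \<in> e \<and> v \<in> e}" using False that by blast
      then show ?thesis by linarith
    qed
    have "hlink E w v \<le> 1 / 9"
    proof (cases "w v \<le> 1 / 3")
      case True
      have "w v * (1 - w v) \<le> 2 / 9"
        using mult_nonneg_nonneg[of "1/3 - w v" "2/3 - w v"] True by (simp add: algebra_simps)
      then show ?thesis using hlink_le_codegree[OF v, of 1] deg by simp
    next
      case False
      then have "(1 - w v)\<^sup>2 \<le> (2/3)\<^sup>2" using w_le_1[OF v(1)] by (intro power_mono) auto
      then show ?thesis using hlink_le_matching[OF v(1)] deg by (simp add: power2_eq_square)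
    qed
    then show thesis using that(1) stationary[OF v(1)] by simp
  qed
qed

text \<open>The vertex colouring makes the link graph of \<open>v\<close> tripartite, so its weight
  is at most the second elementary symmetric function of the three class weights, which is largest
  when these are equal.\<close>

lemma hlink_le_tripartite:
  assumes v: "v \<in> S" and c: "\<And>a b. {v, a, b} \<in> E \<Longrightarrow> a \<noteq> v \<Longrightarrow> b \<noteq> v \<Longrightarrow> a \<noteq> b \<Longrightarrow> (c a :: nat) \<noteq> c b"
    and c3: "\<And>a. a \<in> S \<Longrightarrow> c a < 3"
  shows "hlink E w v \<le> (1 - w v)\<^sup>2 / 3"
proof -
  define A where "A k = {a\<in>S - {v}. c a = k}" for k
  define W where "W k = sum w (A k)" for k
  have fA: "finite (A k)" for k using finite_S by (auto simp: A_def)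
  \<comment> \<open>The cyclic orientation lists each unordered pair of different classes exactly
    once.\<close>
  let ?P = "A 0 \<times> A 1 \<union> (A 1 \<times> A 2 \<union> A 2 \<times> A 0)"
  have "hlink E w v \<le> (\<Sum>(a, b)\<in>?P. w a * w b)"
    unfolding hlink_def
  proof (rule sum_le_included[where i = "\<lambda>(a, b). {v, a, b}"])
    show "\<forall>p\<in>?P. 0 \<le> (case p of (a, b) \<Rightarrow> w a * w b)" using w_pos by (auto simp: A_def less_imp_le)
    show "\<forall>e\<in>{e \<in> E. v \<in> e}. \<exists>p\<in>?P. (case p of (a, b) \<Rightarrow> {v, a, b}) = e \<and> prod w (e - {v}) \<le> (case p of (a, b) \<Rightarrow> w a * w b)"
    proof
      fix e assume "e \<in> {e \<in> E. v \<in> e}"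
      then have eE: "e \<in> E" "v \<in> e" by auto
      then obtain a b where e: "e = {v, a, b}" "v \<noteq> a" "v \<noteq> b" "a \<noteq> b" "a \<in> S" "b \<in> S"
        by (rule edge_through)
      then have eq: "e - {v} = {a, b}" by auto
      have ne: "c a \<noteq> c b" using c[of a b] e eE by auto
      have "c a = 0 \<or> c a = 1 \<or> c a = 2" "c b = 0 \<or> c b = 1 \<or> c b = 2"
        using c3[of a] c3[of b] e by linarith+
      then have "(a, b) \<in> ?P \<or> (b, a) \<in> ?P" using ne e by (auto simp: A_def)
      then show "\<exists>p\<in>?P. (case p of (a, b) \<Rightarrow> {v, a, b}) = e \<and> prod w (e - {v}) \<le> (case p of (a, b) \<Rightarrow> w a * w b)"
      proof
        assume "(a, b) \<in> ?P"
        then show ?thesis using e(1,4) eq by (intro bexI[of _ "(a, b)"]) auto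
      next
        assume "(b, a) \<in> ?P"
        then show ?thesis using e(1,4) eq by (intro bexI[of _ "(b, a)"]) auto
      qed
    qed
  qed (use fA finite_E in auto)
  also have "\<dots> = (\<Sum>(a, b)\<in>A 0 \<times> A 1. w a * w b) + (\<Sum>(a, b)\<in>A 1 \<times> A 2 \<union> A 2 \<times> A 0. w a * w b)"
    by (intro sum.union_disjoint) (use fA in \<open>auto simp: A_def\<close>)
  also have "(\<Sum>(a, b)\<in>A 1 \<times> A 2 \<union> A 2 \<times> A 0. w a * w b) =
      (\<Sum>(a, b)\<in>A 1 \<times> A 2. w a * w b) + (\<Sum>(a, b)\<in>A 2 \<times> A 0. w a * w b)"
    by (intro sum.union_disjoint) (use fA in \<open>auto simp: A_def\<close>)
  also have "(\<Sum>(a, b)\<in>A 0 \<times> A 1. w a * w b) + \<dots> = W 0 * W 1 + (W 1 * W 2 + W 2 * W 0)"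
    by (simp only: W_def sum_product sum.cartesian_product)
  also have "\<dots> \<le> (W 0 + W 1 + W 2)\<^sup>2 / 3"
    using zero_le_power2[of "W 0 - W 1"] zero_le_power2[of "W 1 - W 2"] zero_le_power2[of "W 0 - W 2"]
    by (simp add: power2_eq_square algebra_simps)
  also have "W 0 + W 1 + W 2 = 1 - w v"
  proof -
    have "S - {v} = A 0 \<union> (A 1 \<union> A 2)" using c3 by (force simp: A_def)
    then have "sum w (S - {v}) = sum w (A 0 \<union> (A 1 \<union> A 2))" by (rule arg_cong)
    also have "\<dots> = W 0 + sum w (A 1 \<union> A 2)"
      unfolding W_def by (intro sum.union_disjoint) (use fA in \<open>auto simp: A_def\<close>)
    also have "sum w (A 1 \<union> A 2) = W 1 + W 2"
      unfolding W_def by (intro sum.union_disjoint) (use fA in \<open>auto simp: A_def\<close>)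
    also have "sum w (S - {v}) = 1 - w v"
      using sum_diff1[OF finite_S, of w v] w_sum v by simp
    finally show ?thesis by linarith
  qed
  finally show ?thesis .
qed

text \<open>With maximal weight \<open>m\<close> the two link estimates are
  \<open>m * (1 - m)\<close> and \<open>(1 - m)^2 / 3\<close>. Both equal \<open>3 / 16\<close> at
  \<open>m = 1 / 4\<close>, the first increasing and the second decreasing there, and
  \<open>stationary\<close> divides this by 3.\<close>

lemma codegree_two_bound:
  assumes tri: "\<And>v. v \<in> S \<Longrightarrow> \<exists>c. (\<forall>a b. {v, a, b} \<in> E \<longrightarrow> a \<noteq> v \<longrightarrow> b \<noteq> v \<longrightarrow> a \<noteq> b \<longrightarrow> (c a :: nat) \<noteq> c b) \<and> (\<forall>a\<in>S. c a < 3)"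
  obtains "hsum E w \<le> 1 / 16"
  | u v r s t where "u \<in> S" "v \<in> S" "r \<in> S" "s \<in> S" "t \<in> S" "distinct [u, v, r, s, t]"
      "{u, v, r} \<in> E" "{u, v, s} \<in> E" "{u, v, t} \<in> E"
proof -
  obtain v where v: "v \<in> S" "\<And>u. u \<in> S \<Longrightarrow> w u \<le> w v"
    by (rule max_vertex) (rule that)
  show thesis
  proof (cases "\<exists>u\<in>S. u \<noteq> v \<and> 3 \<le> card {e\<in>E. u \<in> e \<and> v \<in> e}")
    case True
    then obtain u where u: "u \<in> S" "u \<noteq> v" and deg: "3 \<le> card {e\<in>E. u \<in> e \<and> v \<in> e}" by blast
    obtain R where R: "card R = 3" "\<forall>r\<in>R. r \<in> S \<and> r \<noteq> u \<and> r \<noteq> v \<and> {u, v, r} \<in> E"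
      using u(2) deg by (rule third_points_of_codegree)
    obtain r s t where "R = {r, s, t}" "r \<noteq> s" "r \<noteq> t" "s \<noteq> t" using R(1) by (auto simp: card_3_iff)
    then show thesis using u v bspec[OF R(2), of r] bspec[OF R(2), of s] bspec[OF R(2), of t] by (intro that(2)[of u v r s t]) auto
  next
    case False
    have deg: "card {e\<in>E. u \<in> e \<and> v \<in> e} \<le> 2" if "u \<in> S" "u \<noteq> v" for u
    proof -
      have "\<not> 3 \<le> card {e\<in>E. u \<in> e \<and> v \<in> e}" using False that by blast
      then show ?thesis by linarith
    qed
    have "hlink E w v \<le> 3 / 16"
    proof (cases "w v \<le> 1 / 4")
      case True
      have "w v * (1 - w v) \<le> 3 / 16"
        using mult_nonneg_nonneg[of "1/4 - w v" "3/4 - w v"] True by (simp add: algebra_simps)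
      then show ?thesis using hlink_le_codegree[OF v, of 2] deg by simp
    next
      case False
      then have "(1 - w v)\<^sup>2 \<le> (3/4)\<^sup>2" using w_le_1[OF v(1)] by (intro power_mono) auto
      moreover obtain c where "\<forall>a b. {v, a, b} \<in> E \<longrightarrow> a \<noteq> v \<longrightarrow> b \<noteq> v \<longrightarrow> a \<noteq> b \<longrightarrow> (c a :: nat) \<noteq> c b" "\<forall>a\<in>S. c a < 3"
        using tri[OF v(1)] by blast
      then have "hlink E w v \<le> (1 - w v)\<^sup>2 / 3" by (intro hlink_le_tripartite[OF v(1), of c]) auto
      ultimately show ?thesis by (simp add: power2_eq_square)
    qed
    then show thesis using that(1) stationary[OF v(1)] by simp
  qed
qed

end

section \<open>Oblique triangles\<close>

text \<open>The Gram determinant (up to a factor) of the three vectors from one of four points to the others, in the squared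
  distances \<open>12, 13, 14, 23, 24, 34\<close>; it vanishes for points in the plane.\<close>

definition cm6 :: "real \<Rightarrow> real \<Rightarrow> real \<Rightarrow> real \<Rightarrow> real \<Rightarrow> real \<Rightarrow> real" where
  "cm6 p q r s t u =
     2 * p * (4 * q * r - (q + r - u)\<^sup>2) - (p + q - s) * (2 * r * (p + q - s) - (q + r - u) * (p + r - t))
     + (p + r - t) * ((p + q - s) * (q + r - u) - 2 * q * (p + r - t))"

text \<open>Throughout, these properties refer to the squares of the side lengths.\<close>

definition scalene :: "real \<Rightarrow> real \<Rightarrow> real \<Rightarrow> bool" where
  "scalene x y z \<longleftrightarrow> 0 < x \<and> 0 < y \<and> 0 < z \<and> x \<noteq> y \<and> y \<noteq> z \<and> x \<noteq> z"

definition oblique :: "real \<Rightarrow> real \<Rightarrow> real \<Rightarrow> bool" where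
  "oblique x y z \<longleftrightarrow> scalene x y z \<and> x + y \<noteq> z \<and> y + z \<noteq> x \<and> x + z \<noteq> y"

text \<open>For the side \<open>a\<close> and the diagonals \<open>b < c\<close> of a regular
  heptagon, Ptolemy's theorem gives \<open>b^2 - a^2 = a c\<close>, \<open>c^2 - a^2 = b c\<close>
  and \<open>c^2 - b^2 = a b\<close>. These are the squares of those relations, polynomial in the
  squared sides. They survive cyclic shifts of the arguments but not an exchange of two of them in a
  scalene triple, hence the permutations in later statements.\<close>

definition heptagonal :: "real \<Rightarrow> real \<Rightarrow> real \<Rightarrow> bool" where
  "heptagonal x y z \<longleftrightarrow> (x - y)\<^sup>2 = x * z \<and> (x - z)\<^sup>2 = y * z \<and> (y - z)\<^sup>2 = x * y"

text \<open>Two copies \<open>uvr\<close>, \<open>uvs\<close> of an oblique triangle and a copy \<open>rst\<close> span five points. If the squared distances from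
  \<open>u\<close> and \<open>v\<close> to \<open>t\<close> are \<open>p\<close> and \<open>q\<close>, the relations between quadruples leave only the following possibilities.\<close>

lemma kite_leg_config:
  assumes "oblique x y z" "p \<in> {x, y, z}" "q \<in> {x, y, z}"
    and "cm6 z x x y y x = 0" "cm6 z x p y q y = 0" "cm6 z x p y q z = 0" "cm6 x x p x y z = 0" "cm6 y y q x y z = 0"
  shows "p = y \<and> q = z \<and> x = 2 * y \<and> y\<^sup>2 + z\<^sup>2 = 4 * y * z"
proof -
  have ne: "x \<noteq> 0" "y \<noteq> 0" "z \<noteq> 0" "x \<noteq> y" "y \<noteq> z" "x \<noteq> z" "x + y \<noteq> z" "y + z \<noteq> x" "x + z \<noteq> y"
    using assms(1) by (auto simp: oblique_def scalene_def)
  note K = assms(4-8)[unfolded cm6_def]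
  have pq: "p = y \<and> q = z"
  proof (rule ccontr)
    assume "\<not> ?thesis"
    then consider "p = x" "q = x" | "p = x" "q = y" | "p = x" "q = z" | "p = y" "q = x" | "p = y" "q = y"
      | "p = z" "q = x" | "p = z" "q = y" | "p = z" "q = z" using assms(2,3) by blast
    then show False
      proof cases
      case 1
      show ?thesis using ne K[unfolded 1] by algebra
    next
      case 2
      show ?thesis using ne K[unfolded 2] by algebra
    next
      case 3
      show ?thesis using ne K[unfolded 3] by algebra
    next
      case 4
      show ?thesis using ne K[unfolded 4] by algebra
    next
      case 5
      show ?thesis using ne K[unfolded 5] by algebra
    next
      case 6
      show ?thesis using ne K[unfolded 6] by algebra
    next
      case 7
      show ?thesis using ne K[unfolded 7] by algebra
    next
      case 8
      show ?thesis using ne K[unfolded 8] by algebra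
    qed
  qed
  have "x = 2 * y" "y\<^sup>2 + z\<^sup>2 = 4 * y * z" using K[unfolded conjunct1[OF pq] conjunct2[OF pq]] ne by algebra+
  then show ?thesis using pq by auto
qed

text \<open>As before \<open>r\<close> and \<open>s\<close> are mirror images in the line
  \<open>uv\<close>, but now \<open>rs\<close> repeats the common side \<open>uv\<close> instead of
  one of the other two sides; no position of \<open>t\<close> survives.\<close>

lemma kite_base_config:
  assumes "oblique x y z" "p \<in> {x, y, z}" "q \<in> {x, y, z}"
    and "cm6 z x x y y z = 0" "cm6 z x p y q x = 0" "cm6 z x p y q y = 0" "cm6 x x p z x y = 0" "cm6 y y q z x y = 0"
  shows False
proof -
  have ne: "x \<noteq> 0" "y \<noteq> 0" "z \<noteq> 0" "x \<noteq> y" "y \<noteq> z" "x \<noteq> z" "x + y \<noteq> z" "y + z \<noteq> x" "x + z \<noteq> y"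
    using assms(1) by (auto simp: oblique_def scalene_def)
  note K = assms(4-8)[unfolded cm6_def]
  consider "p = x" "q = x" | "p = x" "q = y" | "p = x" "q = z" | "p = y" "q = x" | "p = y" "q = y" | "p = y" "q = z"
      | "p = z" "q = x" | "p = z" "q = y" | "p = z" "q = z" using assms(2,3) by blast
  then show False
    proof cases
      case 1
      show ?thesis using ne K[unfolded 1] by algebra
    next
      case 2
      show ?thesis using ne K[unfolded 2] by algebra
    next
      case 3
      show ?thesis using ne K[unfolded 3] by algebra
    next
      case 4
      show ?thesis using ne K[unfolded 4] by algebra
    next
      case 5
      show ?thesis using ne K[unfolded 5] by algebra
    next
      case 6
      show ?thesis using ne K[unfolded 6] by algebra
    next
      case 7
      show ?thesis using ne K[unfolded 7] by algebra
    next
      case 8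
      show ?thesis using ne K[unfolded 8] by algebra
    next
      case 9
      show ?thesis using ne K[unfolded 9] by algebra
    qed
qed

text \<open>Here \<open>s\<close> has the distances of \<open>r\<close> to \<open>u\<close> and
  \<open>v\<close> exchanged, so \<open>u, v, r, s\<close> form a parallelogram or an isosceles
  trapezoid. The two solutions with proportional sides are not excluded at this point but by a
  further copy of the triangle.\<close>

lemma crossed_config:
  assumes "oblique x y z" "p \<in> {x, y, z}" "q \<in> {x, y, z}"
    and "cm6 z x y y x x = 0" "cm6 z x p y q y = 0" "cm6 z y p x q z = 0" "cm6 x y p x y z = 0" "cm6 y x q x y z = 0"
  shows "(p = x \<and> q = x \<and> x = 4 * y \<and> z = 6 * y) \<or>
    (p = x \<and> q = z \<and> (x = 2 * y \<and> z = 4 * y \<or> heptagonal x y z))"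
proof -
  have ne: "x \<noteq> 0" "y \<noteq> 0" "z \<noteq> 0" "x \<noteq> y" "y \<noteq> z" "x \<noteq> z" "x + y \<noteq> z" "y + z \<noteq> x" "x + z \<noteq> y"
    and pos: "0 < x" "0 < y" "0 < z"
    using assms(1) by (auto simp: oblique_def scalene_def)
  note K = assms(4-8)[unfolded cm6_def]
  \<comment> \<open>The parallelogram law with diagonals \<open>uv\<close> and \<open>rs\<close>, or
    Ptolemy's theorem for the trapezoid. Factors of the same two kinds reappear below for
    \<open>u, v, s, t\<close>.\<close>
  have "(z - x - 2 * y) * ((x - y)\<^sup>2 - x * z) = 0" using K(1) by algebra
  then have uvrs: "z = x + 2 * y \<or> (x - y)\<^sup>2 = x * z" by auto
  have "p = x \<and> (q = x \<or> q = z)"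
  proof (rule ccontr)
    assume "\<not> ?thesis"
    then consider "p = x" "q = y" | "p = y" "q = x" | "p = y" "q = y" | "p = y" "q = z"
      | "p = z" "q = x" | "p = z" "q = y" | "p = z" "q = z" using assms(2,3) by blast
    then show False
      proof cases
      case 1
      show ?thesis using ne K[unfolded 1] by algebra
    next
      case 2
      show ?thesis using ne K[unfolded 2] by algebra
    next
      case 3
      show ?thesis using ne K[unfolded 3] by algebra
    next
      case 4
      show ?thesis using ne K[unfolded 4] by algebra
    next
      case 5
      show ?thesis using ne K[unfolded 5] by algebra
    next
      case 6
      show ?thesis using ne K[unfolded 6] by algebra
    next
      case 7
      show ?thesis using ne K[unfolded 7] by algebra
    qed
  qed
  then consider "p = x" "q = x" | "p = x" "q = z" by blast
  then show ?thesis
  proof cases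
    case 1
    have "(y - x - 2 * z) * ((x - z)\<^sup>2 - x * y) = 0" using K(3)[unfolded 1] by algebra
    then have "y = x + 2 * z \<or> (x - z)\<^sup>2 = x * y" by auto
    then show ?thesis using uvrs
    proof (elim disjE)
      assume "y = x + 2 * z" "z = x + 2 * y"
      then show ?thesis using pos by linarith
    next
      assume "y = x + 2 * z" "(x - y)\<^sup>2 = x * z"
      then have False using K[unfolded 1] ne by algebra
      then show ?thesis ..
    next
      assume "(x - z)\<^sup>2 = x * y" "z = x + 2 * y"
      then have "x = 4 * y" "z = 6 * y" using ne by algebra+
      then show ?thesis using 1 by auto
    next
      assume "(x - z)\<^sup>2 = x * y" "(x - y)\<^sup>2 = x * z"
      then have False using ne by algebra
      then show ?thesis ..
    qed
  next
    case 2
    have "(y - 2 * x - z) * ((x - z)\<^sup>2 - y * z) = 0" using K(3)[unfolded 2] by algebra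
    then have "y = 2 * x + z \<or> (x - z)\<^sup>2 = y * z" by auto
    then show ?thesis using uvrs
    proof (elim disjE)
      assume "y = 2 * x + z" "z = x + 2 * y"
      then show ?thesis using pos by linarith
    next
      assume "y = 2 * x + z" "(x - y)\<^sup>2 = x * z"
      then have "x\<^sup>2 + z\<^sup>2 + x * z = 0" by algebra
      then show ?thesis using pos by (smt (verit) mult_pos_pos zero_le_power2)
    next
      assume "(x - z)\<^sup>2 = y * z" "z = x + 2 * y"
      then have "z = 4 * y" "x = 2 * y" using ne by algebra+
      then show ?thesis using 2 by auto
    next
      assume h: "(x - z)\<^sup>2 = y * z" "(x - y)\<^sup>2 = x * z"
      then have "(y - z)\<^sup>2 = x * y" using K[unfolded 2] ne by algebra
      then show ?thesis using h 2 by (auto simp: heptagonal_def)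
    qed
  qed
qed

section \<open>Planar configurations of copies of one triangle, in squared distances\<close>

definition sqd :: "point \<Rightarrow> point \<Rightarrow> real" where
  "sqd p q = (dist p q)\<^sup>2"

lemma sqd_coords: "sqd p q = (p $ 1 - q $ 1)\<^sup>2 + (p $ 2 - q $ 2)\<^sup>2"
  by (simp add: sqd_def dist_norm norm_vec_def L2_set_def sum_2)

lemma sqd_sym: "sqd p q = sqd q p"
  by (simp add: sqd_def dist_commute)

lemma sqd_eq_0_iff [simp]: "sqd p q = 0 \<longleftrightarrow> p = q"
  by (simp add: sqd_def)

lemma sqd_nonneg [simp]: "0 \<le> sqd p q"
  by (simp add: sqd_def)

lemma cm6_sqd: "cm6 (sqd p q) (sqd p r) (sqd p s) (sqd q r) (sqd q s) (sqd r s) = 0"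
  unfolding cm6_def sqd_coords by algebra

text \<open>Spelled out as a disjunction because its cases are split constantly; the equivalent
  multiset equation supplies symmetry and transitivity.\<close>

definition perm3 :: "real \<Rightarrow> real \<Rightarrow> real \<Rightarrow> real \<Rightarrow> real \<Rightarrow> real \<Rightarrow> bool" where
  "perm3 a b c x y z \<longleftrightarrow>
     a = x \<and> b = y \<and> c = z \<or> a = x \<and> b = z \<and> c = y \<or> a = y \<and> b = x \<and> c = z \<or>
     a = y \<and> b = z \<and> c = x \<or> a = z \<and> b = x \<and> c = y \<or> a = z \<and> b = y \<and> c = x"

lemma perm3_iff_mset: "perm3 a b c x y z \<longleftrightarrow> {#a, b, c#} = {#x, y, z#}"
  unfolding perm3_def by (auto simp: add_mset_eq_single add_eq_conv_ex)

lemma perm3_trans: "perm3 a b c x y z \<Longrightarrow> perm3 x y z p q r \<Longrightarrow> perm3 a b c p q r"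
  by (simp add: perm3_iff_mset)

lemma perm3_sym: "perm3 a b c x y z \<Longrightarrow> perm3 x y z a b c"
  by (simp add: perm3_iff_mset)

lemma scalene_perm:
  assumes "scalene x y z" "perm3 a b c x y z"
  shows "scalene a b c"
  using assms by (auto simp: perm3_def scalene_def)

lemma oblique_perm:
  assumes "oblique x y z" "perm3 a b c x y z"
  shows "oblique a b c"
  using assms scalene_perm[of x y z a b c] by (auto simp: perm3_def oblique_def)

lemma oblique_scalene: "oblique x y z \<Longrightarrow> scalene x y z"
  by (simp add: oblique_def)

lemma rainbow_rest:
  assumes "scalene a b c" "perm3 p q r a b c"
  shows "p = a \<Longrightarrow> q = b \<and> r = c \<or> q = c \<and> r = b"
    and "p = b \<Longrightarrow> q = a \<and> r = c \<or> q = c \<and> r = a"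
    and "p = c \<Longrightarrow> q = a \<and> r = b \<or> q = b \<and> r = a"
  using assms by (auto simp: perm3_def scalene_def)

text \<open>The limit configuration: the support of a maximiser placed in the plane, with every edge
  a copy of the triangle of squared sides \<open>x, y, z\<close>. The expression in
  \<open>area\<close> is Heron's formula for 16 times the squared area.\<close>

locale triangle_copies = weighted_hypergraph S E w for S :: "'a set" and E w +
  fixes \<phi> :: "'a \<Rightarrow> point" and x y z :: real
  assumes inj: "inj_on \<phi> S"
    and sides_pos: "0 < x" "0 < y" "0 < z"
    and area: "0 < 2 * x * y + 2 * y * z + 2 * x * z - x\<^sup>2 - y\<^sup>2 - z\<^sup>2"
    and edge_sides: "\<lbrakk>{i, j, k} \<in> E; i \<noteq> j; j \<noteq> k; i \<noteq> k\<rbrakk> \<Longrightarrow>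
      perm3 (sqd (\<phi> i) (\<phi> j)) (sqd (\<phi> j) (\<phi> k)) (sqd (\<phi> k) (\<phi> i)) x y z"
begin

definition d :: "'a \<Rightarrow> 'a \<Rightarrow> real" where
  "d i j = sqd (\<phi> i) (\<phi> j)"

lemma d_sym: "d i j = d j i"
  by (simp add: d_def sqd_sym)

lemma d_pos: "\<lbrakk>i \<in> S; j \<in> S; i \<noteq> j\<rbrakk> \<Longrightarrow> 0 < d i j"
  using inj sqd_nonneg[of "\<phi> i" "\<phi> j"] by (auto simp: d_def inj_on_eq_iff order_le_less)

lemma cm: "cm6 (d i j) (d i k) (d i l) (d j k) (d j l) (d k l) = 0"
  by (simp add: d_def cm6_sqd)

lemma edge_d: "\<lbrakk>{i, j, k} \<in> E; i \<noteq> j; j \<noteq> k; i \<noteq> k\<rbrakk> \<Longrightarrow> perm3 (d i j) (d j k) (d k i) x y z"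
  using edge_sides by (simp add: d_def)

lemma colour:
  assumes "i \<in> S" "j \<in> S" "i \<noteq> j"
  shows "d i j \<in> {x, y, z}"
proof -
  obtain k where k: "k \<noteq> i" "k \<noteq> j" "{i, j, k} \<in> E" using assms by (rule third_point)
  then have "perm3 (d i j) (d j k) (d k i) x y z" using assms by (intro edge_d) auto
  then show ?thesis by (auto simp: perm3_def)
qed

lemma colour':
  assumes "perm3 a b c x y z" "i \<in> S" "j \<in> S" "i \<noteq> j"
  shows "d i j \<in> {a, b, c}"
  using colour[OF assms(2-4)] assms(1) by (auto simp: perm3_def)

lemma crossed_points:
  assumes obl: "oblique x y z" and abc: "perm3 a b c x y z"
    and S: "u \<in> S" "v \<in> S" "r \<in> S" "s \<in> S" "t \<in> S" and dist: "distinct [u, v, r, s, t]"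
    and d: "d u v = c" "d u r = a" "d v r = b" "d u s = b" "d v s = a" "d r s = a" "d r t = b" "d s t = c"
  shows "(d u t = a \<and> d v t = a \<and> a = 4 * b \<and> c = 6 * b) \<or>
    (d u t = a \<and> d v t = c \<and> (a = 2 * b \<and> c = 4 * b \<or> heptagonal a b c))"
proof (rule crossed_config)
  show "oblique a b c" using oblique_perm obl abc by blast
  show "d u t \<in> {a, b, c}" "d v t \<in> {a, b, c}" using colour'[OF abc] S dist by auto
  show "cm6 c a b b a a = 0" using cm[of u v r s] d by simp
  show "cm6 c a (d u t) b (d v t) b = 0" using cm[of u v r t] d by simp
  show "cm6 c b (d u t) a (d v t) c = 0" using cm[of u v s t] d by simp
  show "cm6 a b (d u t) a b c = 0" using cm[of u r s t] d by simp
  show "cm6 b a (d v t) a b c = 0" using cm[of v r s t] d by simp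
qed

text \<open>Exchanging \<open>u\<close> with \<open>v\<close> and \<open>r\<close> with
  \<open>s\<close> interchanges the two alternatives for \<open>t\<close>. Only the relation between
  the sides is kept, so that it can be confronted with the relation from a second crossed
  quadruple.\<close>

lemma crossed_points_relation:
  assumes obl: "oblique x y z" and abc: "perm3 a b c x y z"
    and S: "u \<in> S" "v \<in> S" "r \<in> S" "s \<in> S" "t \<in> S" and dist: "distinct [u, v, r, s, t]"
    and d: "d u v = c" "d u r = a" "d v r = b" "d u s = b" "d v s = a" "d r s = a"
    and t: "d r t = b \<and> d s t = c \<or> d r t = c \<and> d s t = b"
  shows "a = 4 * b \<and> c = 6 * b \<or> a = 2 * b \<and> c = 4 * b \<or> heptagonal a b c"
  using t
proof
  assume "d r t = b \<and> d s t = c"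
  then show ?thesis using crossed_points[OF obl abc S dist d] by auto
next
  assume "d r t = c \<and> d s t = b"
  then show ?thesis
    using crossed_points[OF obl abc, of v u s r t] S dist d by (auto simp: d_sym)
qed

text \<open>In the two proportional cases a copy on the pair \<open>v, t\<close> creates another
  crossed quadruple, and the relation which that one imposes on the sides is incompatible with the
  first.\<close>

lemma crossed_heptagonal:
  assumes obl: "oblique x y z" and abc: "perm3 a b c x y z"
    and S: "u \<in> S" "v \<in> S" "r \<in> S" "s \<in> S" "t \<in> S" and dist: "distinct [u, v, r, s, t]"
    and d: "d u v = c" "d u r = a" "d v r = b" "d u s = b" "d v s = a" "d r s = a" "d r t = b" "d s t = c"
  shows "heptagonal a b c"
proof -
  have obl': "oblique a b c" using oblique_perm obl abc by blast
  then have sc: "scalene a b c" by (rule oblique_scalene)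
  note ut_vt = crossed_points[OF obl abc S dist d]
  then have vt: "d v t = a \<or> d v t = c" and ut: "d u t = a" by auto
  obtain w' where w: "w' \<in> S" "w' \<noteq> v" "w' \<noteq> t" "{v, t, w'} \<in> E"
    using S dist by (auto intro: third_point[of v t])
  have vtw: "perm3 (d v t) (d t w') (d w' v) a b c" using edge_d[OF w(4)] w dist abc by (auto intro: perm3_trans perm3_sym)
  \<comment> \<open>\<open>u\<close> and \<open>s\<close> both have squared distances
    \<open>a\<close> and \<open>c\<close> to the pair \<open>v, t\<close>, one of which is repeated
    by \<open>d v t\<close>; so neither completes the pair to a copy.\<close>
  have "w' \<noteq> u" using vtw vt ut d sc by (auto simp: perm3_def scalene_def d_sym)
  moreover have "w' \<noteq> s" using vtw vt d sc by (auto simp: perm3_def scalene_def d_sym)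
  ultimately have dist': "distinct [u, s, t, v, w']" "distinct [u, s, v, t, w']" using w dist by auto
  show ?thesis using ut_vt
  proof (elim disjE conjE)
    assume h: "a = 4 * b" "c = 6 * b" "d v t = a"
    have "perm3 a c b x y z" using abc by (auto simp: perm3_def)
    moreover have "d t w' = c \<and> d v w' = b \<or> d t w' = b \<and> d v w' = c"
      using rainbow_rest(1)[OF sc vtw] h by (auto simp: d_sym)
    ultimately have "a = 4 * c \<and> b = 6 * c \<or> a = 2 * c \<and> b = 4 * c \<or> heptagonal a c b"
      using crossed_points_relation[OF obl _ S(1,4,5,2) w(1) dist'(1), of a c b] S dist d ut h by (auto simp: d_sym)
    then show ?thesis using h sc by (auto simp: heptagonal_def scalene_def power2_eq_square)
  next
    assume h: "a = 2 * b" "c = 4 * b" "d v t = c"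
    have "perm3 c a b x y z" using abc by (auto simp: perm3_def)
    moreover have "d v w' = a \<and> d t w' = b \<or> d v w' = b \<and> d t w' = a"
      using rainbow_rest(3)[OF sc vtw] h by (auto simp: d_sym)
    ultimately have "c = 4 * a \<and> b = 6 * a \<or> c = 2 * a \<and> b = 4 * a \<or> heptagonal c a b"
      using crossed_points_relation[OF obl _ S(1,4,2,5) w(1) dist'(2), of c a b] S dist d ut h by (auto simp: d_sym)
    then show ?thesis using h sc by (auto simp: heptagonal_def scalene_def power2_eq_square)
  qed
qed

text \<open>The one surviving kite makes \<open>u, s, v, t\<close> a crossed quadruple. A copy on
  \<open>v, t\<close> then yields a relation between the sides that contradicts
  \<open>a = 2 * b\<close> together with \<open>b^2 + c^2 = 4 * b * c\<close>.\<close>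

lemma kite_leg_impossible:
  assumes obl: "oblique x y z" and abc: "perm3 a b c x y z"
    and S: "u \<in> S" "v \<in> S" "r \<in> S" "s \<in> S" "t \<in> S" and dist: "distinct [u, v, r, s, t]"
    and d: "d u v = c" "d u r = a" "d v r = b" "d u s = a" "d v s = b" "d r s = a" "d r t = b" "d s t = c"
  shows False
proof -
  have obl': "oblique a b c" using oblique_perm obl abc by blast
  then have sc: "scalene a b c" by (rule oblique_scalene)
  have h: "d u t = b \<and> d v t = c \<and> a = 2 * b \<and> b\<^sup>2 + c\<^sup>2 = 4 * b * c"
  proof (rule kite_leg_config[OF obl'])
    show "d u t \<in> {a, b, c}" "d v t \<in> {a, b, c}" using colour'[OF abc] S dist by auto
    show "cm6 c a a b b a = 0" using cm[of u v r s] d by simp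
    show "cm6 c a (d u t) b (d v t) b = 0" using cm[of u v r t] d by simp
    show "cm6 c a (d u t) b (d v t) c = 0" using cm[of u v s t] d by simp
    show "cm6 a a (d u t) a b c = 0" using cm[of u r s t] d by simp
    show "cm6 b b (d v t) a b c = 0" using cm[of v r s t] d by simp
  qed
  obtain w' where w: "w' \<in> S" "w' \<noteq> v" "w' \<noteq> t" "{v, t, w'} \<in> E"
    using S dist by (auto intro: third_point[of v t])
  have vtw: "perm3 (d v t) (d t w') (d w' v) a b c" using edge_d[OF w(4)] w dist abc by (auto intro: perm3_trans perm3_sym)
  have "w' \<noteq> u" "w' \<noteq> s" using vtw h d sc by (auto simp: perm3_def scalene_def d_sym)
  then have dist': "distinct [u, s, v, t, w']" using w dist by auto
  have "perm3 c b a x y z" using abc by (auto simp: perm3_def)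
  moreover have "d v w' = b \<and> d t w' = a \<or> d v w' = a \<and> d t w' = b"
    using rainbow_rest(3)[OF sc vtw] h by (auto simp: d_sym)
  ultimately have "c = 4 * b \<and> a = 6 * b \<or> c = 2 * b \<and> a = 4 * b \<or> heptagonal c b a"
    using crossed_points_relation[OF obl _ S(1,4,2,5) w(1) dist', of c b a] S dist d h by (auto simp: d_sym)
  then show False
  proof (elim disjE conjE)
    assume "heptagonal c b a"
    then have "(c - b)\<^sup>2 = c * a" "(c - a)\<^sup>2 = b * a" by (auto simp: heptagonal_def)
    moreover have "a = 2 * b" "b\<^sup>2 + c\<^sup>2 = 4 * b * c" "b \<noteq> 0" using h sc by (auto simp: scalene_def)
    ultimately show False by algebra
  qed (use h sc in \<open>auto simp: scalene_def\<close>)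
qed

lemma kite_base_impossible:
  assumes obl: "oblique x y z" and abc: "perm3 a b c x y z"
    and S: "u \<in> S" "v \<in> S" "r \<in> S" "s \<in> S" "t \<in> S" and dist: "distinct [u, v, r, s, t]"
    and d: "d u v = c" "d u r = a" "d v r = b" "d u s = a" "d v s = b" "d r s = c" "d r t = a" "d s t = b"
  shows False
proof (rule kite_base_config)
  show "oblique a b c" using oblique_perm obl abc by blast
  show "d u t \<in> {a, b, c}" "d v t \<in> {a, b, c}" using colour'[OF abc] S dist by auto
  show "cm6 c a a b b c = 0" using cm[of u v r s] d by simp
  show "cm6 c a (d u t) b (d v t) a = 0" using cm[of u v r t] d by simp
  show "cm6 c a (d u t) b (d v t) b = 0" using cm[of u v s t] d by simp
  show "cm6 a a (d u t) c a b = 0" using cm[of u r s t] d by simp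
  show "cm6 b b (d v t) c a b = 0" using cm[of v r s t] d by simp
qed

text \<open>Four points whose opposite distances agree span a tetrahedron with congruent faces,
  which is flat only if it is a rectangle, that is, if the faces are right angled.\<close>

lemma oblique_pyramid:
  assumes obl: "oblique a b c"
  shows "cm6 c a b b a c \<noteq> 0"
proof
  assume "cm6 c a b b a c = 0"
  then have "(a + b - c) * (b + c - a) * (a + c - b) = 0" unfolding cm6_def by algebra
  then show False using obl by (auto simp: oblique_def)
qed

text \<open>The pair \<open>r, s\<close> is covered by some copy \<open>rst\<close>, and then \<open>u, t\<close> and \<open>v, t\<close> are again among the three distances.\<close>

theorem oblique_codegree_two_heptagonal:
  assumes obl: "oblique x y z" and S: "u \<in> S" "v \<in> S" "r \<in> S" "s \<in> S" and dist: "distinct [u, v, r, s]"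
    and E: "{u, v, r} \<in> E" "{u, v, s} \<in> E"
  shows "\<exists>a b c. perm3 a b c x y z \<and> heptagonal a b c"
proof -
  define a b c where "a = d u r" "b = d v r" "c = d u v"
  note abc_def = a_b_c_def
  have abc: "perm3 a b c x y z"
    using edge_d[OF E(1)] dist unfolding abc_def by (auto simp: perm3_def d_sym)
  have obl': "oblique a b c" using oblique_perm obl abc by blast
  then have sc: "scalene a b c" by (rule oblique_scalene)
  have uvs: "perm3 (d u v) (d v s) (d s u) a b c" using edge_d[OF E(2)] dist abc by (auto intro: perm3_trans perm3_sym)
  obtain t where t: "t \<in> S" "t \<noteq> r" "t \<noteq> s" "{r, s, t} \<in> E"
    using S dist by (auto intro: third_point[of r s])
  have rst: "perm3 (d r s) (d s t) (d t r) a b c" using edge_d[OF t(4)] t dist abc by (auto intro: perm3_trans perm3_sym)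
  have rs: "d r s \<in> {a, b, c}" using colour'[OF abc] S dist by auto
  have d: "d u v = c" "d u r = a" "d v r = b" by (auto simp: abc_def)
  \<comment> \<open>Either \<open>s\<close> is the mirror image of \<open>r\<close> in the line
    \<open>uv\<close> (a kite), or its distances to \<open>u\<close> and \<open>v\<close> are those
    of \<open>r\<close> exchanged (crossed).\<close>
  consider "d u s = a" "d v s = b" | "d u s = b" "d v s = a"
    using rainbow_rest(3)[OF sc uvs] d by (auto simp: d_sym)
  then show ?thesis
  proof cases
    case 1
    have ne: "t \<noteq> u" "t \<noteq> v" using rst 1 d sc by (auto simp: perm3_def scalene_def d_sym)
    then have dist5: "distinct [u, v, r, s, t]" "distinct [u, v, s, r, t]" "distinct [v, u, r, s, t]" "distinct [v, u, s, r, t]"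
      using t dist by auto
    have bac: "perm3 b a c x y z" using abc by (auto simp: perm3_def)
    from rs consider "d r s = a" | "d r s = b" | "d r s = c" by blast
    then have False
    proof cases
      case a: 1
      have "d r t = b \<and> d s t = c \<or> d r t = c \<and> d s t = b" using rainbow_rest(1)[OF sc rst a] by (auto simp: d_sym)
      then show False
        using kite_leg_impossible[OF obl abc S t(1) dist5(1)] kite_leg_impossible[OF obl abc S(1,2,4,3) t(1) dist5(2)] 1 d a
        by (auto simp: d_sym)
    next
      case b: 2
      have "d r t = a \<and> d s t = c \<or> d r t = c \<and> d s t = a" using rainbow_rest(2)[OF sc rst b] by (auto simp: d_sym)
      then show False
        using kite_leg_impossible[OF obl bac S(2,1,3,4) t(1) dist5(3)] kite_leg_impossible[OF obl bac S(2,1,4,3) t(1) dist5(4)] 1 d b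
        by (auto simp: d_sym)
    next
      case c: 3
      have "d r t = a \<and> d s t = b \<or> d r t = b \<and> d s t = a" using rainbow_rest(3)[OF sc rst c] by (auto simp: d_sym)
      then show False
        using kite_base_impossible[OF obl abc S t(1) dist5(1)] kite_base_impossible[OF obl abc S(1,2,4,3) t(1) dist5(2)] 1 d c
        by (auto simp: d_sym)
    qed
    then show ?thesis ..
  next
    case 2
    have rs': "d r s \<noteq> c" using cm[of u v r s] 2 d oblique_pyramid[OF obl'] by auto
    from rs rs' consider "d r s = a" | "d r s = b" by blast
    then show ?thesis
    proof cases
      case a: 1
      have rt: "d r t = b \<and> d s t = c \<or> d r t = c \<and> d s t = b" using rainbow_rest(1)[OF sc rst a] by (auto simp: d_sym)
      then have "t \<noteq> u" "t \<noteq> v" using 2 d sc by (auto simp: scalene_def d_sym)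
      then have dist5: "distinct [u, v, r, s, t]" "distinct [v, u, s, r, t]" using t dist by auto
      have "heptagonal a b c"
        using rt crossed_heptagonal[OF obl abc S t(1) dist5(1)] crossed_heptagonal[OF obl abc S(2,1,4,3) t(1) dist5(2)] 2 d a
        by (auto simp: d_sym)
      then show ?thesis using abc by blast
    next
      case b: 2
      have bac: "perm3 b a c x y z" using abc by (auto simp: perm3_def)
      have rt: "d r t = a \<and> d s t = c \<or> d r t = c \<and> d s t = a" using rainbow_rest(2)[OF sc rst b] by (auto simp: d_sym)
      then have "t \<noteq> u" "t \<noteq> v" using 2 d sc by (auto simp: scalene_def d_sym)
      then have dist5: "distinct [v, u, r, s, t]" "distinct [u, v, s, r, t]" using t dist by auto
      have "heptagonal b a c"
        using rt crossed_heptagonal[OF obl bac S(2,1,3,4) t(1) dist5(1)] crossed_heptagonal[OF obl bac S(1,2,4,3) t(1) dist5(2)] 2 d b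
        by (auto simp: d_sym)
      then show ?thesis using bac by blast
    qed
  qed
qed

end

section \<open>Heptagonal triangles\<close>

text \<open>Turns a placement of the support at positions below \<open>n\<close> into an inequality
  in \<open>n\<close> explicit variables. Decreasing triples give each edge one representative and
  make the later differences of positions true subtractions of naturals.\<close>

lemma (in weighted_hypergraph) hsum_le_triples:
  fixes p :: "'a \<Rightarrow> nat"
  assumes inj_p: "inj_on p S" and p_lt: "\<And>i. i \<in> S \<Longrightarrow> p i < n"
    and R: "\<And>i j k. \<lbrakk>{i, j, k} \<in> E; p k < p j; p j < p i\<rbrakk> \<Longrightarrow> R (p i) (p j) (p k)"
  obtains v where "\<And>k. 0 \<le> v k" "sum v {..<n} = 1"
    "hsum E w \<le> (\<Sum>a<n. \<Sum>b<a. \<Sum>c<b. if R a b c then v a * v b * v c else 0)"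
proof -
  \<comment> \<open>Positions that carry no vertex receive weight 0, so the support need not fill
    the polygon.\<close>
  define v where "v k = (if k \<in> p ` S then w (inv_into S p k) else 0)" for k
  have vp: "v (p i) = w i" if "i \<in> S" for i using that inj_p by (simp add: v_def)
  have v0: "0 \<le> v k" for k
    using w_pos by (auto simp: v_def inj_p less_imp_le)
  have "sum v {..<n} = sum v (p ` S)"
    by (rule sum.mono_neutral_right) (use p_lt in \<open>auto simp: v_def\<close>)
  also have "\<dots> = 1" using vp w_sum by (simp add: sum.reindex[OF inj_p])
  finally have v1: "sum v {..<n} = 1" .
  let ?T = "SIGMA a:{..<n}. SIGMA b:{..<a}. {..<b}"
  let ?f = "\<lambda>(a, b, c). if R a b c then v a * v b * v c else 0"
  have "hsum E w \<le> sum ?f ?T"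
    unfolding hsum_def
  proof (rule sum_le_included[where i = "\<lambda>(a, b, c). {inv_into S p a, inv_into S p b, inv_into S p c}"])
    show "\<forall>t\<in>?T. 0 \<le> ?f t" using v0 by auto
    show "\<forall>e\<in>E. \<exists>t\<in>?T. (case t of (a, b, c) \<Rightarrow> {inv_into S p a, inv_into S p b, inv_into S p c}) = e \<and> prod w e \<le> ?f t"
    proof
      fix e assume e: "e \<in> E"
      obtain l where l: "set l = e" "sorted_wrt (\<lambda>i j. p j < p i) l"
      proof -
        let ?l = "map (inv_into S p) (rev (sorted_list_of_set (p ` e)))"
        have eS: "e \<subseteq> S" using e edge_sub by auto
        then have fe: "finite e" using finite_S finite_subset by auto
        have "set ?l = e" using eS fe inj_p by (force simp: image_iff inj_on_subset)
        moreover have "sorted_wrt (\<lambda>i j. p j < p i) ?l"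
        proof -
          have "sorted_wrt (\<lambda>a b. b < a) (rev (sorted_list_of_set (p ` e)))"
            by (simp add: sorted_wrt_rev strict_sorted_list_of_set)
          then show ?thesis unfolding sorted_wrt_map
            by (rule sorted_wrt_mono_rel[rotated]) (use eS fe inj_p in \<open>auto simp: subset_iff\<close>)
        qed
        ultimately show thesis using that by blast
      qed
      have "distinct l" using l(2) by (induction l) auto
      then have "length l = 3" using card_edge[OF e] l(1) distinct_card by fastforce
      then obtain i j k where "l = [i, j, k]" by (auto simp: length_Suc_conv numeral_3_eq_3)
      then have ijk: "e = {i, j, k}" "p k < p j" "p j < p i" using l by auto
      have S: "i \<in> S" "j \<in> S" "k \<in> S" using edge_sub[OF e] ijk by auto
      have "R (p i) (p j) (p k)" using R e ijk by auto
      moreover have "prod w e = w i * w j * w k"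
      proof -
        have "i \<noteq> j" "j \<noteq> k" "i \<noteq> k" using ijk by auto
        then show ?thesis using ijk(1) by (simp add: mult.assoc)
      qed
      ultimately show "\<exists>t\<in>?T. (case t of (a, b, c) \<Rightarrow> {inv_into S p a, inv_into S p b, inv_into S p c}) = e \<and> prod w e \<le> ?f t"
        using ijk S p_lt[of i] vp inj_p by (intro bexI[of _ "(p i, p j, p k)"]) auto
    qed
  qed (use finite_E in auto)
  also have "\<dots> = (\<Sum>a<n. \<Sum>b<a. \<Sum>c<b. if R a b c then v a * v b * v c else 0)"
    by (simp add: sum.Sigma)
  finally show thesis using that v0 v1 by blast
qed

text \<open>Positive semidefinite quadratic form of a sum-of-squares certificate: the cyclic sum of \<open>w\<close> times the form at
  the seven vertices is \<open>36\<close> times the difference of the two sides of the inequality.\<close>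

definition heptagon_form :: "real \<Rightarrow> real \<Rightarrow> real \<Rightarrow> real \<Rightarrow> real \<Rightarrow> real \<Rightarrow> real \<Rightarrow> real" where
  "heptagon_form w y0 y1 y2 y3 y4 y5 = 2 * (6 * w - (y0 + y1 + y2 + y3 + y4 + y5))\<^sup>2
     + 222 * ((y0 - y3) - (y1 - y4) + (y2 - y5))\<^sup>2
     + 3 * (((y0 - y3) + (y1 - y4))\<^sup>2 + ((y1 - y4) + (y2 - y5))\<^sup>2 + ((y0 - y3) - (y2 - y5))\<^sup>2)
     + 5 * (((y0 + y3) - (y1 + y4))\<^sup>2 + ((y1 + y4) - (y2 + y5))\<^sup>2 + ((y0 + y3) - (y2 + y5))\<^sup>2)"

lemma heptagon_form_nonneg: "0 \<le> heptagon_form w y0 y1 y2 y3 y4 y5"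
  unfolding heptagon_form_def by simp

text \<open>The 14 terms are the triples of vertices with three different distances. At vertex
  \<open>i\<close> the form is evaluated at \<open>i\<close> and at the vertices
  \<open>i + 3^k\<close> modulo 7 for \<open>k = 0, ..., 5\<close>: multiplication by the primitive
  root 3 permutes the three distance classes cyclically and preserves these triples, and accordingly
  the form is invariant under the cyclic shift of its last six arguments.\<close>

lemma heptagon_inequality:
  fixes w0 w1 w2 w3 w4 w5 w6 :: real
  assumes "0 \<le> w0" "0 \<le> w1" "0 \<le> w2" "0 \<le> w3" "0 \<le> w4" "0 \<le> w5" "0 \<le> w6"
  shows "49 * (w0*w1*w3+w0*w1*w5+w0*w2*w3+w0*w2*w6+w0*w4*w5+w0*w4*w6+w1*w2*w4+w1*w2*w6+w1*w3*w4+w1*w5*w6+w2*w3*w5+w2*w4*w5+w3*w4*w6+w3*w5*w6) \<le> 2 * (w0+w1+w2+w3+w4+w5+w6) ^ 3"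
proof -
  have "72 * (w0+w1+w2+w3+w4+w5+w6) ^ 3 - 1764 * (w0*w1*w3+w0*w1*w5+w0*w2*w3+w0*w2*w6+w0*w4*w5+w0*w4*w6+w1*w2*w4+w1*w2*w6+w1*w3*w4+w1*w5*w6+w2*w3*w5+w2*w4*w5+w3*w4*w6+w3*w5*w6) =
    w0 * heptagon_form w0 w1 w3 w2 w6 w4 w5
    + w1 * heptagon_form w1 w2 w4 w3 w0 w5 w6
    + w2 * heptagon_form w2 w3 w5 w4 w1 w6 w0
    + w3 * heptagon_form w3 w4 w6 w5 w2 w0 w1
    + w4 * heptagon_form w4 w5 w0 w6 w3 w1 w2
    + w5 * heptagon_form w5 w6 w1 w0 w4 w2 w3
    + w6 * heptagon_form w6 w0 w2 w1 w5 w3 w4"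
    unfolding heptagon_form_def by algebra
  moreover have "0 \<le> w0 * heptagon_form w0 w1 w3 w2 w6 w4 w5
    + w1 * heptagon_form w1 w2 w4 w3 w0 w5 w6
    + w2 * heptagon_form w2 w3 w5 w4 w1 w6 w0
    + w3 * heptagon_form w3 w4 w6 w5 w2 w0 w1
    + w4 * heptagon_form w4 w5 w0 w6 w3 w1 w2
    + w5 * heptagon_form w5 w6 w1 w0 w4 w2 w3
    + w6 * heptagon_form w6 w0 w2 w1 w5 w3 w4"
    using assms by (intro add_nonneg_nonneg mult_nonneg_nonneg heptagon_form_nonneg)
  ultimately show ?thesis by linarith
qed

text \<open>A certificate of the same kind: four times the difference of the two sides is the cyclic
  sum of a weight times the form \<open>Q\<close>. Its part in \<open>b - f\<close> and
  \<open>c - e\<close> is positive definite because \<open>12 * 15 > 13^2\<close>.\<close>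

lemma pentagon_inequality:
  fixes w0 w1 w2 w3 w4 :: real
  assumes "0 \<le> w0" "0 \<le> w1" "0 \<le> w2" "0 \<le> w3" "0 \<le> w4"
  shows "25 * (w0 * w1 * w2 + w1 * w2 * w3 + w2 * w3 * w4 + w3 * w4 * w0 + w4 * w0 * w1) \<le> (w0 + w1 + w2 + w3 + w4) ^ 3"
proof -
  define Q where "Q a b c e f = (2 * a - (c + e))\<^sup>2 + (12 * (b - f)\<^sup>2 + 15 * (c - e)\<^sup>2 - 26 * (b - f) * (c - e))" for a b c e f :: real
  have nonneg: "0 \<le> Q a b c e f" for a b c e f
  proof -
    have "12 * (b - f)\<^sup>2 + 15 * (c - e)\<^sup>2 - 26 * (b - f) * (c - e)
      = 12 * ((b - f) - 13 / 12 * (c - e))\<^sup>2 + 11 / 12 * (c - e)\<^sup>2"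
      by (simp add: field_simps power2_eq_square)
    then show ?thesis by (simp add: Q_def)
  qed
  have "4 * (w0 + w1 + w2 + w3 + w4) ^ 3 - 100 * (w0 * w1 * w2 + w1 * w2 * w3 + w2 * w3 * w4 + w3 * w4 * w0 + w4 * w0 * w1) =
    w0 * Q w0 w1 w2 w3 w4 + w1 * Q w1 w2 w3 w4 w0 + w2 * Q w2 w3 w4 w0 w1 + w3 * Q w3 w4 w0 w1 w2 + w4 * Q w4 w0 w1 w2 w3"
    unfolding Q_def by algebra
  moreover have "0 \<le> w0 * Q w0 w1 w2 w3 w4 + w1 * Q w1 w2 w3 w4 w0 + w2 * Q w2 w3 w4 w0 w1 + w3 * Q w3 w4 w0 w1 w2 + w4 * Q w4 w0 w1 w2 w3"
    using assms by (intro add_nonneg_nonneg mult_nonneg_nonneg nonneg)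
  ultimately show ?thesis by linarith
qed

text \<open>Of the 27 candidates for the distances to a fourth point, planarity leaves the four
  realised by the remaining heptagon vertices. For each of the others the determinant and the
  heptagonal relations force a side to vanish or two sides to coincide.\<close>

lemma heptagon_point:
  assumes "heptagonal a b c" "scalene a b c" "p \<in> {a, b, c}" "q \<in> {a, b, c}" "r \<in> {a, b, c}"
    and K: "cm6 c b p a q r = 0"
  shows "p = a \<and> q = b \<and> r = a \<or> p = c \<and> q = a \<and> r = b \<or> p = b \<and> q = b \<and> r = c \<or> p = a \<and> q = c \<and> r = c"
proof (rule ccontr)
  assume no: "\<not> ?thesis"
  have ne: "a \<noteq> 0" "b \<noteq> 0" "c \<noteq> 0" "a \<noteq> b" "b \<noteq> c" "a \<noteq> c" using assms(2) by (auto simp: scalene_def)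
  note H = assms(1)[unfolded heptagonal_def]
  note K' = K[unfolded cm6_def]
  have n1: False if h: "p = a" "q = a" "r = a"
    using K'[unfolded h] H ne by algebra
  have n2: False if h: "p = a" "q = a" "r = b"
    using K'[unfolded h] H ne by algebra
  have n3: False if h: "p = a" "q = a" "r = c"
    using K'[unfolded h] H ne by algebra
  have n4: False if h: "p = a" "q = b" "r = b"
    using K'[unfolded h] H ne by algebra
  have n5: False if h: "p = a" "q = b" "r = c"
    using K'[unfolded h] H ne by algebra
  have n6: False if h: "p = a" "q = c" "r = a"
    using K'[unfolded h] H ne by algebra
  have n7: False if h: "p = a" "q = c" "r = b"
    using K'[unfolded h] H ne by algebra
  have n8: False if h: "p = b" "q = a" "r = a"
    using K'[unfolded h] H ne by algebra
  have n9: False if h: "p = b" "q = a" "r = b"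
    using K'[unfolded h] H ne by algebra
  have n10: False if h: "p = b" "q = a" "r = c"
    using K'[unfolded h] H ne by algebra
  have n11: False if h: "p = b" "q = b" "r = a"
    using K'[unfolded h] H ne by algebra
  have n12: False if h: "p = b" "q = b" "r = b"
    using K'[unfolded h] H ne by algebra
  have n13: False if h: "p = b" "q = c" "r = a"
    using K'[unfolded h] H ne by algebra
  have n14: False if h: "p = b" "q = c" "r = b"
    using K'[unfolded h] H ne by algebra
  have n15: False if h: "p = b" "q = c" "r = c"
    using K'[unfolded h] H ne by algebra
  have n16: False if h: "p = c" "q = a" "r = a"
    using K'[unfolded h] H ne by algebra
  have n17: False if h: "p = c" "q = a" "r = c"
    using K'[unfolded h] H ne by algebra
  have n18: False if h: "p = c" "q = b" "r = a"
    using K'[unfolded h] H ne by algebra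
  have n19: False if h: "p = c" "q = b" "r = b"
    using K'[unfolded h] H ne by algebra
  have n20: False if h: "p = c" "q = b" "r = c"
    using K'[unfolded h] H ne by algebra
  have n21: False if h: "p = c" "q = c" "r = a"
    using K'[unfolded h] H ne by algebra
  have n22: False if h: "p = c" "q = c" "r = b"
    using K'[unfolded h] H ne by algebra
  have n23: False if h: "p = c" "q = c" "r = c"
    using K'[unfolded h] H ne by algebra
  from assms(3-5) show False
    by (elim insertE emptyE) (use no n1 n2 n3 n4 n5 n6 n7 n8 n9 n10 n11 n12 n13 n14 n15 n16 n17 n18 n19 n20 n21 n22 n23 in simp_all)
qed

text \<open>The ten pairs, repetition allowed, of the four positions from
  \<open>heptagon_point\<close>, each tested against the three sides of the base triangle. A
  repeated position is contradictory; two different positions have the distance of the corresponding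
  heptagon vertices.\<close>

lemma heptagon_pair:
  assumes "heptagonal a b c" "scalene a b c" and e: "e \<in> {a, b, c}"
  shows "\<lbrakk>cm6 c a a b b e = 0; cm6 b a a a a e = 0; cm6 a b b a a e = 0\<rbrakk> \<Longrightarrow> False"
    and "\<lbrakk>cm6 c a c b a e = 0; cm6 b a c a b e = 0; cm6 a b a a b e = 0\<rbrakk> \<Longrightarrow> e = c"
    and "\<lbrakk>cm6 c a b b b e = 0; cm6 b a b a c e = 0; cm6 a b b a c e = 0\<rbrakk> \<Longrightarrow> e = c"
    and "\<lbrakk>cm6 c a a b c e = 0; cm6 b a a a c e = 0; cm6 a b c a c e = 0\<rbrakk> \<Longrightarrow> e = b"
    and "\<lbrakk>cm6 c c c a a e = 0; cm6 b c c b b e = 0; cm6 a a a b b e = 0\<rbrakk> \<Longrightarrow> False"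
    and "\<lbrakk>cm6 c c b a b e = 0; cm6 b c b b c e = 0; cm6 a a b b c e = 0\<rbrakk> \<Longrightarrow> e = a"
    and "\<lbrakk>cm6 c c a a c e = 0; cm6 b c a b c e = 0; cm6 a a c b c e = 0\<rbrakk> \<Longrightarrow> e = b"
    and "\<lbrakk>cm6 c b b b b e = 0; cm6 b b b c c e = 0; cm6 a b b c c e = 0\<rbrakk> \<Longrightarrow> False"
    and "\<lbrakk>cm6 c b a b c e = 0; cm6 b b a c c e = 0; cm6 a b c c c e = 0\<rbrakk> \<Longrightarrow> e = a"
    and "\<lbrakk>cm6 c a a c c e = 0; cm6 b a a c c e = 0; cm6 a c c c c e = 0\<rbrakk> \<Longrightarrow> False"
proof -
  have ne: "a \<noteq> 0" "b \<noteq> 0" "c \<noteq> 0" "a \<noteq> b" "b \<noteq> c" "a \<noteq> c" using assms(2) by (auto simp: scalene_def)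
  note H = assms(1)[unfolded heptagonal_def]
  show "False" if K: "cm6 c a a b b e = 0" "cm6 b a a a a e = 0" "cm6 a b b a a e = 0"
  proof -
    have False if h: "e = a" using K[unfolded cm6_def h] H ne by algebra
    moreover have False if h: "e = b" using K[unfolded cm6_def h] H ne by algebra
    moreover have False if h: "e = c" using K[unfolded cm6_def h] H ne by algebra
    ultimately show ?thesis using e by blast
  qed
  show "e = c" if K: "cm6 c a c b a e = 0" "cm6 b a c a b e = 0" "cm6 a b a a b e = 0"
  proof -
    have False if h: "e = a" using K[unfolded cm6_def h] H ne by algebra
    moreover have False if h: "e = b" using K[unfolded cm6_def h] H ne by algebra
    ultimately show ?thesis using e by blast
  qed
  show "e = c" if K: "cm6 c a b b b e = 0" "cm6 b a b a c e = 0" "cm6 a b b a c e = 0"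
  proof -
    have False if h: "e = a" using K[unfolded cm6_def h] H ne by algebra
    moreover have False if h: "e = b" using K[unfolded cm6_def h] H ne by algebra
    ultimately show ?thesis using e by blast
  qed
  show "e = b" if K: "cm6 c a a b c e = 0" "cm6 b a a a c e = 0" "cm6 a b c a c e = 0"
  proof -
    have False if h: "e = a" using K[unfolded cm6_def h] H ne by algebra
    moreover have False if h: "e = c" using K[unfolded cm6_def h] H ne by algebra
    ultimately show ?thesis using e by blast
  qed
  show "False" if K: "cm6 c c c a a e = 0" "cm6 b c c b b e = 0" "cm6 a a a b b e = 0"
  proof -
    have False if h: "e = a" using K[unfolded cm6_def h] H ne by algebra
    moreover have False if h: "e = b" using K[unfolded cm6_def h] H ne by algebra
    moreover have False if h: "e = c" using K[unfolded cm6_def h] H ne by algebra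
    ultimately show ?thesis using e by blast
  qed
  show "e = a" if K: "cm6 c c b a b e = 0" "cm6 b c b b c e = 0" "cm6 a a b b c e = 0"
  proof -
    have False if h: "e = b" using K[unfolded cm6_def h] H ne by algebra
    moreover have False if h: "e = c" using K[unfolded cm6_def h] H ne by algebra
    ultimately show ?thesis using e by blast
  qed
  show "e = b" if K: "cm6 c c a a c e = 0" "cm6 b c a b c e = 0" "cm6 a a c b c e = 0"
  proof -
    have False if h: "e = a" using K[unfolded cm6_def h] H ne by algebra
    moreover have False if h: "e = c" using K[unfolded cm6_def h] H ne by algebra
    ultimately show ?thesis using e by blast
  qed
  show "False" if K: "cm6 c b b b b e = 0" "cm6 b b b c c e = 0" "cm6 a b b c c e = 0"
  proof -
    have False if h: "e = a" using K[unfolded cm6_def h] H ne by algebra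
    moreover have False if h: "e = b" using K[unfolded cm6_def h] H ne by algebra
    moreover have False if h: "e = c" using K[unfolded cm6_def h] H ne by algebra
    ultimately show ?thesis using e by blast
  qed
  show "e = a" if K: "cm6 c b a b c e = 0" "cm6 b b a c c e = 0" "cm6 a b c c c e = 0"
  proof -
    have False if h: "e = b" using K[unfolded cm6_def h] H ne by algebra
    moreover have False if h: "e = c" using K[unfolded cm6_def h] H ne by algebra
    ultimately show ?thesis using e by blast
  qed
  show "False" if K: "cm6 c a a c c e = 0" "cm6 b a a c c e = 0" "cm6 a c c c c e = 0"
  proof -
    have False if h: "e = a" using K[unfolded cm6_def h] H ne by algebra
    moreover have False if h: "e = b" using K[unfolded cm6_def h] H ne by algebra
    moreover have False if h: "e = c" using K[unfolded cm6_def h] H ne by algebra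
    ultimately show ?thesis using e by blast
  qed
qed

context triangle_copies
begin

text \<open>Embed \<open>ABC\<close> in a regular heptagon as the vertices \<open>0\<close>, \<open>3\<close>, \<open>2\<close>. The four possible distance vectors of a further point
  are those of the vertices \<open>1\<close>, \<open>4\<close>, \<open>5\<close>, \<open>6\<close>.\<close>

definition seen_at :: "'a \<Rightarrow> 'a \<Rightarrow> 'a \<Rightarrow> 'a \<Rightarrow> real \<Rightarrow> real \<Rightarrow> real \<Rightarrow> bool" where
  "seen_at A B C i p q r \<longleftrightarrow> i \<in> S \<and> i \<noteq> A \<and> i \<noteq> B \<and> i \<noteq> C \<and> d A i = p \<and> d B i = q \<and> d C i = r"

text \<open>All support points occupy different heptagon positions, so an edge becomes a triple of
  positions whose differences lie in three different distance classes, and the 14-term inequality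
  applies.\<close>

theorem heptagonal_bound:
  assumes sc0: "scalene x y z" and abc: "perm3 a b c x y z" and hept: "heptagonal a b c"
  shows "hsum E w \<le> 2 / 49"
proof (cases "E = {}")
  case True
  then show ?thesis by (simp add: hsum_def)
next
  case False
  have sc: "scalene a b c" using scalene_perm[OF sc0 abc] .
  obtain e where e: "e \<in> E" using False by auto
  then obtain i j k where ijk: "e = {i, j, k}" "i \<noteq> j" "j \<noteq> k" "i \<noteq> k"
    using card_edge by (metis card_3_iff)
  then have dijk: "perm3 (d i j) (d j k) (d k i) a b c"
    using edge_d[of i j k] e abc perm3_trans perm3_sym by blast
  have ijkS: "i \<in> S" "j \<in> S" "k \<in> S" using edge_sub[OF e] ijk by auto
  obtain A B C where ABC: "A \<in> S" "B \<in> S" "C \<in> S" "A \<noteq> B" "B \<noteq> C" "A \<noteq> C"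
    and dABC: "d A B = c" "d A C = b" "d B C = a"
  proof -
    from dijk consider "d i j = a \<and> d j k = b \<and> d k i = c" | "d i j = a \<and> d j k = c \<and> d k i = b"
      | "d i j = b \<and> d j k = a \<and> d k i = c" | "d i j = b \<and> d j k = c \<and> d k i = a"
      | "d i j = c \<and> d j k = a \<and> d k i = b" | "d i j = c \<and> d j k = b \<and> d k i = a"
      unfolding perm3_def by blast
    then show thesis
    proof cases
      case 1
      then show ?thesis using ijk ijkS by (intro that[of k i j]) (auto simp: d_sym)
    next
      case 2
      then show ?thesis using ijk ijkS by (intro that[of k j i]) (auto simp: d_sym)
    next
      case 3
      then show ?thesis using ijk ijkS by (intro that[of i k j]) (auto simp: d_sym)
    next
      case 4
      then show ?thesis using ijk ijkS by (intro that[of j k i]) (auto simp: d_sym)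
    next
      case 5
      then show ?thesis using ijk ijkS by (intro that[of i j k]) (auto simp: d_sym)
    next
      case 6
      then show ?thesis using ijk ijkS by (intro that[of j i k]) (auto simp: d_sym)
    qed
  qed
  \<comment> \<open>The position is decoded from the distances to \<open>A\<close> and
    \<open>B\<close>; the final default 6 is right because \<open>heptagon_point\<close> leaves only
    four distance vectors.\<close>
  define p where "p i = (if i = A then 0 else if i = B then 3 else if i = C then 2 else if d A i = c then 4
    else if d A i = b then 5 else if d B i = b then 1 else 6 :: nat)" for i
  \<comment> \<open>Classes of chords by the difference of positions: 1 and 6, 2 and 5, and, as the
    default, 3 and 4. \<open>cl\<close> is the squared length belonging to the class.\<close>
  define col where "col m = (if m = 1 \<or> m = 6 then 0 else if m = 2 \<or> m = 5 then 1 else 2 :: nat)" for m :: nat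
  define cl where "cl m = (if m = 1 \<or> m = 6 then a else if m = 2 \<or> m = 5 then b else c)" for m :: nat
  let ?at = "seen_at A B C"
  have pos: "i = A \<and> p i = 0 \<or> i = B \<and> p i = 3 \<or> i = C \<and> p i = 2 \<or> ?at i a b a \<and> p i = 1 \<or>
      ?at i c a b \<and> p i = 4 \<or> ?at i b b c \<and> p i = 5 \<or> ?at i a c c \<and> p i = 6" if i: "i \<in> S" for i
  proof (cases "i = A \<or> i = B \<or> i = C")
    case True
    then show ?thesis using ABC by (auto simp: p_def)
  next
    case False
    then have "d A i \<in> {a, b, c}" "d B i \<in> {a, b, c}" "d C i \<in> {a, b, c}"
      using colour'[OF abc] i ABC by auto
    moreover have "cm6 c b (d A i) a (d B i) (d C i) = 0" using cm[of A B C i] dABC by simp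
    ultimately have "d A i = a \<and> d B i = b \<and> d C i = a \<or> d A i = c \<and> d B i = a \<and> d C i = b \<or>
      d A i = b \<and> d B i = b \<and> d C i = c \<or> d A i = a \<and> d B i = c \<and> d C i = c"
      by (rule heptagon_point[OF hept sc])
    then show ?thesis using False i sc by (auto simp: p_def seen_at_def scalene_def)
  qed
  have col3: "d i j \<in> {a, b, c}" if "i \<in> S" "j \<in> S" "i \<noteq> j" for i j using colour'[OF abc that] .
  have h11: "False" if "i \<noteq> j" "?at i a b a" "?at j a b a" for i j
    using that dABC col3[of i j] cm[of A B i j] cm[of A C i j] cm[of B C i j]
    by (intro heptagon_pair(1)[OF hept sc]) (auto simp: seen_at_def)
  have h14: "d i j = c" if "i \<noteq> j" "?at i a b a" "?at j c a b" for i j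
    using that dABC col3[of i j] cm[of A B i j] cm[of A C i j] cm[of B C i j]
    by (intro heptagon_pair(2)[OF hept sc]) (auto simp: seen_at_def)
  have h15: "d i j = c" if "i \<noteq> j" "?at i a b a" "?at j b b c" for i j
    using that dABC col3[of i j] cm[of A B i j] cm[of A C i j] cm[of B C i j]
    by (intro heptagon_pair(3)[OF hept sc]) (auto simp: seen_at_def)
  have h16: "d i j = b" if "i \<noteq> j" "?at i a b a" "?at j a c c" for i j
    using that dABC col3[of i j] cm[of A B i j] cm[of A C i j] cm[of B C i j]
    by (intro heptagon_pair(4)[OF hept sc]) (auto simp: seen_at_def)
  have h44: "False" if "i \<noteq> j" "?at i c a b" "?at j c a b" for i j
    using that dABC col3[of i j] cm[of A B i j] cm[of A C i j] cm[of B C i j]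
    by (intro heptagon_pair(5)[OF hept sc]) (auto simp: seen_at_def)
  have h45: "d i j = a" if "i \<noteq> j" "?at i c a b" "?at j b b c" for i j
    using that dABC col3[of i j] cm[of A B i j] cm[of A C i j] cm[of B C i j]
    by (intro heptagon_pair(6)[OF hept sc]) (auto simp: seen_at_def)
  have h46: "d i j = b" if "i \<noteq> j" "?at i c a b" "?at j a c c" for i j
    using that dABC col3[of i j] cm[of A B i j] cm[of A C i j] cm[of B C i j]
    by (intro heptagon_pair(7)[OF hept sc]) (auto simp: seen_at_def)
  have h55: "False" if "i \<noteq> j" "?at i b b c" "?at j b b c" for i j
    using that dABC col3[of i j] cm[of A B i j] cm[of A C i j] cm[of B C i j]
    by (intro heptagon_pair(8)[OF hept sc]) (auto simp: seen_at_def)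
  have h56: "d i j = a" if "i \<noteq> j" "?at i b b c" "?at j a c c" for i j
    using that dABC col3[of i j] cm[of A B i j] cm[of A C i j] cm[of B C i j]
    by (intro heptagon_pair(9)[OF hept sc]) (auto simp: seen_at_def)
  have h66: "False" if "i \<noteq> j" "?at i a c c" "?at j a c c" for i j
    using that dABC col3[of i j] cm[of A B i j] cm[of A C i j] cm[of B C i j]
    by (intro heptagon_pair(10)[OF hept sc]) (auto simp: seen_at_def)
  \<comment> \<open>\<open>Q m i\<close> puts \<open>i\<close> at position \<open>m\<close>. Since
    \<open>R\<close> demands \<open>n < m\<close>, its instances with equal positions are false and
    express that no position is taken twice.\<close>
  define Q where "Q m i \<longleftrightarrow> (m = 0 \<and> i = A \<or> m = 3 \<and> i = B \<or> m = 2 \<and> i = C \<or> m = 1 \<and> ?at i a b a \<or>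
      m = 4 \<and> ?at i c a b \<or> m = 5 \<and> ?at i b b c \<or> m = 6 \<and> ?at i a c c)" for m :: nat and i
  define R where "R m n i j \<longleftrightarrow> n < m \<and> d i j = cl (m - n)" for m n :: nat and i j
  have q0: "R m 0 i j" if "Q m i" "Q 0 j" "i \<noteq> j" for m i j
    using that dABC by (auto simp: R_def Q_def cl_def seen_at_def d_sym)
  have q2: "R m 2 i j" if "Q m i" "Q 2 j" "i \<noteq> j" "2 \<le> m" for m i j
    using that dABC by (auto simp: R_def Q_def cl_def seen_at_def d_sym)
  have q3: "R m 3 i j" if "Q m i" "Q 3 j" "i \<noteq> j" "3 \<le> m" for m i j
    using that dABC by (auto simp: R_def Q_def cl_def seen_at_def d_sym)
  have q11: "R 1 1 i j" if "Q 1 i" "Q 1 j" "i \<noteq> j" for i j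
    using that dABC h11[of i j] by (auto simp: R_def Q_def cl_def seen_at_def d_sym)
  have q21: "R 2 1 i j" if "Q 2 i" "Q 1 j" "i \<noteq> j" for i j
    using that dABC by (auto simp: R_def Q_def cl_def seen_at_def d_sym)
  have q31: "R 3 1 i j" if "Q 3 i" "Q 1 j" "i \<noteq> j" for i j
    using that dABC by (auto simp: R_def Q_def cl_def seen_at_def d_sym)
  have q41: "R 4 1 i j" if "Q 4 i" "Q 1 j" "i \<noteq> j" for i j
    using that dABC h14[of j i] by (auto simp: R_def Q_def cl_def seen_at_def d_sym)
  have q44: "R 4 4 i j" if "Q 4 i" "Q 4 j" "i \<noteq> j" for i j
    using that dABC h44[of i j] by (auto simp: R_def Q_def cl_def seen_at_def d_sym)
  have q51: "R 5 1 i j" if "Q 5 i" "Q 1 j" "i \<noteq> j" for i j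
    using that dABC h15[of j i] by (auto simp: R_def Q_def cl_def seen_at_def d_sym)
  have q54: "R 5 4 i j" if "Q 5 i" "Q 4 j" "i \<noteq> j" for i j
    using that dABC h45[of j i] by (auto simp: R_def Q_def cl_def seen_at_def d_sym)
  have q55: "R 5 5 i j" if "Q 5 i" "Q 5 j" "i \<noteq> j" for i j
    using that dABC h55[of i j] by (auto simp: R_def Q_def cl_def seen_at_def d_sym)
  have q61: "R 6 1 i j" if "Q 6 i" "Q 1 j" "i \<noteq> j" for i j
    using that dABC h16[of j i] by (auto simp: R_def Q_def cl_def seen_at_def d_sym)
  have q64: "R 6 4 i j" if "Q 6 i" "Q 4 j" "i \<noteq> j" for i j
    using that dABC h46[of j i] by (auto simp: R_def Q_def cl_def seen_at_def d_sym)
  have q65: "R 6 5 i j" if "Q 6 i" "Q 5 j" "i \<noteq> j" for i j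
    using that dABC h56[of j i] by (auto simp: R_def Q_def cl_def seen_at_def d_sym)
  have q66: "R 6 6 i j" if "Q 6 i" "Q 6 j" "i \<noteq> j" for i j
    using that dABC h66[of i j] by (auto simp: R_def Q_def cl_def seen_at_def d_sym)
  have dist_Q: "R m n i j" if Q: "Q m i" "Q n j" and ne: "i \<noteq> j" and mn: "n \<le> m" for m n i j
  proof -
    have "n = 0 \<or> n = 1 \<or> n = 2 \<or> n = 3 \<or> n = 4 \<or> n = 5 \<or> n = 6" "m = 0 \<or> m = 1 \<or> m = 2 \<or> m = 3 \<or> m = 4 \<or> m = 5 \<or> m = 6"
      using Q by (auto simp: Q_def)
    then show ?thesis using Q ne mn
      by (elim disjE) (simp_all add: q0 q2 q3 q11 q21 q31 q41 q44 q51 q54 q55 q61 q64 q65 q66 del: One_nat_def)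
  qed
  have dist: "p j < p i \<and> d i j = cl (p i - p j)" if ij: "i \<in> S" "j \<in> S" "i \<noteq> j" "p j \<le> p i" for i j
    using pos[OF ij(1)] pos[OF ij(2)] dist_Q[OF _ _ ij(3,4)] by (auto simp: Q_def R_def)
  have inj_p: "inj_on p S"
    by (rule inj_onI) (use dist in force)
  define RB where "RB i j k \<longleftrightarrow> col (i - j) \<noteq> col (j - k) \<and> col (i - j) \<noteq> col (i - k) \<and> col (j - k) \<noteq> col (i - k)" for i j k :: nat
  have p7: "p i < 7" if "i \<in> S" for i using pos[OF that] by auto
  have RB: "RB (p i) (p j) (p k)"
    if "{i, j, k} \<in> E" "p k < p j" "p j < p i" for i j k
  proof -
    have S: "i \<in> S" "j \<in> S" "k \<in> S" and ne: "i \<noteq> j" "j \<noteq> k" "i \<noteq> k" using that edge_sub by auto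
    have "perm3 (d i j) (d j k) (d k i) x y z" using that(1) ne by (intro edge_d)
    then have "scalene (d i j) (d j k) (d k i)" using scalene_perm[OF sc0] by blast
    then have "cl (p i - p j) \<noteq> cl (p j - p k)" "cl (p i - p j) \<noteq> cl (p i - p k)" "cl (p j - p k) \<noteq> cl (p i - p k)"
      using dist[OF S(1,2) ne(1)] dist[OF S(2,3) ne(2)] dist[OF S(1,3) ne(3)] that by (auto simp: scalene_def d_sym)
    moreover have "cl m = [a, b, c] ! col m" for m by (simp add: cl_def col_def)
    ultimately show ?thesis by (auto simp: RB_def)
  qed
  obtain v where v: "\<And>k. 0 \<le> v k" "sum v {..<7 :: nat} = 1"
    and le: "hsum E w \<le> (\<Sum>i<7. \<Sum>j<i. \<Sum>k<j. if RB i j k then v i * v j * v k else 0)"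
    by (rule hsum_le_triples[OF inj_p p7, of RB]) (use RB in auto)
  have "v 0 + v 1 + v 2 + v 3 + v 4 + v 5 + v 6 = 1"
    using v(2) by (simp add: numeral_eq_Suc)
  then have "49 * (v 0 * v 1 * v 3 + v 0 * v 1 * v 5 + v 0 * v 2 * v 3 + v 0 * v 2 * v 6 + v 0 * v 4 * v 5 + v 0 * v 4 * v 6 + v 1 * v 2 * v 4 + v 1 * v 2 * v 6 + v 1 * v 3 * v 4 + v 1 * v 5 * v 6 + v 2 * v 3 * v 5 + v 2 * v 4 * v 5 + v 3 * v 4 * v 6 + v 3 * v 5 * v 6) \<le> 2"
    using heptagon_inequality[OF v(1)[of 0] v(1)[of 1] v(1)[of 2] v(1)[of 3] v(1)[of 4] v(1)[of 5] v(1)[of 6]] by simp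
  moreover have "(\<Sum>i<7. \<Sum>j<i. \<Sum>k<j. if RB i j k then v i * v j * v k else 0) = v 0 * v 1 * v 3 + v 0 * v 1 * v 5 + v 0 * v 2 * v 3 + v 0 * v 2 * v 6 + v 0 * v 4 * v 5 + v 0 * v 4 * v 6 + v 1 * v 2 * v 4 + v 1 * v 2 * v 6 + v 1 * v 3 * v 4 + v 1 * v 5 * v 6 + v 2 * v 3 * v 5 + v 2 * v 4 * v 5 + v 3 * v 4 * v 6 + v 3 * v 5 * v 6"
    by (simp add: numeral_eq_Suc RB_def col_def mult.commute mult.left_commute)
  ultimately have "49 * (\<Sum>i<7. \<Sum>j<i. \<Sum>k<j. if RB i j k then v i * v j * v k else 0) \<le> 2"
    by (simp only:)
  moreover have "49 * hsum E w \<le> 49 * (\<Sum>i<7. \<Sum>j<i. \<Sum>k<j. if RB i j k then v i * v j * v k else 0)"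
    using le by (intro mult_left_mono) simp_all
  ultimately have "49 * hsum E w \<le> 2" by (rule order_trans[rotated])
  then show ?thesis by simp
qed

end

section \<open>Right triangles\<close>

text \<open>Every edge is a pair from \<open>M\<close> and one more vertex. A pair of total weight
  \<open>t\<close> contributes at most \<open>t^2 / 4 * (1 - t)\<close>, hence at most
  \<open>t / 16\<close>, and by disjointness the totals add up to at most 1.\<close>

lemma (in weighted_hypergraph) hsum_le_disjoint_pairs:
  assumes M: "M \<subseteq> Pow S" "\<And>P. P \<in> M \<Longrightarrow> card P = 2"
    and disj: "pairwise disjnt M" and meets: "\<And>e. e \<in> E \<Longrightarrow> \<exists>P\<in>M. P \<subseteq> e"
  shows "hsum E w \<le> 1 / 16"
proof -
  have fM: "finite M" using M(1) finite_S by (meson finite_Pow_iff finite_subset)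
  have fP: "finite P" if "P \<in> M" for P using M(1) that by (intro finite_subset[OF _ finite_S]) auto
  have "hsum E w \<le> (\<Sum>(P, r)\<in>(SIGMA P:M. S - P). prod w P * w r)"
    unfolding hsum_def
  proof (rule sum_le_included[where i = "\<lambda>(P, r). insert r P"])
    show "\<forall>t\<in>SIGMA P:M. S - P. 0 \<le> (case t of (P, r) \<Rightarrow> prod w P * w r)"
      using M(1) w_pos by (auto intro!: mult_nonneg_nonneg prod_nonneg simp: less_imp_le subset_iff)
    show "\<forall>e\<in>E. \<exists>t\<in>SIGMA P:M. S - P. (case t of (P, r) \<Rightarrow> insert r P) = e \<and> prod w e \<le> (case t of (P, r) \<Rightarrow> prod w P * w r)"
    proof
      fix e assume e: "e \<in> E"
      obtain P where P: "P \<in> M" "P \<subseteq> e" using meets[OF e] by auto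
      have "card (e - P) = 1"
        using card_Diff_subset[OF fP[OF P(1)] P(2)] card_edge[OF e] M(2)[OF P(1)] by simp
      then obtain r where r: "e - P = {r}" by (auto simp: card_1_singleton_iff)
      then have e_eq: "e = insert r P" "r \<notin> P" using P(2) by auto
      then have "r \<in> S" using edge_sub[OF e] by auto
      moreover have "prod w e = prod w P * w r" using e_eq fP[OF P(1)] by (simp add: mult.commute)
      ultimately show "\<exists>t\<in>SIGMA P:M. S - P. (case t of (P, r) \<Rightarrow> insert r P) = e \<and> prod w e \<le> (case t of (P, r) \<Rightarrow> prod w P * w r)"
        using e_eq P(1) by (intro bexI[of _ "(P, r)"]) auto
    qed
  qed (use fM finite_S finite_E in auto)
  also have "\<dots> = (\<Sum>P\<in>M. prod w P * (1 - sum w P))"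
  proof -
    have "(\<Sum>r\<in>S - P. prod w P * w r) = prod w P * (1 - sum w P)" if "P \<in> M" for P
    proof -
      have "P \<subseteq> S" using M(1) that by auto
      then have "sum w (S - P) = 1 - sum w P" using sum_diff[OF finite_S, of P w] w_sum by simp
      then show ?thesis by (simp add: sum_distrib_left[symmetric])
    qed
    then show ?thesis using fM finite_S by (simp add: sum.Sigma[symmetric])
  qed
  also have "\<dots> \<le> (\<Sum>P\<in>M. sum w P / 16)"
  proof (intro sum_mono)
    fix P assume P: "P \<in> M"
    then have "card P = 2" by (rule M(2))
    then obtain i j where ij: "P = {i, j}" "i \<noteq> j" unfolding card_2_iff by blast
    then have S: "i \<in> S" "j \<in> S" using P M(1) by auto
    define t where "t = sum w P"
    have t: "t = w i + w j" using ij by (simp add: t_def)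
    have "t \<le> 1" unfolding t_def w_sum[symmetric]
      by (rule sum_mono2[OF finite_S]) (use P M(1) w_pos in \<open>auto simp: less_imp_le\<close>)
    have "4 * (w i * w j) \<le> t\<^sup>2"
      using zero_le_power2[of "w i - w j"] by (simp add: t power2_eq_square algebra_simps)
    moreover have "prod w P = w i * w j" using ij by simp
    ultimately have "prod w P * (1 - t) \<le> t\<^sup>2 / 4 * (1 - t)"
      using \<open>t \<le> 1\<close> by (intro mult_right_mono) auto
    also have "\<dots> = t * (t * (1 - t)) / 4" by (simp add: power2_eq_square algebra_simps)
    also have "t * (1 - t) \<le> 1 / 4"
      using zero_le_power2[of "t - 1 / 2"] by (simp add: power2_eq_square algebra_simps)
    then have "t * (t * (1 - t)) / 4 \<le> t * (1 / 4) / 4"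
      using w_pos[OF S(1)] w_pos[OF S(2)] t by (intro divide_right_mono mult_left_mono) auto
    finally show "prod w P * (1 - sum w P) \<le> sum w P / 16" by (simp add: t_def)
  qed
  also have "\<dots> = (\<Sum>P\<in>M. sum w P) / 16" by (simp add: sum_divide_distrib)
  also have "(\<Sum>P\<in>M. sum w P) = sum w (\<Union>M)"
    using fP disj by (intro sum.Union_disjoint[symmetric, unfolded o_def]) (auto simp: pairwise_def disjnt_def)
  also have "\<dots> \<le> sum w S" using M(1) finite_S w_pos by (intro sum_mono2) (auto simp: less_imp_le)
  finally show ?thesis using w_sum by simp
qed

section \<open>Copies of a right triangle on a common side and the regular hexagon\<close>

definition right_sides :: "real \<Rightarrow> real \<Rightarrow> real \<Rightarrow> bool" where
  "right_sides x y z \<longleftrightarrow> x + y = z \<or> x + z = y \<or> y + z = x"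

lemma right_sides_perm: "perm3 a b c x y z \<Longrightarrow> right_sides a b c \<longleftrightarrow> right_sides x y z"
  by (auto simp: perm3_def right_sides_def)

text \<open>A point at admissible distances from five vertices of a hexagon of side 1 is its centre
  (all distances 1) or its sixth vertex. The determinants are applied one after another, each to the
  few candidates left by the previous ones, instead of to all 243 tuples.\<close>

lemma hexagon_point:
  assumes "p \<in> {1, 3, 4}" "q \<in> {1, 3, 4}" "r \<in> {1, 3, 4}" "s \<in> {1, 3, 4}" "t \<in> {1, 3, 4 :: real}"
    and uvP: "cm6 4 3 p 1 q r = 0" and uPQ: "cm6 3 1 p 4 r t = 0" and uPQ': "cm6 3 1 p 1 s t = 0" and vPQ': "cm6 1 3 q 1 s t = 0"
  shows "p = 1 \<and> q = 1 \<and> r = 1 \<and> s = 1 \<and> t = 1 \<or> p = 1 \<and> q = 3 \<and> r = 1 \<and> s = 4 \<and> t = 3"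
proof -
  have "(p, q, r) \<in> {(1, 1, 1), (1, 3, 1), (1, 3, 4), (3, 1, 3), (4, 4, 1)}"
    using assms(1-3) uvP by (elim insertE emptyE; clarify; simp add: cm6_def)
  then have "(p, q, r, t) \<in> {(1, 1, 1, 1), (1, 1, 1, 3), (1, 3, 1, 1), (1, 3, 1, 3), (1, 3, 4, 4), (3, 1, 3, 1), (4, 4, 1, 3)}"
    using assms(5) uPQ by (elim insertE emptyE; clarify; simp add: cm6_def)
  then have "(p, q, r, s, t) \<in> {(1, 1, 1, 1, 1), (1, 1, 1, 4, 1), (1, 1, 1, 4, 3), (1, 3, 1, 1, 1), (1, 3, 1, 4, 1), (1, 3, 1, 4, 3), (3, 1, 3, 3, 1), (4, 4, 1, 1, 3)}"
    using assms(4) uPQ' by (elim insertE emptyE; clarify; simp add: cm6_def)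
  then show ?thesis
    using vPQ' by (elim insertE emptyE; clarify; simp add: cm6_def)
qed

lemma cm6_scale: "cm6 (k * p) (k * q) (k * r) (k * s) (k * t) (k * u) = k ^ 3 * cm6 p q r s t u"
  unfolding cm6_def by algebra

context triangle_copies
begin

text \<open>Five vertices of a regular hexagon with squared side \<open>k\<close>, where \<open>uv\<close> and \<open>PQ\<close> are long diagonals; the triangle has
  angles 30, 60 and 90 degrees. Every copy contains a long diagonal, and long diagonals are pairwise disjoint.\<close>

definition hexagon5 :: "real \<Rightarrow> 'a \<Rightarrow> 'a \<Rightarrow> 'a \<Rightarrow> 'a \<Rightarrow> 'a \<Rightarrow> bool" where
  "hexagon5 k u v P P' Q \<longleftrightarrow> 0 < k \<and> {u, v, P, P', Q} \<subseteq> S \<and> distinct [u, v, P, P', Q] \<and> perm3 k (3 * k) (4 * k) x y z \<and>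
     d u v = 4 * k \<and> d u P = 3 * k \<and> d v P = k \<and> d u P' = 3 * k \<and> d v P' = k \<and> d P P' = 3 * k \<and>
     d u Q = k \<and> d v Q = 3 * k \<and> d P Q = 4 * k \<and> d P' Q = k"

lemma hexagon5_bound:
  assumes H: "hexagon5 k u v P P' Q"
  shows "hsum E w \<le> 1 / 16"
proof -
  have k: "0 < k" and S: "u \<in> S" "v \<in> S" "P \<in> S" "P' \<in> S" "Q \<in> S" and dst: "distinct [u, v, P, P', Q]"
    and perm: "perm3 k (3 * k) (4 * k) x y z"
    and dd: "d u v = 4 * k" "d u P = 3 * k" "d v P = k" "d u P' = 3 * k" "d v P' = k" "d P P' = 3 * k"
     "d u Q = k" "d v Q = 3 * k" "d P Q = 4 * k" "d P' Q = k"
    using H by (auto simp: hexagon5_def)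
  define D where "D i j = inverse k * d i j" for i j
  have D_sym: "D i j = D j i" for i j by (simp add: D_def d_sym)
  have D: "D u v = 4" "D u P = 3" "D v P = 1" "D u P' = 3" "D v P' = 1" "D P P' = 3"
     "D u Q = 1" "D v Q = 3" "D P Q = 4" "D P' Q = 1" using dd k by (simp_all add: D_def)
  have colD: "D i j \<in> {1, 3, 4}" if "i \<in> S" "j \<in> S" "i \<noteq> j" for i j
    using colour'[OF perm that] k by (auto simp: D_def)
  have cmD: "cm6 (D i j) (D i l) (D i m) (D j l) (D j m) (D l m) = 0" for i j l m
    unfolding D_def cm6_scale cm by simp
  let ?F = "{u, v, P, P', Q}"
  have pt: "D u i = 1 \<and> D v i = 1 \<and> D P i = 1 \<and> D P' i = 1 \<and> D Q i = 1 \<or>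
      D u i = 1 \<and> D v i = 3 \<and> D P i = 1 \<and> D P' i = 4 \<and> D Q i = 3" if i: "i \<in> S" "i \<notin> ?F" for i
  proof (rule hexagon_point)
    show "D u i \<in> {1, 3, 4}" "D v i \<in> {1, 3, 4}" "D P i \<in> {1, 3, 4}" "D P' i \<in> {1, 3, 4}" "D Q i \<in> {1, 3, 4}"
      by (rule colD; use i S in blast)+
    show "cm6 4 3 (D u i) 1 (D v i) (D P i) = 0" using cmD[of u v P i] D by simp
    show "cm6 3 1 (D u i) 4 (D P i) (D Q i) = 0" using cmD[of u P Q i] D by simp
    show "cm6 3 1 (D u i) 1 (D P' i) (D Q i) = 0" using cmD[of u P' Q i] D by simp
    show "cm6 1 3 (D v i) 1 (D P' i) (D Q i) = 0" using cmD[of v P' Q i] D by simp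
  qed
  have no4: "D i j \<noteq> 4" if ij: "i \<in> S" "j \<in> S" "i \<noteq> j" "i \<notin> ?F" "j \<notin> ?F" for i j
  proof
    assume e: "D i j = 4"
    have "cm6 4 (D u i) (D u j) (D v i) (D v j) 4 = 0" using cmD[of u v i j] D e by simp
    moreover have "cm6 3 (D u i) (D u j) (D P i) (D P j) 4 = 0" using cmD[of u P i j] D e by simp
    moreover have "cm6 1 (D v i) (D v j) (D P' i) (D P' j) 4 = 0" using cmD[of v P' i j] D e by simp
    ultimately show False using pt[OF ij(1,4)] pt[OF ij(2,5)]
      by (elim disjE conjE) (simp_all add: cm6_def)
  qed
  have same: "D P' i = 4 \<Longrightarrow> D P' j = 4 \<Longrightarrow> False" if ij: "i \<in> S" "j \<in> S" "i \<noteq> j" "i \<notin> ?F" "j \<notin> ?F" for i j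
  proof -
    assume h: "D P' i = 4" "D P' j = 4"
    have i: "D u i = 1" "D v i = 3" "D P i = 1" and j: "D u j = 1" "D v j = 3" "D P j = 1"
      using pt[OF ij(1,4)] pt[OF ij(2,5)] h by auto
    have "cm6 4 1 1 3 3 (D i j) = 0" using cmD[of u v i j] D i j by simp
    moreover have "cm6 3 1 1 1 1 (D i j) = 0" using cmD[of u P i j] D i j by simp
    moreover have "D i j = 1 \<or> D i j = 3 \<or> D i j = 4" using colD[OF ij(1-3)] by simp
    ultimately show False by (elim disjE) (simp_all add: cm6_def)
  qed
  \<comment> \<open>Among the five vertices only \<open>P'\<close> lacks its antipode, so only
    \<open>P'\<close> can have a partner outside, and \<open>same\<close> allows at most
    one.\<close>
  have partner: "j = j'" if h: "i \<in> S" "j \<in> S" "j' \<in> S" "i \<noteq> j" "i \<noteq> j'" "D i j = 4" "D i j' = 4" for i j j'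
  proof (cases "i \<in> ?F")
    case True
    have out: "i = P'" if "l \<in> S" "l \<notin> ?F" "D i l = 4" for l
      using pt[OF that(1,2)] that(3) True by auto
    have F: "l = v \<and> i = u \<or> l = u \<and> i = v \<or> l = Q \<and> i = P \<or> l = P \<and> i = Q" if "l \<in> ?F" "l \<noteq> i" "D i l = 4" for l
      using that True D by (auto simp: D_sym)
    show ?thesis
    proof (rule ccontr)
      assume ne: "j \<noteq> j'"
      consider "j \<in> ?F" "j' \<in> ?F" | "j \<notin> ?F" "j' \<in> ?F" | "j \<in> ?F" "j' \<notin> ?F" | "j \<notin> ?F" "j' \<notin> ?F" by blast
      then show False
      proof cases
        case 1
        then show False using F[of j] F[of j'] h ne dst by auto
      next
        case 2
        then show False using out[of j] F[of j'] h dst by auto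
      next
        case 3
        then show False using out[of j'] F[of j] h dst by auto
      next
        case 4
        then show False using out[of j] same[of j j'] h ne by auto
      qed
    qed
  next
    case False
    have "l = P'" if "l \<in> S" "l \<noteq> i" "D i l = 4" for l
    proof -
      have "l \<in> ?F" using no4[of i l] that False h(1) by auto
      then show ?thesis using pt[OF h(1) False] that by (auto simp: D_sym)
    qed
    then show ?thesis using h by metis
  qed
  define M where "M = {p. \<exists>i j. p = {i, j} \<and> i \<in> S \<and> j \<in> S \<and> i \<noteq> j \<and> D i j = 4}"
  show ?thesis
  proof (rule hsum_le_disjoint_pairs)
    show "M \<subseteq> Pow S" by (auto simp: M_def)
    show "card p = 2" if "p \<in> M" for p using that by (auto simp: M_def)
    show "pairwise disjnt M"
    proof (rule pairwiseI)
      fix p q assume p: "p \<in> M" and q: "q \<in> M" and "p \<noteq> q"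
      show "disjnt p q"
      proof (rule ccontr)
        assume "\<not> disjnt p q"
        then obtain i where i: "i \<in> p" "i \<in> q" by (auto simp: disjnt_def)
        obtain j where j: "p = {i, j}" "i \<in> S" "j \<in> S" "i \<noteq> j" "D i j = 4"
          using p i(1) D_sym unfolding M_def by (auto simp: doubleton_eq_iff)
        obtain j' where j': "q = {i, j'}" "j' \<in> S" "i \<noteq> j'" "D i j' = 4"
          using q i(2) D_sym unfolding M_def by (auto simp: doubleton_eq_iff)
        have "j = j'" using partner j j' by blast
        then show False using j(1) j'(1) \<open>p \<noteq> q\<close> by simp
      qed
    qed
    show "\<exists>p\<in>M. p \<subseteq> e" if e: "e \<in> E" for e
    proof -
      obtain i j l where ijl: "e = {i, j, l}" "i \<noteq> j" "j \<noteq> l" "i \<noteq> l" using card_edge[OF e] by (metis card_3_iff)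
      have ijlS: "i \<in> S" "j \<in> S" "l \<in> S" using edge_sub[OF e] ijl by auto
      have "perm3 (d i j) (d j l) (d l i) k (3 * k) (4 * k)"
        using edge_d[of i j l] e ijl perm perm3_trans perm3_sym by blast
      then have "D i j = 4 \<or> D j l = 4 \<or> D l i = 4" using k by (auto simp: perm3_def D_def)
      moreover have "{a, b} \<in> M" if "a \<in> S" "b \<in> S" "a \<noteq> b" "D a b = 4" for a b
        using that by (auto simp: M_def)
      ultimately show ?thesis using ijl ijlS by (metis insertI1 insert_commute subset_insertI)
    qed
  qed
qed

text \<open>Two points with the same distances to \<open>u\<close> and \<open>v\<close> are mirror
  images in the line \<open>uv\<close>, so \<open>e\<close> determines their distance. Three such
  points would form an equilateral triangle with both \<open>u\<close> and \<open>v\<close> as its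
  centre, and then \<open>3 * a = 3 * b\<close>.\<close>

lemma no_three_alike:
  assumes S: "u \<in> S" "v \<in> S" "r \<in> S" "s \<in> S" "t \<in> S" and dst: "distinct [u, v, r, s, t]"
    and dd: "d u r = a" "d v r = b" "d u s = a" "d v s = b" "d u t = a" "d v t = b" and ab: "a \<noteq> b"
  shows False
proof -
  have pos: "0 < d r s" "0 < d r t" "0 < d s t" "0 < d u v" using S dst by (auto intro: d_pos)
  have e: "e = (4 * a * d u v - (d u v + a - b)\<^sup>2) / d u v"
    if "cm6 (d u v) a a b b e = 0" "0 < e" for e
  proof -
    have "e * (4 * a * d u v - (d u v + a - b)\<^sup>2 - e * d u v) = 0"
      using that(1) unfolding cm6_def by algebra
    then have "4 * a * d u v - (d u v + a - b)\<^sup>2 - e * d u v = 0" using that(2) by simp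
    then show ?thesis using pos(4) by (simp add: field_simps)
  qed
  have "d r s = d r t" "d s t = d r t"
    using e[of "d r s"] e[of "d r t"] e[of "d s t"] cm[of u v r s] cm[of u v r t] cm[of u v s t] dd pos by simp_all
  then have "cm6 a a a (d r t) (d r t) (d r t) = 0" "cm6 b b b (d r t) (d r t) (d r t) = 0"
    using cm[of u r s t] cm[of v r s t] dd by simp_all
  then have "(d r t) = 3 * a" "d r t = 3 * b" using pos(2)[THEN less_imp_neq] unfolding cm6_def by algebra+
  then show False using ab by simp
qed

text \<open>With \<open>uv\<close> a leg, the right angle is at \<open>u\<close> for
  \<open>r\<close> and \<open>s\<close>, so \<open>u\<close> is the midpoint of \<open>rs\<close>,
  and at \<open>v\<close> for \<open>t\<close>. Then \<open>t\<close> would complete a rectangle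
  over \<open>uv\<close> with \<open>r\<close> and with \<open>s\<close> at once.\<close>

lemma right_leg_impossible:
  assumes sc: "scalene a b c" and perm: "perm3 a b c x y z" and right: "b = a + c"
    and S: "u \<in> S" "v \<in> S" "r \<in> S" "s \<in> S" "t \<in> S" and dst: "distinct [u, v, r, s, t]"
    and dd: "d u v = c" "d u r = a" "d v r = b" "d u s = a" "d v s = b" "d u t = b" "d v t = a"
  shows False
proof -
  have ne: "0 < a" "0 < b" "0 < c" "a \<noteq> c" using sc by (auto simp: scalene_def)
  have pos: "0 < d r s" using S dst by (auto intro: d_pos)
  have rt: "d r t \<in> {a, b, c}" "d s t \<in> {a, b, c}" using colour'[OF perm] S dst by auto
  have "d r s * (d r s - 4 * a) * c = 0"
    using cm[of u v r s] dd right unfolding cm6_def by algebra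
  then have rs: "d r s = 4 * a" using ne pos by auto
  have par: "e = c" if "cm6 c a b b a e = 0" "e \<in> {a, b, c}" for e
  proof -
    have "c * (e - c) * (e - c - 4 * a) = 0" using that(1) right unfolding cm6_def by algebra
    then show ?thesis using that(2) ne right by auto
  qed
  have "d r t = c" "d s t = c"
    using par cm[of u v r t] cm[of u v s t] dd rt by simp_all
  then have "cm6 a a b (4 * a) c c = 0" using cm[of u r s t] dd rs by simp
  then show False using ne(1-3)[THEN less_imp_neq] ne(4) right unfolding cm6_def by algebra
qed

text \<open>With \<open>uv\<close> the hypotenuse, \<open>r, s, t\<close> lie on the circle with
  diameter \<open>uv\<close>. The mirror pair \<open>r, s\<close> must have one of the three
  distances, which forces \<open>a = 3 * b\<close>, the angles 30, 60 and 90 degrees; then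
  \<open>t\<close> is antipodal to one of \<open>r, s\<close> and a neighbour of the other on the
  hexagon.\<close>

lemma right_hypotenuse:
  assumes sc: "scalene a b c" and perm: "perm3 a b c x y z" and right: "c = a + b"
    and S: "u \<in> S" "v \<in> S" "r \<in> S" "s \<in> S" "t \<in> S" and dst: "distinct [u, v, r, s, t]"
    and dd: "d u v = c" "d u r = a" "d v r = b" "d u s = a" "d v s = b" "d u t = b" "d v t = a"
    and ab: "b < a"
  shows "\<exists>k u v P P' Q. hexagon5 k u v P P' Q"
proof -
  have ne: "0 < a" "0 < b" "0 < c" "a \<noteq> b" "a \<noteq> c" "b \<noteq> c" using sc by (auto simp: scalene_def)
  have rs: "d r s \<in> {a, b, c}" and pos: "0 < d r s" using colour'[OF perm] S dst by (auto intro: d_pos)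
  have rt: "d r t \<in> {a, b, c}" "d s t \<in> {a, b, c}" using colour'[OF perm] S dst by auto
  \<comment> \<open>The segment \<open>rs\<close> is twice the altitude on the hypotenuse, whose
    square is \<open>a * b / c\<close>.\<close>
  have "d r s * (c * d r s - 4 * a * b) = 0"
    using cm[of u v r s] dd right unfolding cm6_def by algebra
  then have rs': "c * d r s = 4 * a * b" using pos by simp
  have a3: "a = 3 * b" and rsa: "d r s = a"
  proof -
    have "d r s \<noteq> c"
    proof
      assume "d r s = c"
      then have "c * c = 4 * a * b" using rs' by simp
      then have "(a - b)\<^sup>2 = 0" using right by algebra
      then show False using ne by simp
    qed
    moreover have "d r s \<noteq> b"
    proof
      assume "d r s = b"
      then have "b * c = b * (4 * a)" using rs' by simp
      then have "b = 3 * a" using right ne by simp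
      then show False using ab ne by simp
    qed
    ultimately show rsa: "d r s = a" using rs by auto
    then have "a * c = a * (4 * b)" using rs' by simp
    then show "a = 3 * b" using right ne by simp
  qed
  have c4: "c = 4 * b" using right a3 by simp
  have par: "e = c \<or> e = b" if "cm6 c a b b a e = 0" "e \<in> {a, b, c}" for e
  proof -
    have "(e - 4 * b) * (e - b) = 0"
      using that(1)[unfolded a3 c4] ne(2)[THEN less_imp_neq] unfolding cm6_def by algebra
    then show ?thesis using c4 by auto
  qed
  have "d r t = c \<or> d r t = b" "d s t = c \<or> d s t = b"
    using par cm[of u v r t] cm[of u v s t] dd rt by simp_all
  moreover have "cm6 a a b a (d r t) (d s t) = 0" using cm[of u r s t] dd rsa by simp
  moreover have "cm6 b b a a (d r t) (d s t) = 0" using cm[of v r s t] dd rsa by simp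
  moreover have "cm6 a a b a c c \<noteq> 0" "cm6 b b a a b b \<noteq> 0"
    using ne by (auto simp: a3 c4 cm6_def power2_eq_square)
  ultimately consider "d r t = c" "d s t = b" | "d r t = b" "d s t = c" by metis
  then show ?thesis
  proof cases
    case 1
    then have "hexagon5 b u v r s t"
      using ne S dst dd rsa perm unfolding hexagon5_def a3 c4 by (auto simp: perm3_def d_sym)
    then show ?thesis by blast
  next
    case 2
    then have "hexagon5 b u v s r t"
      using ne S dst dd rsa perm unfolding hexagon5_def a3 c4 by (auto simp: perm3_def d_sym)
    then show ?thesis by blast
  qed
qed

end

section \<open>Elementary estimates for small supports\<close>

lemma sum_set_le_sum_list:
  fixes f :: "'a \<Rightarrow> real"
  assumes "E \<subseteq> set xs" "\<And>e. e \<in> set xs \<Longrightarrow> 0 \<le> f e"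
  shows "sum f E \<le> sum_list (map f xs)"
proof -
  have "sum f E \<le> sum f (set xs)" using assms by (intro sum_mono2) auto
  also have "\<dots> \<le> sum_list (map f xs)" using assms(2)
  proof (induction xs)
    case (Cons a xs)
    then show ?case by (cases "a \<in> set xs") (auto simp: insert_absorb intro: add_increasing add_mono)
  qed simp
  finally show ?thesis .
qed

lemma prod3_le:
  fixes a b c :: real
  assumes "0 \<le> a" "0 \<le> b" "0 \<le> c" "a + b + c = 1"
  shows "a * b * c \<le> 1 / 27"
proof -
  have eq: "2 * (a + b + c) ^ 3 - 54 * (a * b * c) =
     (a + b + c) * ((a - b)\<^sup>2 + (b - c)\<^sup>2 + (a - c)\<^sup>2) + 6 * (a * (b - c)\<^sup>2 + b * (a - c)\<^sup>2 + c * (a - b)\<^sup>2)"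
    by algebra
  have "0 \<le> 2 * (a + b + c) ^ 3 - 54 * (a * b * c)"
    unfolding eq using assms(1-3) by simp
  then show ?thesis using assms(4) by simp
qed

lemma perm3_cancel:
  "perm3 a b c a e f \<Longrightarrow> b = e \<and> c = f \<or> b = f \<and> c = e"
  by (auto simp: perm3_def)

lemma (in weighted_hypergraph) hsum_small:
  assumes "card S \<le> 3"
  shows "hsum E w \<le> 1 / 27"
proof (cases "E = {}")
  case True
  then show ?thesis by (simp add: hsum_def)
next
  case False
  then obtain e where e: "e \<in> E" by auto
  have eS: "e = S" if "e \<in> E" for e
    using edge_sub[OF that] card_edge[OF that] assms finite_S by (intro card_subset_eq) (auto dest: card_mono)
  then have "E = {S}" using e by auto
  moreover have "card S = 3" using card_edge[OF e] eS[OF e] by simp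
  then obtain p q r where S: "S = {p, q, r}" "p \<noteq> q" "q \<noteq> r" "p \<noteq> r" by (auto simp: card_3_iff)
  moreover have "w p * w q * w r \<le> 1 / 27"
    using w_pos[of p] w_pos[of q] w_pos[of r] w_sum S by (intro prod3_le) (auto simp: add.assoc)
  ultimately show ?thesis by (simp add: hsum_def mult.assoc)
qed

section \<open>Right triangles and supports with four points\<close>

context triangle_copies
begin

lemma right_core:
  assumes sc: "scalene a b c" and perm: "perm3 a b c x y z" and right: "right_sides a b c"
    and S: "u \<in> S" "v \<in> S" "r \<in> S" "s \<in> S" "t \<in> S" and dst: "distinct [u, v, r, s, t]"
    and dd: "d u v = c" "d u r = a" "d v r = b" "d u s = a" "d v s = b" "d u t = b" "d v t = a"
  shows "hsum E w \<le> 1 / 16"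
proof -
  have sc': "scalene b a c" and perm': "perm3 b a c x y z" and dst': "distinct [v, u, r, s, t]"
    using sc perm dst by (auto simp: scalene_def perm3_def)
  have dd': "d v u = c" using dd by (simp add: d_sym)
  consider "b = a + c" | "a = b + c" | "c = a + b" "b < a" | "c = b + a" "a < b"
    using right sc by (fastforce simp: right_sides_def scalene_def)
  then show ?thesis
  proof cases
    case 1
    then show ?thesis using right_leg_impossible[OF sc perm 1 S dst dd] by simp
  next
    case 2
    then show ?thesis using right_leg_impossible[OF sc' perm' 2 S(2,1,3,4,5) dst' dd'] dd by simp
  next
    case 3
    then show ?thesis using right_hypotenuse[OF sc perm 3(1) S dst dd 3(2)] hexagon5_bound by blast
  next
    case 4
    then show ?thesis using right_hypotenuse[OF sc' perm' 4(1) S(2,1,3,4,5) dst' dd' _ _ _ _ _ _ 4(2)] dd hexagon5_bound by blast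
  qed
qed

theorem right_scalene_bound:
  assumes sc0: "scalene x y z" and right: "right_sides x y z"
  shows "hsum E w \<le> 1 / 16"
proof -
  have tri: "\<exists>c. (\<forall>a b. {v, a, b} \<in> E \<longrightarrow> a \<noteq> v \<longrightarrow> b \<noteq> v \<longrightarrow> a \<noteq> b \<longrightarrow> (c a :: nat) \<noteq> c b) \<and> (\<forall>a\<in>S. c a < 3)" for v
  \<comment> \<open>In a scalene copy the two sides at \<open>v\<close> differ, so the squared
    distance from \<open>v\<close>, coded as 0, 1, 2, properly colours the link.\<close>
  proof (intro exI[of _ "\<lambda>i. if d v i = x then 0 else if d v i = y then 1 else 2"] conjI allI impI ballI)
    fix a b assume h: "{v, a, b} \<in> E" "a \<noteq> v" "b \<noteq> v" "a \<noteq> b"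
    then have "perm3 (d v a) (d a b) (d b v) x y z" by (intro edge_d) auto
    then show "(if d v a = x then 0 else if d v a = y then 1 else 2 :: nat) \<noteq> (if d v b = x then 0 else if d v b = y then 1 else 2)"
      using sc0 by (auto simp: perm3_def scalene_def d_sym)
  qed auto
  show ?thesis
  proof (rule codegree_two_bound)
    fix v assume "v \<in> S"
    show "\<exists>c. (\<forall>a b. {v, a, b} \<in> E \<longrightarrow> a \<noteq> v \<longrightarrow> b \<noteq> v \<longrightarrow> a \<noteq> b \<longrightarrow> (c a :: nat) \<noteq> c b) \<and> (\<forall>a\<in>S. c a < 3)"
      by (rule tri)
  next
    fix u v r s t
    assume S: "u \<in> S" "v \<in> S" "r \<in> S" "s \<in> S" "t \<in> S" and dst: "distinct [u, v, r, s, t]"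
      and e: "{u, v, r} \<in> E" "{u, v, s} \<in> E" "{u, v, t} \<in> E"
    define a b c where abc_defs: "a = d u r" "b = d v r" "c = d u v"
    have perm: "perm3 a b c x y z"
      using edge_d[OF e(1)] dst unfolding abc_defs by (auto simp: perm3_def d_sym)
    have sc: "scalene a b c" using scalene_perm[OF sc0 perm] .
    have right': "right_sides a b c" using right right_sides_perm[OF perm] by simp
    have type: "d u i = a \<and> d v i = b \<or> d u i = b \<and> d v i = a" if "{u, v, i} \<in> E" "i \<noteq> u" "i \<noteq> v" for i
    proof -
      have "perm3 (d u v) (d v i) (d i u) x y z" using that dst by (intro edge_d) auto
      then have "perm3 (d u v) (d v i) (d i u) a b c" using perm perm3_trans perm3_sym by blast
      then show ?thesis using rainbow_rest(3)[OF sc] abc_defs by (auto simp: d_sym)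
    qed
    have ab: "a \<noteq> b" using sc by (simp add: scalene_def)
    have perm': "perm3 b a c x y z" and sc': "scalene b a c" and right'': "right_sides b a c"
      using perm sc right' by (auto simp: perm3_def scalene_def right_sides_def)
    have ty: "d u s = a \<and> d v s = b \<or> d u s = b \<and> d v s = a" "d u t = a \<and> d v t = b \<or> d u t = b \<and> d v t = a"
      using type[of s] type[of t] e dst by auto
    \<comment> \<open>The third points are of two types and no three are alike, so exactly two
      agree; up to renaming this is the pattern of \<open>right_core\<close>.\<close>
    then consider "d u s = a" "d v s = b" "d u t = a" "d v t = b" | "d u s = a" "d v s = b" "d u t = b" "d v t = a"
      | "d u s = b" "d v s = a" "d u t = a" "d v t = b" | "d u s = b" "d v s = a" "d u t = b" "d v t = a" by blast
    then show "hsum E w \<le> 1 / 16"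
    proof cases
      case 1
      have False by (rule no_three_alike[OF S dst _ _ _ _ _ _ ab]) (use 1 abc_defs in simp_all)
      then show ?thesis ..
    next
      case 2
      then show ?thesis using abc_defs by (intro right_core[OF sc perm right' S dst]) auto
    next
      case 3
      have "distinct [u, v, r, t, s]" using dst by auto
      then show ?thesis using 3 abc_defs by (intro right_core[OF sc perm right' S(1,2,3,5,4)]) auto
    next
      case 4
      have "distinct [u, v, s, t, r]" using dst by auto
      then show ?thesis using 4 abc_defs by (intro right_core[OF sc' perm' right'' S(1,2,4,5,3)]) auto
    qed
  qed
qed

text \<open>Cancelling the sides \<open>pq\<close> and \<open>pr\<close> shared by two copies leaves
  two patterns. Either opposite distances agree and the flat tetrahedron is a rectangle, or
  \<open>p\<close> is the centre of the equilateral triangle \<open>qrs\<close>, with squared radius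
  \<open>l\<close> and squared side \<open>3 * l\<close>.\<close>

lemma apex_config:
  assumes S: "p \<in> S" "q \<in> S" "r \<in> S" "s \<in> S" and dst: "distinct [p, q, r, s]"
    and e: "{p, q, r} \<in> E" "{p, q, s} \<in> E" "{p, r, s} \<in> E"
  shows "right_sides x y z \<or> (\<exists>l. perm3 x y z (3 * l) l l \<and> {q, r, s} \<notin> E)"
proof -
  have t1: "perm3 (d p q) (d q r) (d r p) x y z" using e dst by (intro edge_d) auto
  have t2: "perm3 (d p q) (d q s) (d s p) x y z" using e dst by (intro edge_d) auto
  have t3: "perm3 (d p r) (d r s) (d s p) x y z" using e dst by (intro edge_d) auto
  have pos: "0 < d p q" "0 < d q r" using S dst by (auto intro: d_pos)
  have c1: "d q r = d q s \<and> d r p = d s p \<or> d q r = d s p \<and> d r p = d q s"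
    by (rule perm3_cancel[OF perm3_trans[OF t1 perm3_sym[OF t2]]])
  have "perm3 (d r p) (d p q) (d q r) x y z" "perm3 (d r p) (d r s) (d s p) x y z"
    using t1 t3 by (auto simp: perm3_def d_sym)
  then have c2: "d p q = d r s \<and> d q r = d s p \<or> d p q = d s p \<and> d q r = d r s"
    using perm3_cancel[OF perm3_trans[OF _ perm3_sym]] by blast
  have "d q r = d s p \<and> d r p = d q s \<and> d p q = d r s \<or> d q r = d q s \<and> d r p = d s p \<and> d p q = d s p \<and> d q r = d r s"
    using c1 c2 by auto
  then show ?thesis
  proof (elim disjE conjE)
    assume h: "d q r = d s p" "d r p = d q s" "d p q = d r s"
    have "cm6 (d p q) (d r p) (d q r) (d q r) (d r p) (d p q) = 0"
      using cm[of p q r s] h by (simp add: d_sym)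
    then have "(d p q + d q r - d r p) * (d p q + d r p - d q r) * (d q r + d r p - d p q) = 0"
      unfolding cm6_def by algebra
    then have "right_sides (d p q) (d q r) (d r p)" by (auto simp: right_sides_def)
    then show ?thesis using right_sides_perm[OF t1] by simp
  next
    assume h: "d q r = d q s" "d r p = d s p" "d p q = d s p" "d q r = d r s"
    define l f where lf: "l = d p q" "f = d q r"
    have hs: "d p q = l" "d p r = l" "d p s = l" "d q r = f" "d q s = f" "d r s = f"
      using h lf by (auto simp: d_sym)
    have "cm6 l l l f f f = 0" using cm[of p q r s] hs by simp
    moreover have "f \<noteq> 0" "l \<noteq> 0" using pos lf by auto
    ultimately have f: "f = 3 * l" unfolding cm6_def by algebra
    have "perm3 x y z (3 * l) l l" using t1 hs f by (auto simp: perm3_def d_sym)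
    moreover have "{q, r, s} \<notin> E"
    proof
      assume "{q, r, s} \<in> E"
      then have "perm3 (d q r) (d r s) (d s q) x y z" using dst by (intro edge_d) auto
      then show False using calculation hs f \<open>l \<noteq> 0\<close> by (auto simp: perm3_def d_sym)
    qed
    ultimately show ?thesis by blast
  qed
qed

lemma card_four_bound:
  assumes "card S = 4"
  shows "right_sides x y z \<and> hsum E w \<le> 1 / 16 \<or> (\<exists>l. perm3 x y z (3 * l) l l \<and> hsum E w \<le> 4 / 81)"
proof -
  obtain l where l: "S = set l" "distinct l" using finite_S finite_distinct_list by metis
  then have "length l = 4" using assms distinct_card by fastforce
  then obtain i j k m where "l = [i, j, k, m]" by (auto simp: length_Suc_conv numeral_eq_Suc)
  then have S0: "S = {i, j, k, m}" "distinct [i, j, k, m]" using l by auto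
  have mem: "e = {i, j, k} \<or> e = {i, j, m} \<or> e = {i, k, m} \<or> e = {j, k, m}" if e: "e \<in> E" for e
  proof -
    have "card (S - e) = 1"
      using card_Diff_subset[of e S] edge_sub[OF e] card_edge[OF e] assms finite_S finite_subset by fastforce
    then obtain n where n: "S - e = {n}" by (auto simp: card_1_singleton_iff)
    then have "e = S - {n}" "n \<in> S" using edge_sub[OF e] by auto
    then show ?thesis using S0 by auto
  qed
  \<comment> \<open>Two missing triples would share a pair that no edge covers, so at least three of
    the four triples are edges; \<open>p\<close> is the vertex common to three of them.\<close>
  obtain p q r s where S: "S = {p, q, r, s}" "distinct [p, q, r, s]" and e: "{p, q, r} \<in> E" "{p, q, s} \<in> E" "{p, r, s} \<in> E"
  proof -
    have cov: "{a, b, c} \<in> E \<or> {a, b, f} \<in> E" if "S = {a, b, c, f}" "distinct [a, b, c, f]" for a b c f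
      using third_point[of a b] that by (metis distinct_length_2_or_more insert_iff singletonD)
    have c: "{i, j, k} \<in> E \<or> {i, j, m} \<in> E" "{i, k, j} \<in> E \<or> {i, k, m} \<in> E" "{i, m, j} \<in> E \<or> {i, m, k} \<in> E"
      "{j, k, i} \<in> E \<or> {j, k, m} \<in> E" "{j, m, i} \<in> E \<or> {j, m, k} \<in> E" "{k, m, i} \<in> E \<or> {k, m, j} \<in> E"
      using S0 by (intro cov; auto)+
    have eqs: "{i, k, j} = {i, j, k}" "{i, m, j} = {i, j, m}" "{i, m, k} = {i, k, m}" "{j, k, i} = {i, j, k}" "{j, m, i} = {i, j, m}"
      "{j, m, k} = {j, k, m}" "{k, m, i} = {i, k, m}" "{k, m, j} = {j, k, m}" by auto
    consider "{i, j, k} \<in> E" "{i, j, m} \<in> E" "{i, k, m} \<in> E" | "{i, j, k} \<in> E" "{i, j, m} \<in> E" "{j, k, m} \<in> E"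
      | "{i, j, k} \<in> E" "{i, k, m} \<in> E" "{j, k, m} \<in> E" | "{i, j, m} \<in> E" "{i, k, m} \<in> E" "{j, k, m} \<in> E"
      using c unfolding eqs by blast
    then show thesis
    proof cases
      case 1
      then show ?thesis using S0 by (intro that[of i j k m]) auto
    next
      case 2
      then show ?thesis using S0 by (intro that[of j i k m]) (auto simp: insert_commute)
    next
      case 3
      then show ?thesis using S0 by (intro that[of k i j m]) (auto simp: insert_commute)
    next
      case 4
      then show ?thesis using S0 by (intro that[of m i j k]) (auto simp: insert_commute)
    qed
  qed
  have mem': "e = {p, q, r} \<or> e = {p, q, s} \<or> e = {p, r, s} \<or> e = {q, r, s}" if e: "e \<in> E" for e
  proof -
    have "card (S - e) = 1"
      using card_Diff_subset[of e S] edge_sub[OF e] card_edge[OF e] assms finite_S finite_subset by fastforce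
    then obtain n where n: "S - e = {n}" by (auto simp: card_1_singleton_iff)
    then have "e = S - {n}" "n \<in> S" using edge_sub[OF e] by auto
    then show ?thesis using S by auto
  qed
  have pos: "0 < w p" "0 < w q" "0 < w r" "0 < w s" using S by (auto intro: w_pos)
  have sum1: "w p + w q + w r + w s = 1" using w_sum S by (simp add: add.assoc)
  have nn: "0 \<le> prod w e" if "e \<in> set [{p, q, r}, {p, q, s}, {p, r, s}, {q, r, s}]" for e
    using that pos by (auto intro!: prod_nonneg)
  have ne: "p \<noteq> q" "p \<noteq> r" "p \<noteq> s" "q \<noteq> r" "q \<noteq> s" "r \<noteq> s" using S by auto
  have "right_sides x y z \<or> (\<exists>l. perm3 x y z (3 * l) l l \<and> {q, r, s} \<notin> E)"
    using apex_config[of p q r s] S e by auto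
  then show ?thesis
  proof (elim disjE exE conjE)
    assume right: "right_sides x y z"
    have "hsum E w \<le> sum_list (map (prod w) [{p, q, r}, {p, q, s}, {p, r, s}, {q, r, s}])"
      unfolding hsum_def using mem' nn by (intro sum_set_le_sum_list) auto
    then have "hsum E w \<le> w p * w q * (w r + w s) + w r * w s * (w p + w q)"
      using ne by (simp add: algebra_simps)
    also have "\<dots> \<le> ((w p + w q)\<^sup>2 / 4) * (w r + w s) + ((w r + w s)\<^sup>2 / 4) * (w p + w q)"
      using zero_le_power2[of "w p - w q"] zero_le_power2[of "w r - w s"] pos
      by (intro add_mono mult_right_mono) (auto simp: power2_eq_square algebra_simps)
    also have "\<dots> = (w p + w q) * (w r + w s) * (w p + w q + w r + w s) / 4"
      by (simp add: power2_eq_square field_simps)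
    also have "\<dots> = (w p + w q) * (1 - (w p + w q)) / 4"
    proof -
      have "w r + w s = 1 - (w p + w q)" using sum1 by simp
      then show ?thesis using sum1 by simp
    qed
    also have "\<dots> \<le> 1 / 16"
      using zero_le_power2[of "w p + w q - 1 / 2"] by (simp add: power2_eq_square algebra_simps)
    finally show ?thesis using right by blast
  next
    fix l assume l: "perm3 x y z (3 * l) l l" and no: "{q, r, s} \<notin> E"
    have "hsum E w \<le> sum_list (map (prod w) [{p, q, r}, {p, q, s}, {p, r, s}])"
      unfolding hsum_def using mem' nn no by (intro sum_set_le_sum_list) auto
    then have "hsum E w \<le> w p * (w q * w r + w q * w s + w r * w s)"
      using ne by (simp add: algebra_simps)
    also have "\<dots> \<le> w p * ((w q + w r + w s)\<^sup>2 / 3)"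
      using zero_le_power2[of "w q - w r"] zero_le_power2[of "w r - w s"] zero_le_power2[of "w q - w s"] pos
      by (intro mult_left_mono) (auto simp: power2_eq_square algebra_simps)
    also have "w q + w r + w s = 1 - w p" using sum1 by simp
    also have "w p * ((1 - w p)\<^sup>2 / 3) \<le> 4 / 81"
    proof -
      \<comment> \<open>Splitting \<open>1 - w p\<close> into equal halves makes the inequality of
        arithmetic and geometric means sharp at \<open>w p = 1 / 3\<close>, whence
        \<open>4 / 81\<close>.\<close>
      have "w p * ((1 - w p) / 2) * ((1 - w p) / 2) \<le> 1 / 27"
        using pos sum1 by (intro prod3_le) auto
      then show ?thesis by (simp add: power2_eq_square)
    qed
    finally show ?thesis using l by blast
  qed
qed

end

section \<open>Isosceles triangles\<close>

text \<open>Fourth points over an equilateral triangle of squared side \<open>s\<close>: for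
  \<open>t = 3 * s\<close> the reflection of a vertex in the opposite side, for
  \<open>s = 3 * t\<close> the centre, otherwise a point on a symmetry axis at squared distance
  \<open>s\<close> from one vertex and \<open>t\<close> from the other two. Three distances equal to
  \<open>s\<close> would give a regular tetrahedron.\<close>

lemma two_distance_point:
  assumes ne: "s \<noteq> 0" "t \<noteq> 0" "s \<noteq> t" and "p \<in> {s, t}" "q \<in> {s, t}" "r \<in> {s, t}" and K: "cm6 s s p s q r = 0"
  obtains "p = t" "q = s" "r = s" "t = 3 * s"
  | "p = s" "q = t" "r = s" "t = 3 * s"
  | "p = s" "q = s" "r = t" "t = 3 * s"
  | "p = t" "q = t" "r = s" "s\<^sup>2 + t\<^sup>2 = 4 * s * t"
  | "p = t" "q = s" "r = t" "s\<^sup>2 + t\<^sup>2 = 4 * s * t"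
  | "p = s" "q = t" "r = t" "s\<^sup>2 + t\<^sup>2 = 4 * s * t"
  | "p = t" "q = t" "r = t" "s = 3 * t"
proof -
  have n0: False if h: "p = s" "q = s" "r = s"
    using K[unfolded cm6_def h] ne by algebra
  have n1: "t = 3 * s" if h: "p = t" "q = s" "r = s"
    using K[unfolded cm6_def h] ne by algebra
  have n2: "t = 3 * s" if h: "p = s" "q = t" "r = s"
    using K[unfolded cm6_def h] ne by algebra
  have n3: "t = 3 * s" if h: "p = s" "q = s" "r = t"
    using K[unfolded cm6_def h] ne by algebra
  have n4: "s\<^sup>2 + t\<^sup>2 = 4 * s * t" if h: "p = t" "q = t" "r = s"
    using K[unfolded cm6_def h] ne by algebra
  have n5: "s\<^sup>2 + t\<^sup>2 = 4 * s * t" if h: "p = t" "q = s" "r = t"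
    using K[unfolded cm6_def h] ne by algebra
  have n6: "s\<^sup>2 + t\<^sup>2 = 4 * s * t" if h: "p = s" "q = t" "r = t"
    using K[unfolded cm6_def h] ne by algebra
  have n7: "s = 3 * t" if h: "p = t" "q = t" "r = t"
    using K[unfolded cm6_def h] ne by algebra
  have "p = s \<or> p = t" "q = s \<or> q = t" "r = s \<or> r = t" using assms(4-6) by auto
  then have "p = t \<and> q = s \<and> r = s \<and> t = 3 * s \<or>
    p = s \<and> q = t \<and> r = s \<and> t = 3 * s \<or>
    p = s \<and> q = s \<and> r = t \<and> t = 3 * s \<or>
    p = t \<and> q = t \<and> r = s \<and> s\<^sup>2 + t\<^sup>2 = 4 * s * t \<or>
    p = t \<and> q = s \<and> r = t \<and> s\<^sup>2 + t\<^sup>2 = 4 * s * t \<or>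
    p = s \<and> q = t \<and> r = t \<and> s\<^sup>2 + t\<^sup>2 = 4 * s * t \<or>
    p = t \<and> q = t \<and> r = t \<and> s = 3 * t"
    using n0 n1 n2 n3 n4 n5 n6 n7 by sat
  then show thesis by (elim disjE conjE) (rule that; assumption)+
qed

text \<open>The three relations between \<open>s\<close> and \<open>t\<close> exclude each other, so
  both further points are of one kind; two different points of one kind would have a mutual distance
  other than \<open>s\<close> and \<open>t\<close>.\<close>

lemma two_distance_equilateral:
  assumes ne: "s \<noteq> 0" "t \<noteq> 0" "s \<noteq> t" "s + t \<noteq> 0" and "p \<in> {s, t}" "q \<in> {s, t}" "r \<in> {s, t}"
    and "p' \<in> {s, t}" "q' \<in> {s, t}" "r' \<in> {s, t}" "e \<in> {s, t}"
    and diff: "\<not> (p = p' \<and> q = q' \<and> r = r')"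
    and K0: "cm6 s s p s q r = 0" "cm6 s s p' s q' r' = 0"
    and K: "cm6 s p p' q q' e = 0" "cm6 s p p' r r' e = 0" "cm6 s q q' r r' e = 0"
  shows False
proof -
  have rel: "t = 3 * s \<Longrightarrow> s\<^sup>2 + t\<^sup>2 = 4 * s * t \<Longrightarrow> False" "t = 3 * s \<Longrightarrow> s = 3 * t \<Longrightarrow> False" "s = 3 * t \<Longrightarrow> s\<^sup>2 + t\<^sup>2 = 4 * s * t \<Longrightarrow> False"
    using ne by algebra+
  have cs: False if "e = s \<Longrightarrow> False" "e = t \<Longrightarrow> False" using that assms(11) by blast
  have n1: False if h: "p = t" "q = s" "r = s" "p' = s" "q' = t" "r' = s" and rel: "t = 3 * s"
    by (rule cs) (use K[unfolded cm6_def h rel] ne(1) rel in \<open>simp_all add: power2_eq_square algebra_simps\<close>)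
  have n2: False if h: "p = t" "q = s" "r = s" "p' = s" "q' = s" "r' = t" and rel: "t = 3 * s"
    by (rule cs) (use K[unfolded cm6_def h rel] ne(1) rel in \<open>simp_all add: power2_eq_square algebra_simps\<close>)
  have n3: False if h: "p = s" "q = t" "r = s" "p' = t" "q' = s" "r' = s" and rel: "t = 3 * s"
    by (rule cs) (use K[unfolded cm6_def h rel] ne(1) rel in \<open>simp_all add: power2_eq_square algebra_simps\<close>)
  have n4: False if h: "p = s" "q = t" "r = s" "p' = s" "q' = s" "r' = t" and rel: "t = 3 * s"
    by (rule cs) (use K[unfolded cm6_def h rel] ne(1) rel in \<open>simp_all add: power2_eq_square algebra_simps\<close>)
  have n5: False if h: "p = s" "q = s" "r = t" "p' = t" "q' = s" "r' = s" and rel: "t = 3 * s"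
    by (rule cs) (use K[unfolded cm6_def h rel] ne(1) rel in \<open>simp_all add: power2_eq_square algebra_simps\<close>)
  have n6: False if h: "p = s" "q = s" "r = t" "p' = s" "q' = t" "r' = s" and rel: "t = 3 * s"
    by (rule cs) (use K[unfolded cm6_def h rel] ne(1) rel in \<open>simp_all add: power2_eq_square algebra_simps\<close>)
  have n7: False if h: "p = t" "q = t" "r = s" "p' = t" "q' = s" "r' = t" and rel: "s\<^sup>2 + t\<^sup>2 = 4 * s * t"
  proof (rule cs)
    show False if e: "e = s" using K[unfolded cm6_def h e] ne rel by algebra
    show False if e: "e = t" using K[unfolded cm6_def h e] ne rel by algebra
  qed
  have n8: False if h: "p = t" "q = t" "r = s" "p' = s" "q' = t" "r' = t" and rel: "s\<^sup>2 + t\<^sup>2 = 4 * s * t"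
  proof (rule cs)
    show False if e: "e = s" using K[unfolded cm6_def h e] ne rel by algebra
    show False if e: "e = t" using K[unfolded cm6_def h e] ne rel by algebra
  qed
  have n9: False if h: "p = t" "q = s" "r = t" "p' = t" "q' = t" "r' = s" and rel: "s\<^sup>2 + t\<^sup>2 = 4 * s * t"
  proof (rule cs)
    show False if e: "e = s" using K[unfolded cm6_def h e] ne rel by algebra
    show False if e: "e = t" using K[unfolded cm6_def h e] ne rel by algebra
  qed
  have n10: False if h: "p = t" "q = s" "r = t" "p' = s" "q' = t" "r' = t" and rel: "s\<^sup>2 + t\<^sup>2 = 4 * s * t"
  proof (rule cs)
    show False if e: "e = s" using K[unfolded cm6_def h e] ne rel by algebra
    show False if e: "e = t" using K[unfolded cm6_def h e] ne rel by algebra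
  qed
  have n11: False if h: "p = s" "q = t" "r = t" "p' = t" "q' = t" "r' = s" and rel: "s\<^sup>2 + t\<^sup>2 = 4 * s * t"
  proof (rule cs)
    show False if e: "e = s" using K[unfolded cm6_def h e] ne rel by algebra
    show False if e: "e = t" using K[unfolded cm6_def h e] ne rel by algebra
  qed
  have n12: False if h: "p = s" "q = t" "r = t" "p' = t" "q' = s" "r' = t" and rel: "s\<^sup>2 + t\<^sup>2 = 4 * s * t"
  proof (rule cs)
    show False if e: "e = s" using K[unfolded cm6_def h e] ne rel by algebra
    show False if e: "e = t" using K[unfolded cm6_def h e] ne rel by algebra
  qed
  show False
    by (rule two_distance_point[OF ne(1-3) assms(5-7) K0(1)]; rule two_distance_point[OF ne(1-3) assms(8-10) K0(2)];
        (erule (1) rel | (rule n1 n2 n3 n4 n5 n6 n7 n8 n9 n10 n11 n12; assumption) | use diff in simp))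
qed

text \<open>Subtracting the equations for \<open>P\<close> from those for \<open>Q\<close> and
  \<open>R\<close> gives a linear system in \<open>D - D'\<close> whose determinant \<open>k\<close>
  is twice the oriented area of \<open>PQR\<close>, and \<open>4 * k^2 = 3 * s^2\<close>.\<close>

lemma equidistant_unique:
  assumes "sqd P Q = s" "sqd P R = s" "sqd Q R = s" "s \<noteq> 0"
    and "sqd P D = sqd P D'" "sqd Q D = sqd Q D'" "sqd R D = sqd R D'"
  shows "D = D'"
proof -
  define k where "k = (Q $ 1 - P $ 1) * (R $ 2 - P $ 2) - (Q $ 2 - P $ 2) * (R $ 1 - P $ 1)"
  define c where "c = (Q $ 1 - P $ 1) * (R $ 1 - P $ 1) + (Q $ 2 - P $ 2) * (R $ 2 - P $ 2)"
  have "k\<^sup>2 + c\<^sup>2 = sqd P Q * sqd P R" unfolding sqd_coords k_def c_def by algebra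
  moreover have "2 * c = sqd P Q + sqd P R - sqd Q R" unfolding sqd_coords c_def by algebra
  ultimately have "4 * k\<^sup>2 = 3 * s\<^sup>2" using assms(1-3) by algebra
  then have "k \<noteq> 0" using assms(4) by auto
  moreover have "k * (D $ 1 - D' $ 1) = 0" "k * (D $ 2 - D' $ 2) = 0"
    using assms(5-7) unfolding sqd_coords k_def by algebra+
  ultimately have "D $ 1 = D' $ 1" "D $ 2 = D' $ 2" by simp_all
  then show ?thesis by (simp add: vec_eq_iff forall_2)
qed

context triangle_copies
begin

lemma no_equilateral:
  assumes bl: "perm3 x y z b l l" "b \<noteq> l" and st: "s = b \<and> t = l \<or> s = l \<and> t = b"
    and S: "P \<in> S" "Q \<in> S" "R \<in> S" "D1 \<in> S" "D2 \<in> S" and dst: "distinct [P, Q, R, D1, D2]"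
    and eq: "d P Q = s" "d P R = s" "d Q R = s"
  shows False
proof -
  have pos: "0 < s" "0 < t" "s \<noteq> t" using bl st sides_pos by (auto simp: perm3_def)
  have col: "d i j \<in> {s, t}" if "i \<in> S" "j \<in> S" "i \<noteq> j" for i j
    using colour[OF that] bl st by (auto simp: perm3_def)
  show False
  proof (rule two_distance_equilateral)
    show "s \<noteq> 0" "t \<noteq> 0" "s \<noteq> t" "s + t \<noteq> 0" using pos by auto
    show "d P D1 \<in> {s, t}" "d Q D1 \<in> {s, t}" "d R D1 \<in> {s, t}" "d P D2 \<in> {s, t}" "d Q D2 \<in> {s, t}" "d R D2 \<in> {s, t}" "d D1 D2 \<in> {s, t}"
      by (rule col; use S dst in simp)+
    show "\<not> (d P D1 = d P D2 \<and> d Q D1 = d Q D2 \<and> d R D1 = d R D2)"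
    proof
      assume h: "d P D1 = d P D2 \<and> d Q D1 = d Q D2 \<and> d R D1 = d R D2"
      have "\<phi> D1 = \<phi> D2"
        using equidistant_unique[of "\<phi> P" "\<phi> Q" s "\<phi> R"] eq pos h unfolding d_def by auto
      then show False using inj S dst by (auto simp: inj_on_eq_iff)
    qed
    show "cm6 s s (d P D1) s (d Q D1) (d R D1) = 0" using cm[of P Q R D1] eq by simp
    show "cm6 s s (d P D2) s (d Q D2) (d R D2) = 0" using cm[of P Q R D2] eq by simp
    show "cm6 s (d P D1) (d P D2) (d Q D1) (d Q D2) (d D1 D2) = 0" using cm[of P Q D1 D2] eq by simp
    show "cm6 s (d P D1) (d P D2) (d R D1) (d R D2) (d D1 D2) = 0" using cm[of P R D1 D2] eq by simp
    show "cm6 s (d Q D1) (d Q D2) (d R D1) (d R D2) (d D1 D2) = 0" using cm[of Q R D1 D2] eq by simp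
  qed
qed

text \<open>Colouring pairs by the two distances leaves no monochromatic triangle, so every point
  has at most two neighbours in each colour. Hence there are exactly five points and both colours
  form 5-cycles, the colouring that shows the Ramsey number of two triangles to exceed 5.\<close>

lemma isosceles_pentagon:
  assumes bl: "perm3 x y z b l l" "b \<noteq> l" and card5: "5 \<le> card S"
  obtains p0 p1 p2 p3 p4 where "S = {p0, p1, p2, p3, p4}" "distinct [p0, p1, p2, p3, p4]"
    "d p0 p1 = l" "d p1 p2 = l" "d p2 p3 = l" "d p3 p4 = l" "d p4 p0 = l"
    "d p0 p2 = b" "d p1 p3 = b" "d p2 p4 = b" "d p3 p0 = b" "d p4 p1 = b"
proof -
  have col: "d i j = b \<or> d i j = l" if "i \<in> S" "j \<in> S" "i \<noteq> j" for i j
    using colour[OF that] bl by (auto simp: perm3_def)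
  have mono: False if "P \<in> S" "Q \<in> S" "R \<in> S" "P \<noteq> Q" "Q \<noteq> R" "P \<noteq> R" "d P Q = s" "d P R = s" "d Q R = s" and s: "s = b \<or> s = l" for P Q R s
  proof -
    have "2 \<le> card (S - {P, Q, R})"
      using card5 that finite_S by (simp add: card_Diff_subset)
    then obtain F where F: "F \<subseteq> S - {P, Q, R}" "card F = 2" by (rule obtain_subset_with_card_n)
    then obtain D1 D2 where "F = {D1, D2}" "D1 \<noteq> D2" by (auto simp: card_2_iff)
    then show False
      using no_equilateral[OF bl, of s "if s = b then l else b" P Q R D1 D2] that F(1) bl(2) by auto
  qed
  have nbrs: "card {i\<in>S - {p}. d p i = s} \<le> 2" if p: "p \<in> S" and st: "s = b \<and> t = l \<or> s = l \<and> t = b" for p s t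
  proof (rule ccontr)
    assume "\<not> ?thesis"
    then have "3 \<le> card {i\<in>S - {p}. d p i = s}" by simp
    then obtain F where F: "F \<subseteq> {i\<in>S - {p}. d p i = s}" "card F = 3" by (rule obtain_subset_with_card_n)
    then obtain i j k where ijk: "F = {i, j, k}" "i \<noteq> j" "j \<noteq> k" "i \<noteq> k" by (auto simp: card_3_iff)
    then have h: "i \<in> S" "j \<in> S" "k \<in> S" "i \<noteq> p" "j \<noteq> p" "k \<noteq> p" "d p i = s" "d p j = s" "d p k = s" using F(1) by auto
    have "d m n = t" if "m \<in> {i, j, k}" "n \<in> {i, j, k}" "m \<noteq> n" for m n
    proof -
      have "m \<in> S" "n \<in> S" "m \<noteq> p" "n \<noteq> p" "d p m = s" "d p n = s" using that h by auto
      then show ?thesis using mono[of p m n s] col[of m n] that p st by auto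
    qed
    then show False using mono[of i j k t] h ijk st by auto
  qed
  obtain p0 where p0: "p0 \<in> S" using S_ne by auto
  let ?L = "{i\<in>S - {p0}. d p0 i = l}" and ?B = "{i\<in>S - {p0}. d p0 i = b}"
  have un: "S = insert p0 (?L \<union> ?B)" using col p0 by auto
  have cL: "card ?L \<le> 2" "card ?B \<le> 2" using nbrs[OF p0, of l b] nbrs[OF p0, of b l] by auto
  have "card S = card (insert p0 (?L \<union> ?B))" using un by (rule arg_cong)
  also have "\<dots> \<le> Suc (card (?L \<union> ?B))" using finite_S by (simp add: card_insert_if)
  also have "\<dots> \<le> Suc (card ?L + card ?B)" using card_Un_le by simp
  finally have "card S \<le> Suc (card ?L + card ?B)" .
  then have "card ?L = 2" "card ?B = 2" using cL card5 by linarith+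
  then obtain A B C D where L: "?L = {A, B}" "A \<noteq> B" and Bs: "?B = {C, D}" "C \<noteq> D"
    by (auto simp: card_2_iff)
  have "A \<in> ?L" "B \<in> ?L" "C \<in> ?B" "D \<in> ?B" using L Bs by auto
  then have in_S: "A \<in> S" "B \<in> S" "C \<in> S" "D \<in> S" and ne0: "p0 \<noteq> A" "p0 \<noteq> B" "p0 \<noteq> C" "p0 \<noteq> D"
    and d0: "d p0 A = l" "d p0 B = l" "d p0 C = b" "d p0 D = b" by auto
  have ne: "A \<noteq> C" "A \<noteq> D" "B \<noteq> C" "B \<noteq> D" using d0 bl(2) by auto
  have S5: "S = {p0, A, B, C, D}" using un L Bs by auto
  have AB: "d A B = b" using col[of A B] mono[of p0 A B l] in_S p0 ne0 L(2) d0 by auto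
  have CD: "d C D = l" using col[of C D] mono[of p0 C D b] in_S p0 ne0 Bs(2) d0 by auto
  note pentagon = that
  have main: thesis if C: "C \<in> S" "D \<in> S" "C \<noteq> D" "p0 \<noteq> C" "p0 \<noteq> D" "A \<noteq> C" "A \<noteq> D" "B \<noteq> C" "B \<noteq> D" "d p0 C = b" "d p0 D = b"
    "d C D = l" "S = {p0, A, B, C, D}" and AC: "d A C = l" for C D
  proof -
    have AD: "d A D = b" using col[of A D] mono[of A C D l] C in_S AC by auto
    have BD: "d B D = l" using col[of B D] mono[of A B D b] C in_S AB AD L(2) by auto
    have BC: "d B C = b" using col[of B C] mono[of B C D l] C in_S BD by auto
    show thesis
      by (rule pentagon[of p0 A C D B]) (use C ne0 L(2) d0 AB AC AD BD BC in \<open>auto simp: d_sym\<close>)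
  qed
  show thesis
  proof (cases "d A C = l")
    case True
    then show thesis using main[of C D] in_S Bs(2) ne0 ne d0 CD S5 by auto
  next
    case False
    then have AC: "d A C = b" using col[of A C] in_S ne by auto
    have "d A D = l"
    proof (rule ccontr)
      assume "d A D \<noteq> l"
      then have AD: "d A D = b" using col[of A D] in_S ne by auto
      have "d B C = l" using col[of B C] mono[of A B C b] in_S AB AC L(2) ne by auto
      moreover have "d B D = l" using col[of B D] mono[of A B D b] in_S AB AD L(2) ne by auto
      ultimately show False using mono[of B C D l] CD in_S ne Bs(2) by auto
    qed
    moreover have "S = {p0, A, B, D, C}" using S5 by auto
    ultimately show thesis using main[of D C] in_S Bs(2) ne0 ne d0 CD by (auto simp: d_sym)
  qed
qed

text \<open>The length belonging to \<open>l\<close> may be the side or the diagonal of the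
  pentagon; the relation is symmetric and says that the two lengths are in the golden ratio. A copy
  has two sides of squared length \<open>l\<close>, so the edges are among the five triples
  consecutive along the \<open>l\<close>-cycle.\<close>

lemma isosceles_large_bound:
  assumes bl: "perm3 x y z b l l" "b \<noteq> l" and card5: "5 \<le> card S"
  shows "b\<^sup>2 + l\<^sup>2 = 3 * b * l \<and> hsum E w \<le> 1 / 25"
proof -
  obtain p0 p1 p2 p3 p4 where S: "S = {p0, p1, p2, p3, p4}" and dst: "distinct [p0, p1, p2, p3, p4]"
    and dl: "d p0 p1 = l" "d p1 p2 = l" "d p2 p3 = l" "d p3 p4 = l" "d p4 p0 = l"
    and db: "d p0 p2 = b" "d p1 p3 = b" "d p2 p4 = b" "d p3 p0 = b" "d p4 p1 = b"
    using isosceles_pentagon[OF assms] .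
  have pos: "0 < b" "0 < l" using bl sides_pos by (auto simp: perm3_def)
  have "cm6 l b b l b l = 0" using cm[of p0 p1 p2 p3] dl db by (simp add: d_sym)
  then have "(b + l) * (b\<^sup>2 + l\<^sup>2 - 3 * b * l) = 0" unfolding cm6_def by algebra
  then have rel: "b\<^sup>2 + l\<^sup>2 = 3 * b * l" using pos by auto
  let ?T = "[{p0, p1, p2}, {p1, p2, p3}, {p2, p3, p4}, {p3, p4, p0}, {p4, p0, p1}]"
  have bad: "{i, j, k} \<notin> E" if "d i j = b" "d j k = b" "i \<noteq> j" "j \<noteq> k" "i \<noteq> k" for i j k
  proof
    assume "{i, j, k} \<in> E"
    then have "perm3 (d i j) (d j k) (d k i) x y z" using that by (intro edge_d)
    then show False using that bl by (auto simp: perm3_def)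
  qed
  have no: "{p0, p2, p4} \<notin> E" "{p1, p3, p0} \<notin> E" "{p2, p4, p1} \<notin> E" "{p3, p0, p2} \<notin> E" "{p4, p1, p3} \<notin> E"
    using db dst by (intro bad; auto)+
  have mem: "e \<in> set ?T" if e: "e \<in> E" for e
  proof -
    have "card (S - e) = 2"
    proof -
      have "finite e" "card e = 3" "e \<subseteq> S"
        using finite_subset[OF edge_sub[OF e] finite_S] card_edge[OF e] edge_sub[OF e] by auto
      moreover have "card S = 5" using S dst by simp
      ultimately show ?thesis by (simp add: card_Diff_subset)
    qed
    then obtain m n where mn: "S - e = {m, n}" "m \<noteq> n" by (auto simp: card_2_iff)
    then have eq: "e = S - {m, n}" and "m \<in> S" "n \<in> S" using edge_sub[OF e] by auto
    then have "m = p0 \<or> m = p1 \<or> m = p2 \<or> m = p3 \<or> m = p4" "n = p0 \<or> n = p1 \<or> n = p2 \<or> n = p3 \<or> n = p4"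
      using S by auto
    then have "{m, n} \<in> {{p0, p1}, {p0, p2}, {p0, p3}, {p0, p4}, {p1, p2}, {p1, p3}, {p1, p4}, {p2, p3}, {p2, p4}, {p3, p4}}"
      using mn(2) by (elim disjE) (simp_all add: insert_commute)
    moreover have D: "S - {p0, p1} = {p2, p3, p4}" "S - {p0, p2} = {p4, p1, p3}" "S - {p0, p3} = {p2, p4, p1}" "S - {p0, p4} = {p1, p2, p3}"
      "S - {p1, p2} = {p3, p4, p0}" "S - {p1, p3} = {p0, p2, p4}" "S - {p1, p4} = {p3, p0, p2}" "S - {p2, p3} = {p4, p0, p1}"
      "S - {p2, p4} = {p1, p3, p0}" "S - {p3, p4} = {p0, p1, p2}"
      using S dst by auto
    ultimately show ?thesis using e no unfolding eq
      by (elim insertE emptyE) (simp_all add: D)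
  qed
  have ws: "0 < w p0" "0 < w p1" "0 < w p2" "0 < w p3" "0 < w p4" using S by (auto intro: w_pos)
  have "hsum E w \<le> sum_list (map (prod w) ?T)"
    unfolding hsum_def
  proof (rule sum_set_le_sum_list)
    show "E \<subseteq> set ?T" using mem by blast
    show "0 \<le> prod w e" if "e \<in> set ?T" for e using that ws by (auto intro!: prod_nonneg)
  qed
  also have "\<dots> = w p0 * w p1 * w p2 + w p1 * w p2 * w p3 + w p2 * w p3 * w p4 + w p3 * w p4 * w p0 + w p4 * w p0 * w p1"
    using dst by (auto simp: mult.assoc)
  also have "25 * \<dots> \<le> (w p0 + w p1 + w p2 + w p3 + w p4) ^ 3"
    using ws by (intro pentagon_inequality) auto
  also have "w p0 + w p1 + w p2 + w p3 + w p4 = 1" using w_sum S dst by (simp add: add.assoc)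
  finally show ?thesis using rel by simp
qed

lemma equilateral_card:
  assumes "x = y" "y = z"
  shows "card S \<le> 3"
proof (rule ccontr)
  assume "\<not> ?thesis"
  then have "4 \<le> card S" by simp
  then obtain F where F: "F \<subseteq> S" "card F = 4" by (rule obtain_subset_with_card_n)
  obtain l where l: "F = set l" "distinct l" using F finite_S finite_distinct_list finite_subset by metis
  then have "length l = 4" using F distinct_card by fastforce
  then obtain i j k m where "l = [i, j, k, m]" by (auto simp: length_Suc_conv numeral_eq_Suc)
  then have h: "{i, j, k, m} \<subseteq> S" "distinct [i, j, k, m]" using l F by auto
  have "d p q = x" if "p \<in> {i, j, k, m}" "q \<in> {i, j, k, m}" "p \<noteq> q" for p q
    using colour[of p q] that h assms by auto
  then have "cm6 x x x x x x = 0" using cm[of i j k m] h by simp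
  then show False using sides_pos by (simp add: cm6_def power2_eq_square)
qed

theorem hsum_bound:
  "hsum E w \<le> 1 / 27 \<or> right_sides x y z \<and> hsum E w \<le> 1 / 16 \<or>
   (\<exists>l. perm3 x y z (3 * l) l l) \<and> hsum E w \<le> 4 / 81 \<or>
   (\<exists>a b c. perm3 a b c x y z \<and> heptagonal a b c) \<and> scalene x y z \<and> hsum E w \<le> 2 / 49 \<or>
   (\<exists>b l. perm3 x y z b l l \<and> b\<^sup>2 + l\<^sup>2 = 3 * b * l) \<and> hsum E w \<le> 1 / 25"
proof (cases "scalene x y z")
  case sc: True
  show ?thesis
  proof (cases "right_sides x y z")
    case True
    then show ?thesis using right_scalene_bound sc by blast
  next
    case False
    then have obl: "oblique x y z" using sc by (auto simp: oblique_def right_sides_def)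
    show ?thesis
    proof (rule codegree_one_bound)
      fix u v r s
      assume "u \<in> S" "v \<in> S" "r \<in> S" "s \<in> S" "distinct [u, v, r, s]" "{u, v, r} \<in> E" "{u, v, s} \<in> E"
      then obtain a b c where "perm3 a b c x y z" "heptagonal a b c"
        using oblique_codegree_two_heptagonal[OF obl] by blast
      then show ?thesis using heptagonal_bound[OF sc] sc by blast
    qed auto
  qed
next
  case False
  then obtain b l where bl: "perm3 x y z b l l"
    using sides_pos by (auto simp: scalene_def perm3_def)
  have small: ?thesis if "card S \<le> 3" using hsum_small[OF that] by blast
  show ?thesis
  proof (cases "b = l")
    case True
    then show ?thesis using bl by (intro small equilateral_card) (auto simp: perm3_def)
  next
    case False
    consider "card S \<le> 3" | "card S = 4" | "5 \<le> card S" by linarith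
    then show ?thesis
    proof cases
      case 1
      then show ?thesis by (rule small)
    next
      case 2
      then show ?thesis using card_four_bound by blast
    next
      case 3
      then show ?thesis using isosceles_large_bound[OF bl False] bl by blast
    qed
  qed
qed

end

section \<open>From point sets to the Lagrange polynomial\<close>

lemma count_eps_le: "finite P \<Longrightarrow> count_eps P T \<epsilon> \<le> 2 ^ card P"
  unfolding count_eps_def
  by (metis (no_types, lifting) card_Pow card_mono finite_Pow_iff Collect_subset PowI mem_Collect_eq subsetI)

text \<open>Finiteness makes the \<open>Max\<close> in \<open>h_eps\<close> a genuine
  maximum.\<close>

lemma finite_count_values: "finite {count_eps P T \<epsilon> | P. finite P \<and> card P = n}"
  by (rule finite_subset[of _ "{..2 ^ n}"]) (auto simp: count_eps_le)

lemma exists_point_set: "\<exists>P :: point set. finite P \<and> card P = n"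
proof -
  have "infinite (UNIV :: point set)" by (simp add: infinite_UNIV_char_0)
  then show ?thesis using infinite_arbitrarily_large by blast
qed

lemma count_eps_le_h_eps:
  assumes "finite P" "card P = n"
  shows "count_eps P T \<epsilon> \<le> h_eps n T \<epsilon>"
  unfolding h_eps_def using assms finite_count_values by (intro Max_ge) auto

lemma h_attained:
  assumes "0 < \<epsilon>"
  obtains P where "finite P" "card P = n" "h n T \<le> count_eps P T \<epsilon>"
proof -
  have "h n T \<le> h_eps n T \<epsilon>" unfolding h_def using assms by (intro cInf_lower) auto
  moreover have "h_eps n T \<epsilon> \<in> {count_eps P T \<epsilon> | P. finite P \<and> card P = n}"
    unfolding h_eps_def using exists_point_set[of n] finite_count_values by (intro Max_in) auto
  ultimately show thesis using that by auto
qed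

lemma h_greatest:
  assumes "\<And>\<epsilon>. 0 < \<epsilon> \<Longrightarrow> \<exists>P. finite P \<and> card P = n \<and> m \<le> count_eps P T \<epsilon>"
  shows "m \<le> h n T"
  unfolding h_def
proof (rule cInf_greatest)
  show "(\<lambda>\<epsilon>. h_eps n T \<epsilon>) ` {0<..} \<noteq> {}" using zero_less_one by blast
  fix v assume "v \<in> (\<lambda>\<epsilon>. h_eps n T \<epsilon>) ` {0<..}"
  then obtain \<epsilon> :: real where "0 < \<epsilon>" "v = h_eps n T \<epsilon>" by auto
  then show "m \<le> v" using assms count_eps_le_h_eps order_trans by metis
qed

text \<open>Strict Cauchy-Schwarz for the two side vectors at \<open>A\<close>, rewritten by the law
  of cosines.\<close>

lemma triangle_area:
  assumes "is_triangle (A, B, C)"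
  shows "0 < 2 * sqd B C * sqd C A + 2 * sqd C A * sqd A B + 2 * sqd B C * sqd A B - (sqd B C)\<^sup>2 - (sqd C A)\<^sup>2 - (sqd A B)\<^sup>2"
proof -
  have "\<not> collinear {A, B, C}" using assms by (simp add: is_triangle_def)
  moreover have "collinear {A, B, C} \<longleftrightarrow> collinear {0, B - A, C - A}"
    using collinear_3[of B A C] by (simp add: insert_commute)
  ultimately have ne: "\<bar>(B - A) \<bullet> (C - A)\<bar> \<noteq> norm (B - A) * norm (C - A)"
    using norm_cauchy_schwarz_equal by metis
  then have "\<bar>(B - A) \<bullet> (C - A)\<bar> < norm (B - A) * norm (C - A)"
    using Cauchy_Schwarz_ineq2[of "B - A" "C - A"] by linarith
  then have "((B - A) \<bullet> (C - A))\<^sup>2 < (norm (B - A) * norm (C - A))\<^sup>2"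
    by (metis abs_ge_zero abs_le_square_iff abs_mult abs_norm_cancel linorder_not_less)
  then have "((B - A) \<bullet> (C - A))\<^sup>2 < sqd A B * sqd C A"
    by (simp add: sqd_def dist_norm norm_minus_commute power_mult_distrib)
  moreover have "2 * ((B - A) \<bullet> (C - A)) = sqd A B + sqd C A - sqd B C"
    by (simp add: sqd_coords inner_vec_def sum_2 power2_eq_square algebra_simps)
  then have "4 * ((B - A) \<bullet> (C - A))\<^sup>2 = (sqd A B + sqd C A - sqd B C)\<^sup>2"
    by (metis power_mult_distrib mult_2 numeral_Bit0 power2_eq_square numeral_times_numeral semiring_norm(12) semiring_norm(13))
  ultimately have "(sqd A B + sqd C A - sqd B C)\<^sup>2 < 4 * (sqd A B * sqd C A)" by linarith
  then show ?thesis by (simp add: power2_eq_square algebra_simps)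
qed

lemma triangle_distinct:
  assumes "is_triangle (A, B, C)"
  shows "A \<noteq> B" "B \<noteq> C" "C \<noteq> A"
  using assms by (auto simp: is_triangle_def insert_commute)

lemma triple_set_perm:
  assumes "{i, j, k} = {a, b, c}" "i \<noteq> j" "j \<noteq> k" "i \<noteq> k"
  shows "i = a \<and> j = b \<and> k = c \<or> i = a \<and> j = c \<and> k = b \<or> i = b \<and> j = a \<and> k = c \<or>
    i = b \<and> j = c \<and> k = a \<or> i = c \<and> j = a \<and> k = b \<or> i = c \<and> j = b \<and> k = a"
proof -
  have "i = a \<or> i = b \<or> i = c" "j = a \<or> j = b \<or> j = c" "k = a \<or> k = b \<or> k = c"
    using assms(1) by blast+
  then show ?thesis using assms(2-4) by auto
qed

lemma perm3_triple:
  assumes "{i, j, k} = {a, b, c}" "i \<noteq> j" "j \<noteq> k" "i \<noteq> k" and sym: "\<And>p q. f p q = f q p"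
  shows "perm3 (f i j) (f j k) (f k i) (f a b) (f b c) (f c a)"
  using triple_set_perm[OF assms(1-4)] sym[of a b] sym[of b c] sym[of c a]
  by (elim disjE conjE) (simp_all add: perm3_def)

lemma eps_congruent_dist:
  assumes "eps_congruent P Q R (A, B, C) \<epsilon>"
  shows "\<bar>dist P Q - dist A B\<bar> \<le> 2 * \<epsilon> * min_side (A, B, C)"
    "\<bar>dist Q R - dist B C\<bar> \<le> 2 * \<epsilon> * min_side (A, B, C)"
    "\<bar>dist R P - dist C A\<bar> \<le> 2 * \<epsilon> * min_side (A, B, C)"
proof -
  obtain P' Q' R' where d: "dist P' Q' = dist A B" "dist Q' R' = dist B C" "dist R' P' = dist C A"
    and b: "dist P' P \<le> \<epsilon> * min_side (A, B, C)" "dist Q' Q \<le> \<epsilon> * min_side (A, B, C)" "dist R' R \<le> \<epsilon> * min_side (A, B, C)"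
    using assms by (auto simp: eps_congruent_def congruent_to_def)
  have key: "\<bar>dist p q - dist p' q'\<bar> \<le> dist p' p + dist q' q" for p q p' q' :: point
    using dist_triangle[of p q p'] dist_triangle[of p' q q'] dist_triangle[of p' q' p] dist_triangle[of p q' q]
    by (simp add: dist_commute abs_le_iff)
  then show "\<bar>dist P Q - dist A B\<bar> \<le> 2 * \<epsilon> * min_side (A, B, C)"
    "\<bar>dist Q R - dist B C\<bar> \<le> 2 * \<epsilon> * min_side (A, B, C)"
    "\<bar>dist R P - dist C A\<bar> \<le> 2 * \<epsilon> * min_side (A, B, C)"
    using d b key[of P Q P' Q'] key[of Q R Q' R'] key[of R P R' P'] by linarith+
qed

theorem h_le_hsum:
  assumes T: "is_triangle (A, B, C)" and n: "0 < n"
  obtains S E w \<phi> where "triangle_copies (S :: nat set) E w \<phi> (sqd B C) (sqd C A) (sqd A B)"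
    "real (h n (A, B, C)) \<le> real n ^ 3 * hsum E w"
proof -
  let ?T = "(A, B, C)"
  let ?m = "min_side ?T"
  let ?e = "\<lambda>k. 1 / real (Suc k)"
  have "\<exists>f. bij_betw f {..<n} (f ` {..<n}) \<and> h n ?T \<le> count_eps (f ` {..<n}) ?T (?e k)" for k
  proof -
    obtain P where P: "finite P" "card P = n" "h n ?T \<le> count_eps P ?T (?e k)"
      by (rule h_attained[of "?e k"]) auto
    obtain f where "bij_betw f {..<n} P"
      using ex_bij_betw_nat_finite[OF P(1)] P(2) by (auto simp: atLeast0LessThan)
    then show ?thesis using P by (intro exI[of _ f]) (auto simp: bij_betw_def)
  qed
  then obtain f where f: "\<And>k. bij_betw (f k) {..<n} (f k ` {..<n})"
      "\<And>k. h n ?T \<le> count_eps (f k ` {..<n}) ?T (?e k)" by metis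
  \<comment> \<open>The whole pattern of near-copies as ordered index triples. It takes only
    finitely many values, so one of them recurs along a subsequence whose tolerance tends to
    0.\<close>
  define O3 where "O3 k = {(i, j, l). i < n \<and> j < n \<and> l < n \<and> eps_congruent (f k i) (f k j) (f k l) ?T (?e k)}" for k
  have "O3 k \<in> Pow ({..<n} \<times> {..<n} \<times> {..<n})" for k by (auto simp: O3_def)
  then have "finite (range O3)" by (intro finite_subset[of "range O3" "Pow ({..<n} \<times> {..<n} \<times> {..<n})"]) auto
  then obtain k0 where "infinite {k. O3 k = O3 k0}"
    using pigeonhole_infinite[of UNIV O3] by auto
  then obtain r where r: "strict_mono (r :: nat \<Rightarrow> nat)" "\<And>k. O3 (r k) = O3 k0"
    using infinite_enumerate by blast
  define Q where "Q = O3 k0"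
  \<comment> \<open>The cardinality condition discards triples with repeated indices, which the
    definition of \<open>O3\<close> does not rule out.\<close>
  define E0 where "E0 = {e. card e = 3 \<and> (\<exists>i j l. e = {i, j, l} \<and> (i, j, l) \<in> Q)}"
  have Q_lt: "i < n" "j < n" "l < n" if "(i, j, l) \<in> Q" for i j l using that by (auto simp: Q_def O3_def)
  have E0_sub: "E0 \<subseteq> Pow {..<n}"
  proof
    fix e assume "e \<in> E0"
    then obtain i j l where "e = {i, j, l}" "(i, j, l) \<in> Q" unfolding E0_def by blast
    then show "e \<in> Pow {..<n}" using Q_lt[of i j l] by simp
  qed
  have "h n ?T \<le> card E0"
  proof -
    have "{S. S \<subseteq> f k0 ` {..<n} \<and> card S = 3 \<and> (\<exists>A' B' C'. S = {A', B', C'} \<and> eps_congruent A' B' C' ?T (?e k0))}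
       \<subseteq> (`) (f k0) ` E0"
    proof
      fix S assume "S \<in> {S. S \<subseteq> f k0 ` {..<n} \<and> card S = 3 \<and> (\<exists>A' B' C'. S = {A', B', C'} \<and> eps_congruent A' B' C' ?T (?e k0))}"
      then obtain A' B' C' where S: "S \<subseteq> f k0 ` {..<n}" "card S = 3" "S = {A', B', C'}" "eps_congruent A' B' C' ?T (?e k0)" by blast
      then obtain i j l where ijl: "i < n" "j < n" "l < n" "A' = f k0 i" "B' = f k0 j" "C' = f k0 l" by auto
      then have "(i, j, l) \<in> Q" using S(4) by (simp add: Q_def O3_def)
      moreover have S': "S = f k0 ` {i, j, l}" using S(3) ijl by simp
      moreover have "inj_on (f k0) {i, j, l}" using f(1)[of k0] ijl by (auto simp: bij_betw_def inj_on_def)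
      then have "card {i, j, l} = 3" using S(2) S' card_image by metis
      ultimately show "S \<in> (`) (f k0) ` E0" unfolding S' by (intro imageI) (auto simp: E0_def)
    qed
    moreover have "finite E0" using E0_sub finite_subset by auto
    ultimately have "count_eps (f k0 ` {..<n}) ?T (?e k0) \<le> card E0"
      unfolding count_eps_def by (meson card_image_le card_mono finite_imageI order_trans)
    then show ?thesis using f(2)[of k0] by linarith
  qed
  moreover have "{..<n} \<noteq> {}" using n by auto
  then obtain S w where S: "S \<subseteq> {..<n}" "\<And>i. i \<in> S \<Longrightarrow> 0 < w i" "sum w S = 1"
    and cov: "\<And>i j. \<lbrakk>i \<in> S; j \<in> S; i \<noteq> j\<rbrakk> \<Longrightarrow> \<exists>e\<in>{e\<in>E0. e \<subseteq> S}. i \<in> e \<and> j \<in> e"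
    and stat: "\<And>i. i \<in> S \<Longrightarrow> hlink {e\<in>E0. e \<subseteq> S} w i = 3 * hsum {e\<in>E0. e \<subseteq> S} w"
    and le: "real (card E0) \<le> real (card {..<n}) ^ 3 * hsum {e\<in>E0. e \<subseteq> S} w"
    by (rule lagrangian_reduction[OF finite_lessThan _ E0_sub]) (auto simp: E0_def)
  ultimately have bound: "real (h n ?T) \<le> real n ^ 3 * hsum {e\<in>E0. e \<subseteq> S} w" by simp
  have finS: "finite S" using S(1) finite_subset by auto
  have m0: "0 < ?m" using triangle_distinct[OF T] by (auto simp: min_side_def)
  obtain i0 where i0: "i0 \<in> S" using S(3) by (metis sum.empty zero_neq_one equals0I)
  \<comment> \<open>Translation preserves distances. With one support vertex fixed at the origin all
    others are bounded, since each shares an edge with it.\<close>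
  define g where "g k i = f (r k) i - f (r k) i0" for k i
  have dg: "dist (g k i) (g k j) = dist (f (r k) i) (f (r k) j)" for k i j
    by (simp add: g_def dist_norm)
  let ?\<delta> = "\<lambda>k. 2 * ?e (r k) * ?m"
  have near: "\<bar>dist (g k i) (g k j) - dist A B\<bar> \<le> ?\<delta> k" "\<bar>dist (g k j) (g k l) - dist B C\<bar> \<le> ?\<delta> k"
      "\<bar>dist (g k l) (g k i) - dist C A\<bar> \<le> ?\<delta> k" if "(i, j, l) \<in> Q" for k i j l
  proof -
    have "(i, j, l) \<in> O3 (r k)" using that r by (simp add: Q_def)
    then have "eps_congruent (f (r k) i) (f (r k) j) (f (r k) l) ?T (?e (r k))" by (simp add: O3_def)
    then show "\<bar>dist (g k i) (g k j) - dist A B\<bar> \<le> ?\<delta> k" "\<bar>dist (g k j) (g k l) - dist B C\<bar> \<le> ?\<delta> k"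
      "\<bar>dist (g k l) (g k i) - dist C A\<bar> \<le> ?\<delta> k"
      unfolding dg by (rule eps_congruent_dist)+
  qed
  have \<delta>_le: "?\<delta> k \<le> 2 * ?m" for k using m0 by (simp add: field_simps)
  let ?M = "dist A B + dist B C + dist C A + 2 * ?m"
  have bnd: "bounded (range (\<lambda>k. g k i))" if i: "i \<in> S" for i
    unfolding bounded_iff
  proof (intro exI[of _ ?M] ballI)
    fix p assume "p \<in> range (\<lambda>k. g k i)"
    then obtain k where p: "p = g k i" by auto
    have g0: "g k i0 = 0" by (simp add: g_def)
    show "norm p \<le> ?M"
    proof (cases "i = i0")
      case True
      then show ?thesis using m0 p g0 by simp
    next
      case False
      then obtain e where e: "e \<in> E0" "i \<in> e" "i0 \<in> e" using cov i i0 by blast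
      then obtain a b c where abc: "e = {a, b, c}" "(a, b, c) \<in> Q" by (auto simp: E0_def)
      have "dist (g k i) (g k i0) = dist (g k a) (g k b) \<or> dist (g k i) (g k i0) = dist (g k b) (g k c) \<or>
          dist (g k i) (g k i0) = dist (g k c) (g k a)"
        using e(2,3) False abc(1) dist_commute[of "g k i"] by auto
      moreover have "dist (g k a) (g k b) \<le> ?M" "dist (g k b) (g k c) \<le> ?M" "dist (g k c) (g k a) \<le> ?M"
        using near[OF abc(2), of k] \<delta>_le[of k] zero_le_dist[of A B] zero_le_dist[of B C] zero_le_dist[of C A] by linarith+
      ultimately have "dist (g k i) (g k i0) \<le> ?M" by metis
      then show ?thesis using p g0 by (simp add: dist_norm)
    qed
  qed
  obtain r' \<phi> where r': "strict_mono (r' :: nat \<Rightarrow> nat)" and lim: "\<And>i. i \<in> S \<Longrightarrow> (\<lambda>k. g (r' k) i) \<longlonglongrightarrow> \<phi> i"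
    using finite_bounded_subseq[OF finS, of g] bnd by blast
  have \<delta>0: "(\<lambda>k. ?\<delta> (r' k)) \<longlonglongrightarrow> 0"
  proof -
    have "(\<lambda>k. ?e k) \<longlonglongrightarrow> 0" by (rule LIMSEQ_Suc[OF lim_1_over_n])
    then have "((\<lambda>k. ?e k) \<circ> (r \<circ> r')) \<longlonglongrightarrow> 0"
      by (rule LIMSEQ_subseq_LIMSEQ) (rule strict_mono_o[OF r(1) r'])
    then have "(\<lambda>k. 2 * ?e (r (r' k)) * ?m) \<longlonglongrightarrow> 2 * 0 * ?m" unfolding o_def by (intro tendsto_intros)
    then show ?thesis by simp
  qed
  have exact: "dist (\<phi> i) (\<phi> j) = D" if ij: "i \<in> S" "j \<in> S" and nr: "\<And>k. \<bar>dist (g k i) (g k j) - D\<bar> \<le> ?\<delta> k" for i j D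
  proof -
    have "(\<lambda>k. dist (g (r' k) i) (g (r' k) j)) \<longlonglongrightarrow> dist (\<phi> i) (\<phi> j)"
      using lim ij by (intro tendsto_dist) auto
    moreover have "(\<lambda>k. dist (g (r' k) i) (g (r' k) j) - D) \<longlonglongrightarrow> 0"
      by (rule Lim_null_comparison[OF _ \<delta>0]) (use nr in auto)
    then have "(\<lambda>k. dist (g (r' k) i) (g (r' k) j)) \<longlonglongrightarrow> D" by (simp add: LIM_zero_iff)
    ultimately show ?thesis using LIMSEQ_unique by blast
  qed
  have sides: "dist (\<phi> i) (\<phi> j) = dist A B" "dist (\<phi> j) (\<phi> l) = dist B C" "dist (\<phi> l) (\<phi> i) = dist C A"
    if "(i, j, l) \<in> Q" "{i, j, l} \<subseteq> S" for i j l
    using near[OF that(1)] that(2) by (auto intro!: exact)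
  have "triangle_copies S {e\<in>E0. e \<subseteq> S} w \<phi> (sqd B C) (sqd C A) (sqd A B)"
  proof
    show "finite S" by (rule finS)
    show "{e\<in>E0. e \<subseteq> S} \<subseteq> Pow S" by auto
    show "card e = 3" if "e \<in> {e\<in>E0. e \<subseteq> S}" for e using that by (auto simp: E0_def)
    show "0 < w i" if "i \<in> S" for i using S that by auto
    show "sum w S = 1" by (rule S)
    show "\<exists>e\<in>{e\<in>E0. e \<subseteq> S}. i \<in> e \<and> j \<in> e" if "i \<in> S" "j \<in> S" "i \<noteq> j" for i j by (rule cov[OF that])
    show "hlink {e\<in>E0. e \<subseteq> S} w i = 3 * hsum {e\<in>E0. e \<subseteq> S} w" if "i \<in> S" for i by (rule stat[OF that])
    show "inj_on \<phi> S"
    proof (rule inj_onI, rule ccontr)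
      fix i j assume h: "i \<in> S" "j \<in> S" "\<phi> i = \<phi> j" "i \<noteq> j"
      then obtain e where e: "e \<in> E0" "e \<subseteq> S" "i \<in> e" "j \<in> e" using cov by blast
      then obtain a b c where "e = {a, b, c}" "(a, b, c) \<in> Q" by (auto simp: E0_def)
      then show False using sides[of a b c] e h triangle_distinct[OF T] by (auto simp: dist_commute)
    qed
    show "0 < sqd B C" "0 < sqd C A" "0 < sqd A B" using triangle_distinct[OF T] by (auto simp: sqd_def)
    show "0 < 2 * sqd B C * sqd C A + 2 * sqd C A * sqd A B + 2 * sqd B C * sqd A B - (sqd B C)\<^sup>2 - (sqd C A)\<^sup>2 - (sqd A B)\<^sup>2"
      by (rule triangle_area[OF T])
    fix i j k assume h: "{i, j, k} \<in> {e\<in>E0. e \<subseteq> S}" "i \<noteq> j" "j \<noteq> k" "i \<noteq> k"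
    then obtain a b c where abc: "{i, j, k} = {a, b, c}" "(a, b, c) \<in> Q" by (auto simp: E0_def)
    have "perm3 (sqd (\<phi> i) (\<phi> j)) (sqd (\<phi> j) (\<phi> k)) (sqd (\<phi> k) (\<phi> i))
        (sqd (\<phi> a) (\<phi> b)) (sqd (\<phi> b) (\<phi> c)) (sqd (\<phi> c) (\<phi> a))"
      by (rule perm3_triple[OF abc(1) h(2-4), of "\<lambda>p q. sqd (\<phi> p) (\<phi> q)"]) (rule sqd_sym)
    moreover have "{a, b, c} \<subseteq> S" using h(1) abc(1) by auto
    then have "sqd (\<phi> a) (\<phi> b) = sqd A B" "sqd (\<phi> b) (\<phi> c) = sqd B C" "sqd (\<phi> c) (\<phi> a) = sqd C A"
      using sides[OF abc(2)] by (simp_all add: sqd_def)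
    ultimately show "perm3 (sqd (\<phi> i) (\<phi> j)) (sqd (\<phi> j) (\<phi> k)) (sqd (\<phi> k) (\<phi> i)) (sqd B C) (sqd C A) (sqd A B)"
      by (auto simp: perm3_def)
  qed
  then show thesis using that bound by blast
qed

section \<open>Angles and side lengths\<close>

text \<open>The angle opposite the side \<open>a\<close>, by the law of cosines.\<close>

definition ang :: "real \<Rightarrow> real \<Rightarrow> real \<Rightarrow> real" where
  "ang a b c = arccos ((b\<^sup>2 + c\<^sup>2 - a\<^sup>2) / (2 * b * c))"

definition angs :: "real \<Rightarrow> real \<Rightarrow> real \<Rightarrow> real multiset" where
  "angs a b c = {#ang a b c, ang b c a, ang c a b#}"

lemma ang_commute: "ang a b c = ang a c b"
  by (simp add: ang_def algebra_simps)

lemma angs_perm: "perm3 a b c p q r \<Longrightarrow> angs a b c = angs p q r"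
  unfolding perm3_def angs_def by (elim disjE conjE) (simp_all add: ang_commute add_mset_commute)

lemma vertex_angle_ang: "vertex_angle A B C = ang (dist B C) (dist C A) (dist A B)"
proof -
  have "2 * ((B - A) \<bullet> (C - A)) = sqd C A + sqd A B - sqd B C"
    by (simp add: sqd_coords inner_vec_def sum_2 power2_eq_square algebra_simps)
  then have i: "(B - A) \<bullet> (C - A) = ((dist C A)\<^sup>2 + (dist A B)\<^sup>2 - (dist B C)\<^sup>2) / 2"
    by (simp add: sqd_def)
  have v: "vertex_angle A B C = arccos ((B - A) \<bullet> (C - A) / (dist A B * dist C A))"
    by (simp add: vertex_angle_def dist_norm norm_minus_commute)
  show ?thesis unfolding v i ang_def by (simp add: mult.commute mult.left_commute)
qed

lemma tri_angles_angs: "tri_angles (A, B, C) = angs (dist B C) (dist C A) (dist A B)"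
  by (simp add: tri_angles_def angs_def vertex_angle_ang)

text \<open>The last condition says that Heron's expression for the squared area is positive.\<close>

definition tri_sides :: "real \<Rightarrow> real \<Rightarrow> real \<Rightarrow> bool" where
  "tri_sides a b c \<longleftrightarrow> 0 < a \<and> 0 < b \<and> 0 < c \<and> (b\<^sup>2 + c\<^sup>2 - a\<^sup>2)\<^sup>2 < 4 * b\<^sup>2 * c\<^sup>2"

lemma tri_sides_rotate: "tri_sides a b c \<Longrightarrow> tri_sides b c a"
  by (auto simp: tri_sides_def power2_eq_square algebra_simps)

lemma tri_sides_swap: "tri_sides a b c \<Longrightarrow> tri_sides a c b"
  by (auto simp: tri_sides_def algebra_simps)

lemma tri_sides_perm: "perm3 a b c p q r \<Longrightarrow> tri_sides p q r \<Longrightarrow> tri_sides a b c"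
  unfolding perm3_def by (elim disjE conjE) (auto intro: tri_sides_rotate tri_sides_swap)

lemma tri_sides_dist:
  assumes "is_triangle (A, B, C)"
  shows "tri_sides (dist B C) (dist C A) (dist A B)"
proof -
  have "4 * v * w - (v + w - u)\<^sup>2 = 2 * u * v + 2 * v * w + 2 * u * w - u\<^sup>2 - v\<^sup>2 - w\<^sup>2" for u v w :: real
    by algebra
  from this[of "sqd C A" "sqd A B" "sqd B C"] have "(sqd C A + sqd A B - sqd B C)\<^sup>2 < 4 * sqd C A * sqd A B"
    using triangle_area[OF assms] by linarith
  then show ?thesis using triangle_distinct[OF assms] by (simp add: tri_sides_def sqd_def)
qed

lemma ang_bounds:
  assumes "tri_sides a b c"
  shows "0 < ang a b c" "ang a b c < pi" "cos (ang a b c) = (b\<^sup>2 + c\<^sup>2 - a\<^sup>2) / (2 * b * c)"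
    "sin (ang a b c) = sqrt (4 * b\<^sup>2 * c\<^sup>2 - (b\<^sup>2 + c\<^sup>2 - a\<^sup>2)\<^sup>2) / (2 * b * c)"
proof -
  let ?u = "(b\<^sup>2 + c\<^sup>2 - a\<^sup>2) / (2 * b * c)"
  have pos: "0 < 2 * b * c" using assms by (simp add: tri_sides_def)
  have "(b\<^sup>2 + c\<^sup>2 - a\<^sup>2)\<^sup>2 < (2 * b * c)\<^sup>2" using assms by (simp add: tri_sides_def power_mult_distrib)
  then have "\<bar>b\<^sup>2 + c\<^sup>2 - a\<^sup>2\<bar> < 2 * b * c"
    using abs_le_square_iff[of "2 * b * c" "b\<^sup>2 + c\<^sup>2 - a\<^sup>2"] pos by linarith
  then have u: "-1 < ?u" "?u < 1" using pos by (auto simp: field_simps)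
  show "0 < ang a b c" "ang a b c < pi" unfolding ang_def using arccos_lt_bounded[OF u] by auto
  show "cos (ang a b c) = ?u" unfolding ang_def using u by (intro cos_arccos) auto
  have "sin (ang a b c) = sqrt (1 - ?u\<^sup>2)" unfolding ang_def using u by (intro sin_arccos) auto
  also have "1 - ?u\<^sup>2 = (4 * b\<^sup>2 * c\<^sup>2 - (b\<^sup>2 + c\<^sup>2 - a\<^sup>2)\<^sup>2) / (2 * b * c)\<^sup>2"
  proof -
    have "1 - (N / M)\<^sup>2 = (M\<^sup>2 - N\<^sup>2) / M\<^sup>2" if "M \<noteq> 0" for M N :: real
      using that by (simp add: power_divide field_simps)
    moreover have "(2 * b * c)\<^sup>2 = 4 * b\<^sup>2 * c\<^sup>2" by (simp add: power_mult_distrib)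
    ultimately show ?thesis using pos by (metis less_numeral_extra(3))
  qed
  also have "sqrt \<dots> = sqrt (4 * b\<^sup>2 * c\<^sup>2 - (b\<^sup>2 + c\<^sup>2 - a\<^sup>2)\<^sup>2) / (2 * b * c)"
    using pos by (simp only: real_sqrt_divide real_sqrt_abs abs_of_pos)
  finally show "sin (ang a b c) = sqrt (4 * b\<^sup>2 * c\<^sup>2 - (b\<^sup>2 + c\<^sup>2 - a\<^sup>2)\<^sup>2) / (2 * b * c)" .
qed

lemma sine_rule:
  assumes "tri_sides a b c"
  shows "\<exists>R>0. a = 2 * R * sin (ang a b c) \<and> b = 2 * R * sin (ang b c a) \<and> c = 2 * R * sin (ang c a b)"
proof -
  have t: "tri_sides b c a" "tri_sides c a b" using assms tri_sides_rotate by blast+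
  \<comment> \<open>Four times the area, the same from every vertex; the witness
    \<open>a * b * c / K\<close> below is the circumradius.\<close>
  define K where "K = sqrt (4 * b\<^sup>2 * c\<^sup>2 - (b\<^sup>2 + c\<^sup>2 - a\<^sup>2)\<^sup>2)"
  have pos: "0 < a" "0 < b" "0 < c" using assms by (auto simp: tri_sides_def)
  have K: "0 < K" using assms by (simp add: K_def tri_sides_def)
  have K2: "sqrt (4 * c\<^sup>2 * a\<^sup>2 - (c\<^sup>2 + a\<^sup>2 - b\<^sup>2)\<^sup>2) = K" "sqrt (4 * a\<^sup>2 * b\<^sup>2 - (a\<^sup>2 + b\<^sup>2 - c\<^sup>2)\<^sup>2) = K"
    unfolding K_def by (rule arg_cong[of _ _ sqrt]; algebra)+
  have "sin (ang a b c) = K / (2 * b * c)" "sin (ang b c a) = K / (2 * c * a)" "sin (ang c a b) = K / (2 * a * b)"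
    using ang_bounds(4)[OF assms] ang_bounds(4)[OF t(1)] ang_bounds(4)[OF t(2)] by (simp_all only: K2 K_def[symmetric])
  then show ?thesis using K pos
    by (intro exI[of _ "a * b * c / K"]) (simp add: field_simps)
qed

text \<open>The sine rule and the projection formula \<open>c = b * cos A + a * cos B\<close> give
  equal sines for \<open>C\<close> and \<open>A + B\<close>, so these angles are equal or
  supplementary; the first case has to be shown harmless.\<close>

lemma angle_sum:
  assumes t: "tri_sides a b c"
  shows "ang a b c + ang b c a + ang c a b = pi"
proof -
  have t': "tri_sides b c a" "tri_sides c a b" using t tri_sides_rotate by blast+
  let ?A = "ang a b c" and ?B = "ang b c a" and ?C = "ang c a b"
  obtain R where R: "0 < R" "a = 2 * R * sin ?A" "b = 2 * R * sin ?B" "c = 2 * R * sin ?C"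
    using sine_rule[OF t] by blast
  note A = ang_bounds[OF t] and B = ang_bounds[OF t'(1)] and C = ang_bounds[OF t'(2)]
  have pos: "0 < a" "0 < b" "0 < c" using t by (auto simp: tri_sides_def)
  have cosA: "2 * b * c * cos ?A = b\<^sup>2 + c\<^sup>2 - a\<^sup>2" and cosB: "2 * c * a * cos ?B = c\<^sup>2 + a\<^sup>2 - b\<^sup>2"
    using A(3) B(3) pos by (simp_all add: field_simps)
  have "2 * c * (b * cos ?A + a * cos ?B) = 2 * c * c"
    using cosA cosB by (simp add: algebra_simps power2_eq_square)
  then have "c = b * cos ?A + a * cos ?B" using pos by simp
  then have "2 * R * sin ?C = 2 * R * (sin ?A * cos ?B + cos ?A * sin ?B)"
    using R(2-4) by algebra
  then have sinC: "sin ?C = sin (?A + ?B)" using R(1) by (simp add: sin_add)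
  have "0 < sin ?C" using C by (intro sin_gt_zero) auto
  have AB: "?A + ?B < pi"
  proof (rule ccontr)
    assume "\<not> ?A + ?B < pi"
    then have "0 \<le> sin (?A + ?B - pi)" using A(2) B(2) by (intro sin_ge_zero) auto
    then show False using sinC \<open>0 < sin ?C\<close> by simp
  qed
  have "sin ?C * sin ?C = 1 - cos ?C * cos ?C" "sin (?A + ?B) * sin (?A + ?B) = 1 - cos (?A + ?B) * cos (?A + ?B)"
    using sin_cos_squared_add[of ?C] sin_cos_squared_add[of "?A + ?B"] by (simp_all add: power2_eq_square algebra_simps)
  then have "(cos ?C)\<^sup>2 = (cos (?A + ?B))\<^sup>2" using sinC by (simp add: power2_eq_square)
  then have "cos ?C = cos (?A + ?B) \<or> cos ?C = cos (pi - (?A + ?B))"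
    by (auto simp: power2_eq_iff)
  then have C_cases: "?C = ?A + ?B \<or> ?C = pi - (?A + ?B)"
    using C(1,2) A(1) B(1) AB cos_inj_pi[of ?C "?A + ?B"] cos_inj_pi[of ?C "pi - (?A + ?B)"] by auto
  have cosC: "2 * a * b * cos ?C = a\<^sup>2 + b\<^sup>2 - c\<^sup>2" using C(3) pos by (simp add: field_simps)
  show ?thesis
  proof (rule ccontr)
    \<comment> \<open>If \<open>C = A + B\<close>, the law of cosines and the addition formula give
      \<open>2 * a * b * cos C\<close> opposite signs. Hence \<open>C\<close> is a right angle, and
      then \<open>A + B\<close> is also its supplement.\<close>
    assume no: "\<not> ?thesis"
    then have "cos ?C = cos (?A + ?B)" using C_cases by auto
    then have e: "cos ?C = cos ?A * cos ?B - sin ?A * sin ?B" by (simp add: cos_add)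
    define u v t where uvt: "u = b * cos ?A" "v = a * cos ?B" "t = b * sin ?A"
    have t: "t = a * sin ?B" using R(2,3) uvt(3) by algebra
    have "t\<^sup>2 = b\<^sup>2 - u\<^sup>2" "t\<^sup>2 = a\<^sup>2 - v\<^sup>2"
      unfolding uvt(1,2) by (simp add: uvt(3) power_mult_distrib sin_squared_eq algebra_simps)
        (simp add: t power_mult_distrib sin_squared_eq algebra_simps)
    moreover have "c = u + v" using \<open>c = b * cos ?A + a * cos ?B\<close> uvt by simp
    ultimately have "a\<^sup>2 + b\<^sup>2 - c\<^sup>2 = 2 * t\<^sup>2 - 2 * (u * v)" by algebra
    moreover have "2 * a * b * cos ?C = 2 * (u * v) - 2 * t\<^sup>2"
    proof -
      have "2 * a * b * cos ?C = 2 * (u * v) - 2 * (b * sin ?A) * (a * sin ?B)"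
        unfolding e uvt by (simp add: algebra_simps)
      then show ?thesis using uvt(3) t by (simp add: power2_eq_square)
    qed
    ultimately have "2 * a * b * cos ?C = 0" using cosC by linarith
    then have "cos ?C = 0" using pos by simp
    then have "?C = pi / 2" using C(1,2) cos_inj_pi[of ?C "pi / 2"] by simp
    then show False using no C_cases by auto
  qed
qed

text \<open>The classical criterion for one angle to be twice another: \<open>cos (2 P)\<close>
  equals \<open>cos Q\<close>, and since \<open>cos P > 0\<close> the angle \<open>2 P\<close> lies
  in the range where cosine is injective.\<close>

lemma angle_double:
  assumes t: "tri_sides p q r" and rel: "q\<^sup>2 = p\<^sup>2 + p * r"
  shows "ang q r p = 2 * ang p q r"
proof -
  have pos: "0 < p" "0 < q" "0 < r" using t by (auto simp: tri_sides_def)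
  note P = ang_bounds[OF t] and Q = ang_bounds[OF tri_sides_rotate[OF t]]
  have cP: "cos (ang p q r) = (p + r) / (2 * q)"
  proof -
    have "q\<^sup>2 + r\<^sup>2 - p\<^sup>2 = r * (p + r)" using rel by (simp add: power2_eq_square algebra_simps)
    then show ?thesis using P(3) pos by simp
  qed
  have cQ: "cos (ang q r p) = (r - p) / (2 * p)"
  proof -
    have "r\<^sup>2 + p\<^sup>2 - q\<^sup>2 = r * (r - p)" using rel by (simp add: power2_eq_square algebra_simps)
    then show ?thesis using Q(3) pos by simp
  qed
  have "cos (2 * ang p q r) = 2 * ((p + r) / (2 * q))\<^sup>2 - 1" by (simp add: cos_double_cos cP)
  also have "\<dots> = (p + r)\<^sup>2 / (2 * q\<^sup>2) - 1" by (simp add: power_divide power_mult_distrib)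
  also have "q\<^sup>2 = p * (p + r)" using rel by (simp add: power2_eq_square algebra_simps)
  also have "(p + r)\<^sup>2 / (2 * (p * (p + r))) = (p + r) / (2 * p)"
    using pos by (simp add: power2_eq_square)
  also have "(p + r) / (2 * p) - 1 = (r - p) / (2 * p)"
    using pos by (simp add: field_simps)
  finally have "cos (ang q r p) = cos (2 * ang p q r)" using cQ by simp
  moreover have "ang p q r < pi / 2"
  proof (rule ccontr)
    assume "\<not> ang p q r < pi / 2"
    then have "cos (ang p q r) \<le> cos (pi / 2)" using P(2) by (intro cos_monotone_0_pi_le) auto
    then show False using cP pos by (simp add: field_simps)
  qed
  ultimately show ?thesis using P(1) Q(1,2) cos_inj_pi[of "ang q r p" "2 * ang p q r"] by auto
qed

lemma ang_eqI:
  assumes "tri_sides a b c" "0 \<le> \<theta>" "\<theta> \<le> pi" "(b\<^sup>2 + c\<^sup>2 - a\<^sup>2) / (2 * b * c) = cos \<theta>"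
  shows "ang a b c = \<theta>"
  unfolding ang_def assms(4) using assms(2,3) by (rule arccos_cos)

lemma angs_120:
  assumes "tri_sides p q r" "perm3 p q r (sqrt 3 * l) l l"
  shows "angs p q r = {#2 * pi / 3, pi / 6, pi / 6#}"
proof -
  have t: "tri_sides (sqrt 3 * l) l l" using assms tri_sides_perm perm3_sym by blast
  then have l: "0 < l" by (auto simp: tri_sides_def)
  have "cos (2 * pi / 3) = - (1 / 2 :: real)"
    using cos_120 by simp
  then have a1: "ang (sqrt 3 * l) l l = 2 * pi / 3"
    using l by (intro ang_eqI[OF t]) (auto simp: power_mult_distrib power2_eq_square field_simps)
  have a2: "ang l l (sqrt 3 * l) = pi / 6"
    using l by (intro ang_eqI[OF tri_sides_rotate[OF t]]) (auto simp: power_mult_distrib power2_eq_square field_simps cos_30)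
  then have a3: "ang l (sqrt 3 * l) l = pi / 6" by (simp only: ang_commute[of l "sqrt 3 * l"])
  show ?thesis unfolding angs_perm[OF assms(2)] unfolding angs_def a1 a2 a3 ..
qed

lemma angs_heptagonal:
  assumes t: "tri_sides a b c" and rel: "b\<^sup>2 = a\<^sup>2 + a * c" "c\<^sup>2 = b\<^sup>2 + b * a"
  shows "angs a b c = {#4 * pi / 7, 2 * pi / 7, pi / 7#}"
proof -
  have "ang b c a = 2 * ang a b c" by (rule angle_double[OF t rel(1)])
  moreover have "ang c a b = 2 * ang b c a" by (rule angle_double[OF tri_sides_rotate[OF t] rel(2)])
  ultimately have e: "ang a b c = pi / 7" "ang b c a = 2 * pi / 7" "ang c a b = 4 * pi / 7"
    using angle_sum[OF t] by simp_all
  show ?thesis unfolding angs_def e by (simp add: add_mset_commute)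
qed

lemma angs_golden_acute:
  assumes t: "tri_sides s l l" and rel: "l\<^sup>2 = s\<^sup>2 + s * l"
  shows "angs s l l = {#2 * pi / 5, 2 * pi / 5, pi / 5#}"
proof -
  have "ang l l s = 2 * ang s l l" by (rule angle_double[OF t rel])
  moreover have "ang l s l = ang l l s" by (rule ang_commute)
  ultimately have e: "ang s l l = pi / 5" "ang l l s = 2 * pi / 5" "ang l s l = 2 * pi / 5"
    using angle_sum[OF t] by simp_all
  show ?thesis unfolding angs_def e by (simp add: add_mset_commute)
qed

text \<open>Here no angle is twice another, so the triple angle is used: the quadratic equation for
  the cosine of the base angle \<theta> gives
  \<open>cos (3 \<theta>) = cos (pi - 2 \<theta>)\<close>, and \<open>\<theta> < pi / 3\<close>
  allows the cosine to be cancelled.\<close>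

lemma angs_golden_obtuse:
  assumes t: "tri_sides s l l" and rel: "s\<^sup>2 = l\<^sup>2 + s * l"
  shows "angs s l l = {#3 * pi / 5, pi / 5, pi / 5#}"
proof -
  let ?\<theta> = "ang l l s"
  have pos: "0 < s" "0 < l" using t by (auto simp: tri_sides_def)
  have tl: "tri_sides l l s" using t by (rule tri_sides_rotate)
  note B = ang_bounds[OF tl]
  have sum: "ang s l l + 2 * ?\<theta> = pi" using angle_sum[OF t] ang_commute[of l s l] by simp
  have u: "cos ?\<theta> = s / (2 * l)" using B(3) pos by (simp add: power2_eq_square field_simps)
  have "l < s"
  proof (rule ccontr)
    assume "\<not> l < s"
    then have "s\<^sup>2 \<le> l\<^sup>2" using pos by (intro power_mono) auto
    then show False using rel pos by (smt (verit) mult_pos_pos)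
  qed
  then have "1 / 2 < s / (2 * l)" using pos by (simp add: field_simps)
  then have "cos (pi / 3) < cos ?\<theta>" by (simp only: u cos_60)
  then have small: "?\<theta> < pi / 3"
    using B(1,2) cos_monotone_0_pi_le[of "pi / 3" ?\<theta>] by fastforce
  have "4 * (cos ?\<theta>)\<^sup>2 = 1 + 2 * cos ?\<theta>" using rel pos by (simp add: u power_divide field_simps power2_eq_square)
  then have "4 * cos ?\<theta> ^ 3 - 3 * cos ?\<theta> = - (2 * (cos ?\<theta>)\<^sup>2 - 1)" by algebra
  then have "cos (3 * ?\<theta>) = cos (pi - 2 * ?\<theta>)"
    by (simp add: cos_treble_cos cos_double_cos)
  then have "3 * ?\<theta> = pi - 2 * ?\<theta>"
    using B(1,2) small cos_inj_pi[of "3 * ?\<theta>" "pi - 2 * ?\<theta>"] by auto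
  then have e: "?\<theta> = pi / 5" "ang s l l = 3 * pi / 5" using sum by simp_all
  show ?thesis unfolding angs_def ang_commute[of l s l] e ..
qed

lemma right_angle_iff:
  assumes t: "tri_sides a b c"
  shows "ang a b c = pi / 2 \<longleftrightarrow> b\<^sup>2 + c\<^sup>2 = a\<^sup>2"
proof
  assume "ang a b c = pi / 2"
  then have "cos (ang a b c) = 0" by (simp only: cos_pi_half)
  then show "b\<^sup>2 + c\<^sup>2 = a\<^sup>2" using ang_bounds(3)[OF t] t by (simp add: tri_sides_def)
next
  assume "b\<^sup>2 + c\<^sup>2 = a\<^sup>2"
  then show "ang a b c = pi / 2" by (simp add: ang_def)
qed

lemma right_angled_iff:
  assumes T: "is_triangle (A, B, C)"
  shows "right_angled (A, B, C) \<longleftrightarrow> right_sides (sqd B C) (sqd C A) (sqd A B)"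
proof -
  have t: "tri_sides (dist B C) (dist C A) (dist A B)" by (rule tri_sides_dist[OF T])
  have "right_angled (A, B, C) \<longleftrightarrow> pi / 2 \<in># angs (dist B C) (dist C A) (dist A B)"
    by (simp add: right_angled_def tri_angles_angs)
  also have "\<dots> \<longleftrightarrow> right_sides (sqd B C) (sqd C A) (sqd A B)"
    using right_angle_iff[OF t] right_angle_iff[OF tri_sides_rotate[OF t]]
      right_angle_iff[OF tri_sides_rotate[OF tri_sides_rotate[OF t]]]
    by (auto simp: angs_def right_sides_def sqd_def)
  finally show ?thesis .
qed

lemma perm3_sqrt:
  assumes "perm3 p q r (a\<^sup>2) (b\<^sup>2) (c\<^sup>2)" "0 \<le> a" "0 \<le> b" "0 \<le> c"
  shows "perm3 (sqrt p) (sqrt q) (sqrt r) a b c"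
  using assms unfolding perm3_def by (elim disjE conjE) simp_all

lemma heptagonal_rotate: "heptagonal a b c \<Longrightarrow> heptagonal c a b"
  unfolding heptagonal_def by (elim conjE, intro conjI; algebra)

text \<open>Undoes the squaring in \<open>heptagonal\<close>. By cyclic symmetry the first argument
  may be taken as the least, which fixes the signs of two roots; comparing \<open>a * c\<close> with
  \<open>b * c\<close> then gives \<open>q < r\<close> and the sign of the third.\<close>

lemma heptagonal_sides:
  assumes h: "heptagonal p q r" and sc: "scalene p q r"
  shows "\<exists>a b c. perm3 p q r (a\<^sup>2) (b\<^sup>2) (c\<^sup>2) \<and> 0 < a \<and> 0 < b \<and> 0 < c \<and> b\<^sup>2 = a\<^sup>2 + a * c \<and> c\<^sup>2 = b\<^sup>2 + b * a"
proof -
  have least: "\<exists>a b c. perm3 p q r (a\<^sup>2) (b\<^sup>2) (c\<^sup>2) \<and> 0 < a \<and> 0 < b \<and> 0 < c \<and> b\<^sup>2 = a\<^sup>2 + a * c \<and> c\<^sup>2 = b\<^sup>2 + b * a"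
    if h: "heptagonal p q r" and sc: "scalene p q r" and lt: "p < q" "p < r" for p q r
  proof -
    define a b c where abc: "a = sqrt p" "b = sqrt q" "c = sqrt r"
    have pos: "0 < p" "0 < q" "0 < r" using sc by (auto simp: scalene_def)
    then have sq: "a\<^sup>2 = p" "b\<^sup>2 = q" "c\<^sup>2 = r" and abc0: "0 < a" "0 < b" "0 < c" by (auto simp: abc)
    have sqrt_eq: "u = v" if "u\<^sup>2 = v\<^sup>2" "0 < u" "0 < v" for u v :: real
      using that power2_eq_iff_nonneg[of u v] by simp
    have h': "(p - q)\<^sup>2 = p * r" "(p - r)\<^sup>2 = q * r" "(q - r)\<^sup>2 = p * q" using h by (auto simp: heptagonal_def)
    have "(q - p)\<^sup>2 = (a * c)\<^sup>2" using h'(1) sq(1,3) by algebra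
    then have e1: "q - p = a * c" by (rule sqrt_eq) (use lt abc0 in auto)
    have "(r - p)\<^sup>2 = (b * c)\<^sup>2" using h'(2) sq(2,3) by algebra
    then have e2: "r - p = b * c" by (rule sqrt_eq) (use lt abc0 in auto)
    have "a < b" using lt by (simp add: abc)
    then have "a * c < b * c" using abc0 by simp
    then have "q < r" using e1 e2 by linarith
    have "(r - q)\<^sup>2 = (b * a)\<^sup>2" using h'(3) sq(1,2) by algebra
    then have e3: "r - q = b * a" by (rule sqrt_eq) (use \<open>q < r\<close> abc0 in auto)
    show ?thesis
      using sq abc0 e1 e3 by (intro exI[of _ a] exI[of _ b] exI[of _ c]) (auto simp: perm3_def)
  qed
  have ne: "p \<noteq> q" "q \<noteq> r" "p \<noteq> r" using sc by (auto simp: scalene_def)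
  have sc2: "scalene r p q" "scalene q r p" using sc by (auto simp: scalene_def)
  have pm: "perm3 r p q u v t \<Longrightarrow> perm3 p q r u v t" "perm3 q r p u v t \<Longrightarrow> perm3 p q r u v t" for u v t
    by (auto simp: perm3_def)
  consider "p < q" "p < r" | "q < p" "q < r" | "r < p" "r < q" using ne by linarith
  then show ?thesis
  proof cases
    case 1
    then show ?thesis using least[OF h sc] by blast
  next
    case 2
    then show ?thesis using least[OF heptagonal_rotate[OF heptagonal_rotate[OF h]] sc2(2)] pm(2) by blast
  next
    case 3
    then show ?thesis using least[OF heptagonal_rotate[OF h] sc2(1)] pm(1) by blast
  qed
qed

section \<open>Lower bounds by blow-ups\<close>

lemma eps_congruent_of_perm3:
  assumes d: "perm3 (dist p q) (dist q r) (dist r p) (dist B C) (dist C A) (dist A B)"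
    and near: "a \<in> cball p (\<epsilon> * min_side (A, B, C))" "b \<in> cball q (\<epsilon> * min_side (A, B, C))" "c \<in> cball r (\<epsilon> * min_side (A, B, C))"
  shows "\<exists>A' B' C'. {a, b, c} = {A', B', C'} \<and> eps_congruent A' B' C' (A, B, C) \<epsilon>"
proof -
  let ?m = "\<epsilon> * min_side (A, B, C)"
  have I: "eps_congruent a' b' c' (A, B, C) \<epsilon>"
    if "dist p' q' = dist A B" "dist q' r' = dist B C" "dist r' p' = dist C A" "a' \<in> cball p' ?m" "b' \<in> cball q' ?m" "c' \<in> cball r' ?m"
    for p' q' r' a' b' c'
    unfolding eps_congruent_def congruent_to_def using that by auto
  have sets: "{a, b, c} = {b, c, a}" "{a, b, c} = {c, a, b}" "{a, b, c} = {b, a, c}" "{a, b, c} = {a, c, b}" "{a, b, c} = {c, b, a}" by auto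
  from d show ?thesis unfolding perm3_def
  proof (elim disjE conjE)
    assume "dist p q = dist B C" "dist q r = dist C A" "dist r p = dist A B"
    then have "eps_congruent c a b (A, B, C) \<epsilon>" using near by (intro I[of r p q])
    then show ?thesis using sets(2) by blast
  next
    assume "dist p q = dist B C" "dist q r = dist A B" "dist r p = dist C A"
    then have "eps_congruent c b a (A, B, C) \<epsilon>" using near by (intro I[of r q p]) (auto simp: dist_commute)
    then show ?thesis using sets(5) by blast
  next
    assume "dist p q = dist C A" "dist q r = dist B C" "dist r p = dist A B"
    then have "eps_congruent p' q' r' (A, B, C) \<epsilon>" if "p' = a" "q' = c" "r' = b" for p' q' r'
      unfolding that using near by (intro I[of p r q]) (auto simp: dist_commute)
    then show ?thesis using sets(4) by blast
  next
    assume "dist p q = dist C A" "dist q r = dist A B" "dist r p = dist B C"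
    then have "eps_congruent b c a (A, B, C) \<epsilon>" using near by (intro I[of q r p])
    then show ?thesis using sets(1) by blast
  next
    assume "dist p q = dist A B" "dist q r = dist B C" "dist r p = dist C A"
    then have "eps_congruent a b c (A, B, C) \<epsilon>" using near by (intro I[of p q r])
    then show ?thesis by blast
  next
    assume "dist p q = dist A B" "dist q r = dist C A" "dist r p = dist B C"
    then have "eps_congruent b a c (A, B, C) \<epsilon>" using near by (intro I[of q p r]) (auto simp: dist_commute)
    then show ?thesis using sets(3) by blast
  qed
qed

text \<open>The vertex \<open>v i\<close> is replaced by \<open>m i\<close> points in a ball so
  small that clusters stay disjoint and every transversal of an admissible triple is
  \<epsilon>-congruent to the triangle.\<close>

theorem h_ge_sum:
  fixes v :: "nat \<Rightarrow> point" and m :: "nat \<Rightarrow> nat"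
  assumes T: "is_triangle (A, B, C)" and inj: "inj_on v {..<N}" and n: "sum m {..<N} = n"
    and R: "\<And>i j l. \<lbrakk>R i j l; l < j; j < i; i < N\<rbrakk> \<Longrightarrow>
      perm3 (dist (v i) (v j)) (dist (v j) (v l)) (dist (v l) (v i)) (dist B C) (dist C A) (dist A B)"
  shows "(\<Sum>i<N. \<Sum>j<i. \<Sum>l<j. if R i j l then m i * m j * m l else 0) \<le> h n (A, B, C)"
proof (rule h_greatest)
  fix \<epsilon> :: real assume \<epsilon>: "0 < \<epsilon>"
  let ?T = "(A, B, C)"
  have m0: "0 < min_side ?T" using triangle_distinct[OF T] by (auto simp: min_side_def)
  \<comment> \<open>The inserted 1 keeps \<open>D\<close> non-empty, so that \<open>Min\<close> is
    meaningful also for fewer than two vertices.\<close>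
  define D where "D = insert 1 ((\<lambda>(i, j). dist (v i) (v j)) ` {(i, j). i < N \<and> j < N \<and> i \<noteq> j})"
  have "finite {(i, j). i < N \<and> j < N \<and> i \<noteq> j}"
    by (rule finite_subset[of _ "{..<N} \<times> {..<N}"]) auto
  then have finD: "finite D" by (simp add: D_def)
  have "0 < Min D" using finD inj by (subst Min_gr_iff) (auto simp: D_def inj_on_eq_iff)
  define r where "r = min (\<epsilon> * min_side ?T) (Min D / 2)"
  have r: "0 < r" "r \<le> \<epsilon> * min_side ?T" "2 * r \<le> Min D"
    using \<open>0 < Min D\<close> \<epsilon> m0 by (auto simp: r_def)
  have sep: "2 * r \<le> dist (v i) (v j)" if "i < N" "j < N" "i \<noteq> j" for i j
  proof -
    have "Min D \<le> dist (v i) (v j)" using finD that by (intro Min_le) (auto simp: D_def)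
    then show ?thesis using r by simp
  qed
  have "\<exists>K. finite K \<and> card K = m i \<and> K \<subseteq> ball (v i) r" for i
    using uncountable_infinite[OF uncountable_ball[OF r(1)]] infinite_arbitrarily_large by blast
  then obtain K where K: "\<And>i. finite (K i)" "\<And>i. card (K i) = m i" "\<And>i. K i \<subseteq> ball (v i) r" by metis
  have disj: "i = j" if h: "i < N" "j < N" "a \<in> K i" "a \<in> K j" for i j a
  proof (rule ccontr)
    assume "i \<noteq> j"
    have "dist (v i) a < r" "dist (v j) a < r" using h K(3)[of i] K(3)[of j] by auto
    then have "dist (v i) (v j) < 2 * r" using dist_triangle2[of "v i" "v j" a] by linarith
    then show False using sep[OF h(1,2) \<open>i \<noteq> j\<close>] by simp
  qed
  define P where "P = (\<Union>i<N. K i)"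
  have finP: "finite P" using K(1) by (simp add: P_def)
  have "card P = (\<Sum>i<N. card (K i))"
    unfolding P_def using K(1) disj by (intro card_UN_disjoint) auto
  then have cardP: "card P = n" using K(2) n by simp
  define TS where "TS = (SIGMA i:{..<N}. SIGMA j:{..<i}. {l\<in>{..<j}. R i j l})"
  define G where "G = (SIGMA t:TS. case t of (i, j, l) \<Rightarrow> K i \<times> K j \<times> K l)"
  let ?g = "\<lambda>(t :: nat \<times> nat \<times> nat, a, b, c). {a, b, c :: point}"
  have TS: "i < N" "j < i" "l < j" "R i j l" if "(i, j, l) \<in> TS" for i j l using that by (auto simp: TS_def)
  have finTS: "finite TS" by (auto simp: TS_def)
  have distinct3: "a \<noteq> b" "b \<noteq> c" "a \<noteq> c" if "(i, j, l) \<in> TS" "a \<in> K i" "b \<in> K j" "c \<in> K l" for i j l a b c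
    using disj[of i j a] disj[of j l b] disj[of i l a] TS[OF that(1)] that by auto
  \<comment> \<open>Indices decrease within a triple, so a set of points determines its clusters and
    thereby the order of its elements.\<close>
  have "inj_on ?g G"
  proof (rule inj_onI)
    fix s t assume s: "s \<in> G" and t: "t \<in> G" and eq: "?g s = ?g t"
    obtain i j l a b c where s': "s = ((i, j, l), a, b, c)" by (metis prod.exhaust)
    obtain i' j' l' a' b' c' where t': "t = ((i', j', l'), a', b', c')" by (metis prod.exhaust)
    have S: "(i, j, l) \<in> TS" "a \<in> K i" "b \<in> K j" "c \<in> K l" using s s' by (auto simp: G_def)
    have S': "(i', j', l') \<in> TS" "a' \<in> K i'" "b' \<in> K j'" "c' \<in> K l'" using t t' by (auto simp: G_def)
    note o = TS[OF S(1)] TS[OF S'(1)]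
    have ix: "p = q" if "p < N" "q < N" "e \<in> K p" "f \<in> K q" "e = f" for p q e f using disj that by blast
    have N: "i < N" "j < N" "l < N" "i' < N" "j' < N" "l' < N" using o by auto
    have "{a, b, c} = {a', b', c'}" using eq s' t' by simp
    from triple_set_perm[OF this distinct3(1,2)[OF S] distinct3(3)[OF S]]
    show "s = t"
    proof (elim disjE conjE)
      assume e: "a = a'" "b = b'" "c = c'"
      then show ?thesis using ix[OF N(1,4) S(2) S'(2)] ix[OF N(2,5) S(3) S'(3)] ix[OF N(3,6) S(4) S'(4)] s' t' by simp
    next
      assume e: "a = a'" "b = c'" "c = b'"
      then show ?thesis using ix[OF N(2,6) S(3) S'(4)] ix[OF N(3,5) S(4) S'(3)] o by simp
    next
      assume e: "a = b'" "b = a'" "c = c'"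
      then show ?thesis using ix[OF N(1,5) S(2) S'(3)] ix[OF N(2,4) S(3) S'(2)] o by simp
    next
      assume e: "a = b'" "b = c'" "c = a'"
      then show ?thesis using ix[OF N(1,5) S(2) S'(3)] ix[OF N(3,4) S(4) S'(2)] o by simp
    next
      assume e: "a = c'" "b = a'" "c = b'"
      then show ?thesis using ix[OF N(1,6) S(2) S'(4)] ix[OF N(2,4) S(3) S'(2)] o by simp
    next
      assume e: "a = c'" "b = b'" "c = a'"
      then show ?thesis using ix[OF N(1,6) S(2) S'(4)] ix[OF N(3,4) S(4) S'(2)] o by simp
    qed
  qed
  moreover have "?g ` G \<subseteq> {S. S \<subseteq> P \<and> card S = 3 \<and> (\<exists>A' B' C'. S = {A', B', C'} \<and> eps_congruent A' B' C' ?T \<epsilon>)}"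
  proof
    fix S assume "S \<in> ?g ` G"
    then obtain i j l a b c where S: "S = {a, b, c}" and t: "(i, j, l) \<in> TS" and abc: "a \<in> K i" "b \<in> K j" "c \<in> K l"
      by (auto simp: G_def)
    note o = TS[OF t]
    have "S \<subseteq> P" using S abc o by (auto simp: P_def)
    moreover have "card S = 3" using S distinct3[OF t abc] by simp
    moreover have "\<exists>A' B' C'. {a, b, c} = {A', B', C'} \<and> eps_congruent A' B' C' ?T \<epsilon>"
    proof (rule eps_congruent_of_perm3)
      show "perm3 (dist (v i) (v j)) (dist (v j) (v l)) (dist (v l) (v i)) (dist B C) (dist C A) (dist A B)"
        using R o by blast
      show "a \<in> cball (v i) (\<epsilon> * min_side ?T)" "b \<in> cball (v j) (\<epsilon> * min_side ?T)" "c \<in> cball (v l) (\<epsilon> * min_side ?T)"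
        using abc K(3)[of i] K(3)[of j] K(3)[of l] r(2) by (auto simp: subset_iff)
    qed
    ultimately show "S \<in> {S. S \<subseteq> P \<and> card S = 3 \<and> (\<exists>A' B' C'. S = {A', B', C'} \<and> eps_congruent A' B' C' ?T \<epsilon>)}"
      using S by blast
  qed
  moreover have "finite {S. S \<subseteq> P \<and> card S = 3 \<and> (\<exists>A' B' C'. S = {A', B', C'} \<and> eps_congruent A' B' C' ?T \<epsilon>)}"
    using finP by (auto intro: finite_subset[of _ "Pow P"])
  ultimately have "card G \<le> count_eps P ?T \<epsilon>"
    unfolding count_eps_def by (metis (no_types, lifting) card_inj_on_le)
  moreover have "card G = (\<Sum>i<N. \<Sum>j<i. \<Sum>l<j. if R i j l then m i * m j * m l else 0)"
  proof -
    have "card G = (\<Sum>t\<in>TS. card (case t of (i, j, l) \<Rightarrow> K i \<times> K j \<times> K l))"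
      unfolding G_def using finTS K(1) by (intro card_SigmaI) auto
    also have "\<dots> = (\<Sum>(i, j, l)\<in>TS. m i * m j * m l)"
      by (intro sum.cong) (auto simp: card_cartesian_product K(2))
    also have "\<dots> = (\<Sum>i<N. \<Sum>j<i. \<Sum>l\<in>{l\<in>{..<j}. R i j l}. m i * m j * m l)"
      unfolding TS_def by (subst sum.Sigma[symmetric]; simp)+
    also have "\<dots> = (\<Sum>i<N. \<Sum>j<i. \<Sum>l<j. if R i j l then m i * m j * m l else 0)"
      by (intro sum.cong refl sum.inter_filter) auto
    finally show ?thesis .
  qed
  ultimately show "\<exists>P. finite P \<and> card P = n \<and> (\<Sum>i<N. \<Sum>j<i. \<Sum>l<j. if R i j l then m i * m j * m l else 0) \<le> count_eps P ?T \<epsilon>"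
    using finP cardP by auto
qed

section \<open>Regular polygons and the extremal configurations\<close>

definition circle_point :: "real \<Rightarrow> real \<Rightarrow> point" where
  "circle_point R \<theta> = vector [R * cos \<theta>, R * sin \<theta>]"

lemma dist_circle_point:
  assumes "0 \<le> R" "0 \<le> \<theta> - \<eta>" "\<theta> - \<eta> \<le> 2 * pi"
  shows "dist (circle_point R \<theta>) (circle_point R \<eta>) = 2 * R * sin ((\<theta> - \<eta>) / 2)"
proof -
  have "sqd (circle_point R \<theta>) (circle_point R \<eta>) = R\<^sup>2 * ((cos \<theta> - cos \<eta>)\<^sup>2 + (sin \<theta> - sin \<eta>)\<^sup>2)"
    unfolding sqd_coords circle_point_def vector_2 by algebra
  also have "(cos \<theta> - cos \<eta>)\<^sup>2 + (sin \<theta> - sin \<eta>)\<^sup>2 = 2 - 2 * cos (\<theta> - \<eta>)"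
    using sin_cos_squared_add[of \<theta>] sin_cos_squared_add[of \<eta>] unfolding cos_diff by algebra
  also have "\<dots> = 4 * (sin ((\<theta> - \<eta>) / 2))\<^sup>2"
  proof -
    have "cos (\<theta> - \<eta>) = 1 - 2 * (sin ((\<theta> - \<eta>) / 2))\<^sup>2"
      by (metis cos_double_sin field_sum_of_halves mult_2)
    then show ?thesis by simp
  qed
  finally have "(dist (circle_point R \<theta>) (circle_point R \<eta>))\<^sup>2 = (2 * R * sin ((\<theta> - \<eta>) / 2))\<^sup>2"
    by (simp add: sqd_def power_mult_distrib)
  moreover have "0 \<le> sin ((\<theta> - \<eta>) / 2)" using assms by (intro sin_ge_zero) auto
  ultimately show ?thesis using assms(1) by (simp add: power2_eq_iff_nonneg)
qed

lemma norm_circle_point: "0 \<le> R \<Longrightarrow> dist 0 (circle_point R \<theta>) = R"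
proof -
  assume R: "0 \<le> R"
  have "sqd 0 (circle_point R \<theta>) = R\<^sup>2 * ((sin \<theta>)\<^sup>2 + (cos \<theta>)\<^sup>2)"
    unfolding sqd_coords circle_point_def vector_2 zero_index by algebra
  then show ?thesis using R by (simp add: sqd_def)
qed

lemma sides_of_angs:
  assumes t: "tri_sides a b c" and "angs a b c = {#\<alpha>, \<beta>, \<gamma>#}"
  shows "\<exists>R>0. perm3 a b c (2 * R * sin \<alpha>) (2 * R * sin \<beta>) (2 * R * sin \<gamma>)"
proof -
  obtain R where R: "0 < R" and s: "2 * R * sin (ang a b c) = a" "2 * R * sin (ang b c a) = b" "2 * R * sin (ang c a b) = c"
    using sine_rule[OF t] by metis
  have "image_mset (\<lambda>x. 2 * R * sin x) (angs a b c) = {#2 * R * sin \<alpha>, 2 * R * sin \<beta>, 2 * R * sin \<gamma>#}"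
    unfolding assms(2) by simp
  then have "{#a, b, c#} = {#2 * R * sin \<alpha>, 2 * R * sin \<beta>, 2 * R * sin \<gamma>#}"
    by (simp only: angs_def image_mset_add_mset image_mset_empty s)
  then show ?thesis using R by (auto simp: perm3_iff_mset)
qed

definition chord :: "nat \<Rightarrow> real \<Rightarrow> nat \<Rightarrow> real" where
  "chord p R k = 2 * R * sin (pi * real k / real p)"

definition polygon :: "nat \<Rightarrow> real \<Rightarrow> nat \<Rightarrow> point" where
  "polygon p R i = circle_point R (2 * pi * real i / real p)"

lemma dist_polygon:
  assumes "0 \<le> R" "j < i" "i < p"
  shows "dist (polygon p R i) (polygon p R j) = chord p R (i - j)"
proof -
  have "2 * pi * real i / real p - 2 * pi * real j / real p = 2 * (pi * real (i - j) / real p)"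
    using assms(2) by (simp add: of_nat_diff right_diff_distrib diff_divide_distrib)
  moreover have "pi * (real (i - j) / real p) \<le> pi * 1"
    using assms by (intro mult_left_mono) (auto simp: divide_le_eq_1)
  then have "pi * real (i - j) / real p \<le> pi" by simp
  ultimately show ?thesis
    unfolding polygon_def chord_def using assms(1) by (subst dist_circle_point) auto
qed

lemma chord_pos:
  assumes "0 < R" "0 < k" "k < p"
  shows "0 < chord p R k"
proof -
  have "pi * real k / real p < pi" "0 < pi * real k / real p" using assms by (auto simp: field_simps)
  then show ?thesis using assms(1) unfolding chord_def by (intro mult_pos_pos sin_gt_zero) auto
qed

lemma chord_reflect:
  assumes "k \<le> p" "0 < p"
  shows "chord p R (p - k) = chord p R k"
proof -
  have "pi * real (p - k) / real p = pi - pi * real k / real p"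
    using assms by (simp add: of_nat_diff field_simps)
  then show ?thesis by (simp add: chord_def)
qed

lemma inj_polygon:
  assumes "0 < R"
  shows "inj_on (polygon p R) {..<p}"
proof (rule linorder_inj_onI)
  fix i j :: nat assume h: "i < j" "i \<in> {..<p}" "j \<in> {..<p}"
  then have "dist (polygon p R j) (polygon p R i) = chord p R (j - i)" using assms by (intro dist_polygon) auto
  moreover have "0 < chord p R (j - i)" using h assms by (intro chord_pos) auto
  ultimately show "polygon p R i \<noteq> polygon p R j" by auto
qed auto

lemma h_ge_triangle:
  assumes T: "is_triangle (A, B, C)"
  shows "k ^ 3 \<le> h (3 * k) (A, B, C)"
proof -
  let ?v = "\<lambda>i. [A, B, C] ! i"
  have "(\<Sum>i<(3::nat). \<Sum>j<i. \<Sum>l<j. if True then k * k * k else 0) \<le> h (3 * k) (A, B, C)"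
  proof (rule h_ge_sum[OF T, of ?v 3 "\<lambda>_. k" _ "\<lambda>_ _ _. True"])
    show "inj_on ?v {..<3}"
      using triangle_distinct[OF T] by (auto simp: inj_on_def numeral_3_eq_3 less_Suc_eq)
    fix i j l :: nat assume "l < j" "j < i" "i < 3"
    then have "l = 0" "j = 1" "i = 2" by auto
    then show "perm3 (dist (?v i) (?v j)) (dist (?v j) (?v l)) (dist (?v l) (?v i)) (dist B C) (dist C A) (dist A B)"
      by (simp add: perm3_def dist_commute)
  qed simp
  then show ?thesis by (simp add: numeral_eq_Suc)
qed

text \<open>Clusters of equal size at the corners of a rectangle, all four of whose triples are
  copies; \<open>D\<close> is the corner opposite the right angle at \<open>p\<close>.\<close>

lemma h_ge_right:
  assumes T: "is_triangle (A, B, C)" and right: "right_sides (sqd B C) (sqd C A) (sqd A B)"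
  shows "4 * k ^ 3 \<le> h (4 * k) (A, B, C)"
proof -
  obtain p q r where pqr: "sqd q r = sqd p q + sqd p r" "p \<noteq> q" "p \<noteq> r" "q \<noteq> r"
      "perm3 (dist p q) (dist q r) (dist r p) (dist B C) (dist C A) (dist A B)"
  proof -
    note ne = triangle_distinct[OF T]
    consider "sqd B C + sqd C A = sqd A B" | "sqd B C + sqd A B = sqd C A" | "sqd C A + sqd A B = sqd B C"
      using right by (auto simp: right_sides_def)
    then show thesis
    proof cases
      case 1
      then show ?thesis using ne by (intro that[where p = C and q = A and r = B]) (auto simp: sqd_sym perm3_def dist_commute)
    next
      case 2
      then show ?thesis using ne by (intro that[where p = B and q = C and r = A]) (auto simp: sqd_sym perm3_def dist_commute)
    next
      case 3
      then show ?thesis using ne by (intro that[where p = A and q = B and r = C]) (auto simp: sqd_sym perm3_def dist_commute)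
    qed
  qed
  define D where "D = q + r - p"
  have "sqd D q = sqd p r" "sqd D r = sqd p q" "sqd D p = sqd q r"
    using pqr(1) unfolding D_def sqd_coords vector_minus_component vector_add_component by algebra+
  then have dD: "dist D q = dist p r" "dist D r = dist p q" "dist D p = dist q r" by (simp_all add: sqd_def)
  then have D: "D \<noteq> p" "D \<noteq> q" "D \<noteq> r" using pqr(2-4) by (metis dist_eq_0_iff)+
  let ?v = "\<lambda>i. [p, q, r, D] ! i"
  have "(\<Sum>i<(4::nat). \<Sum>j<i. \<Sum>l<j. if True then k * k * k else 0) \<le> h (4 * k) (A, B, C)"
  proof (rule h_ge_sum[OF T, of ?v 4 "\<lambda>_. k" _ "\<lambda>_ _ _. True"])
    show "inj_on ?v {..<4}"
      using pqr(2-4) D by (auto simp: inj_on_def numeral_eq_Suc less_Suc_eq)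
    fix i j l :: nat assume h: "l < j" "j < i" "i < 4"
    have "perm3 (dist (?v i) (?v j)) (dist (?v j) (?v l)) (dist (?v l) (?v i)) (dist p q) (dist q r) (dist r p)"
    proof -
      from h consider "i = 2" "j = 1" "l = 0" | "i = 3" "j = 1" "l = 0" | "i = 3" "j = 2" "l = 0" | "i = 3" "j = 2" "l = 1"
        by linarith
      then show ?thesis
        by cases (simp_all add: perm3_def dD dist_commute[of p D] dist_commute[of q D] dist_commute[of r D] dist_commute[of q p] dist_commute[of r p] dist_commute[of r q])
    qed
    then show "perm3 (dist (?v i) (?v j)) (dist (?v j) (?v l)) (dist (?v l) (?v i)) (dist B C) (dist C A) (dist A B)"
      using perm3_trans pqr(5) by blast
  qed simp
  then show ?thesis by (simp add: numeral_eq_Suc power3_eq_cube)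
qed

text \<open>An equilateral triangle, each vertex of weight \<open>2 k\<close>, with its centre, of weight \<open>3 k\<close>.\<close>

lemma h_ge_120:
  assumes T: "is_triangle (A, B, C)" and ty: "tri_angles (A, B, C) = {#2 * pi / 3, pi / 6, pi / 6#}"
  shows "36 * k ^ 3 \<le> h (9 * k) (A, B, C)"
proof -
  obtain R where R: "0 < R" and s: "perm3 (dist B C) (dist C A) (dist A B) (2 * R * sin (2 * pi / 3)) (2 * R * sin (pi / 6)) (2 * R * sin (pi / 6))"
    using sides_of_angs[OF tri_sides_dist[OF T] ty[unfolded tri_angles_angs]] by blast
  have leg: "2 * R * sin (pi / 6) = R" by (simp add: sin_30)
  let ?v = "\<lambda>i. if i = 0 then 0 else polygon 3 R (i - 1)" and ?m = "\<lambda>i :: nat. if i = 0 then 3 * k else 2 * k"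
  have v0: "dist 0 (polygon 3 R i) = R" "dist (polygon 3 R i) 0 = R" for i
    using R norm_circle_point[of R] by (simp_all add: polygon_def dist_commute)
  have dv: "dist (polygon 3 R i) (polygon 3 R j) = 2 * R * sin (2 * pi / 3)" if "j < i" "i < 3" for i j
  proof -
    have "dist (polygon 3 R i) (polygon 3 R j) = chord 3 R (i - j)" using R that by (intro dist_polygon) auto
    moreover have "i - j = 1 \<or> i - j = 2" using that by auto
    moreover have "chord 3 R 2 = 2 * R * sin (2 * pi / 3)" by (simp add: chord_def mult.commute)
    ultimately show ?thesis using chord_reflect[of 1 3 R] by auto
  qed
  \<comment> \<open>The index \<open>l\<close> is the smallest, so the condition selects the three
    triples through the centre, each contributing \<open>3 * k * (2 * k) * (2 * k)\<close>.\<close>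
  have "(\<Sum>i<4. \<Sum>j<i. \<Sum>l<j. if l = 0 then ?m i * ?m j * ?m l else 0) \<le> h (9 * k) (A, B, C)"
  proof (rule h_ge_sum[OF T, of ?v 4 ?m])
    show "inj_on ?v {..<4}"
    proof (rule linorder_inj_onI)
      fix i j :: nat assume h: "i < j" "i \<in> {..<4}" "j \<in> {..<4}"
      show "?v i \<noteq> ?v j"
      proof (cases "i = 0")
        case True
        have "polygon 3 R (j - 1) \<noteq> 0" using v0(1)[of "j - 1"] R by auto
        then show ?thesis using True h by simp
      next
        case False
        then have "i - 1 \<noteq> j - 1" "i - 1 \<in> {..<3}" "j - 1 \<in> {..<3}" using h by auto
        then have "polygon 3 R (i - 1) \<noteq> polygon 3 R (j - 1)"
          using inj_onD[OF inj_polygon[OF R, of 3], of "i - 1" "j - 1"] by blast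
        then show ?thesis using False h by simp
      qed
    qed auto
    show "sum ?m {..<4} = 9 * k" by (simp add: numeral_eq_Suc)
    fix i j l :: nat assume h: "l = 0" "l < j" "j < i" "i < 4"
    have "dist (?v i) (?v j) = 2 * R * sin (2 * pi / 3)" using dv[of "j - 1" "i - 1"] h by auto
    moreover have "dist (?v j) (?v l) = R" "dist (?v l) (?v i) = R" using v0 h by auto
    ultimately have "perm3 (dist (?v i) (?v j)) (dist (?v j) (?v l)) (dist (?v l) (?v i)) (2 * R * sin (2 * pi / 3)) (2 * R * sin (pi / 6)) (2 * R * sin (pi / 6))"
      unfolding leg by (simp only: perm3_def simp_thms)
    then show "perm3 (dist (?v i) (?v j)) (dist (?v j) (?v l)) (dist (?v l) (?v i)) (dist B C) (dist C A) (dist A B)"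
      using perm3_trans perm3_sym[OF s] by blast
  qed
  moreover have "(\<Sum>i<4. \<Sum>j<i. \<Sum>l<j. if l = 0 then ?m i * ?m j * ?m l else 0) = 36 * k ^ 3"
    by (simp add: numeral_eq_Suc power3_eq_cube algebra_simps)
  ultimately show ?thesis by (simp only:)
qed

lemma h_ge_polygon:
  assumes T: "is_triangle (A, B, C)" and R: "0 < R"
    and s: "\<And>i j l. \<lbrakk>Q i j l; l < j; j < i; i < p\<rbrakk> \<Longrightarrow>
      perm3 (chord p R (i - j)) (chord p R (j - l)) (chord p R (i - l)) (dist B C) (dist C A) (dist A B)"
  shows "(\<Sum>i<p. \<Sum>j<i. \<Sum>l<j. if Q i j l then k * k * k else 0) \<le> h (p * k) (A, B, C)"
proof (rule h_ge_sum[OF T inj_polygon[OF R]])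
  fix i j l assume h: "Q i j l" "l < j" "j < i" "i < p"
  have "dist (polygon p R i) (polygon p R j) = chord p R (i - j)" "dist (polygon p R j) (polygon p R l) = chord p R (j - l)"
    "dist (polygon p R l) (polygon p R i) = chord p R (i - l)"
    using h R dist_polygon[of R j i p] dist_polygon[of R l j p] dist_polygon[of R l i p] by (auto simp: dist_commute)
  then show "perm3 (dist (polygon p R i) (polygon p R j)) (dist (polygon p R j) (polygon p R l)) (dist (polygon p R l) (polygon p R i))
      (dist B C) (dist C A) (dist A B)" using s[OF h] by simp
qed simp

lemma h_ge_heptagon:
  assumes T: "is_triangle (A, B, C)" and ty: "tri_angles (A, B, C) = {#4 * pi / 7, 2 * pi / 7, pi / 7#}"
  shows "14 * k ^ 3 \<le> h (7 * k) (A, B, C)"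
proof -
  obtain R where R: "0 < R" and s: "perm3 (dist B C) (dist C A) (dist A B) (2 * R * sin (4 * pi / 7)) (2 * R * sin (2 * pi / 7)) (2 * R * sin (pi / 7))"
    using sides_of_angs[OF tri_sides_dist[OF T] ty[unfolded tri_angles_angs]] by blast
  have c: "2 * R * sin (4 * pi / 7) = chord 7 R 3" "2 * R * sin (2 * pi / 7) = chord 7 R 2" "2 * R * sin (pi / 7) = chord 7 R 1"
    using chord_reflect[of 3 7 R] by (simp_all add: chord_def mult.commute)
  define col where "col m = (if m = 1 \<or> m = 6 then 0 else if m = 2 \<or> m = 5 then 1 else 2 :: nat)" for m :: nat
  define Q where "Q i j l \<longleftrightarrow> col (i - j) \<noteq> col (j - l) \<and> col (i - j) \<noteq> col (i - l) \<and> col (j - l) \<noteq> col (i - l)" for i j l :: nat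
  have ch: "chord 7 R m = [chord 7 R 1, chord 7 R 2, chord 7 R 3] ! col m" if "0 < m" "m < 7" for m
  proof -
    have "m = 1 \<or> m = 2 \<or> m = 3 \<or> m = 4 \<or> m = 5 \<or> m = 6" using that by linarith
    then show ?thesis using chord_reflect[of 1 7 R] chord_reflect[of 2 7 R] chord_reflect[of 3 7 R]
      by (auto simp: col_def)
  qed
  have c3: "col m = 0 \<or> col m = 1 \<or> col m = 2" for m by (simp add: col_def)
  have "(\<Sum>i<7. \<Sum>j<i. \<Sum>l<j. if Q i j l then k * k * k else 0) \<le> h (7 * k) (A, B, C)"
  proof (rule h_ge_polygon[OF T R])
    fix i j l :: nat assume h: "Q i j l" "l < j" "j < i" "i < 7"
    have "perm3 (chord 7 R (i - j)) (chord 7 R (j - l)) (chord 7 R (i - l)) (chord 7 R 3) (chord 7 R 2) (chord 7 R 1)"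
    proof -
      have "chord 7 R (i - j) = [chord 7 R 1, chord 7 R 2, chord 7 R 3] ! col (i - j)"
        "chord 7 R (j - l) = [chord 7 R 1, chord 7 R 2, chord 7 R 3] ! col (j - l)"
        "chord 7 R (i - l) = [chord 7 R 1, chord 7 R 2, chord 7 R 3] ! col (i - l)"
        by (rule ch; use h in linarith)+
      then show ?thesis using c3[of "i - j"] c3[of "j - l"] c3[of "i - l"] h(1) unfolding Q_def
        by (elim disjE) (simp_all add: perm3_def)
    qed
    then show "perm3 (chord 7 R (i - j)) (chord 7 R (j - l)) (chord 7 R (i - l)) (dist B C) (dist C A) (dist A B)"
      using perm3_trans perm3_sym[OF s[unfolded c]] by blast
  qed
  moreover have "(\<Sum>i<7. \<Sum>j<i. \<Sum>l<j. if Q i j l then k * k * k else 0) = 14 * k ^ 3"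
    by (simp add: numeral_eq_Suc Q_def col_def)
  ultimately show ?thesis by (simp only:)
qed

lemma h_ge_pentagon:
  assumes T: "is_triangle (A, B, C)"
    and ty: "tri_angles (A, B, C) = {#3 * pi / 5, pi / 5, pi / 5#} \<or> tri_angles (A, B, C) = {#2 * pi / 5, 2 * pi / 5, pi / 5#}"
  shows "5 * k ^ 3 \<le> h (5 * k) (A, B, C)"
proof -
  \<comment> \<open>0 codes a side and 1 a diagonal of the pentagon; the three codes add up to 1 for
    the obtuse triangle and to 2 for the acute one.\<close>
  define col where "col m = (if m = 1 \<or> m = 4 then 0 else 1 :: nat)" for m :: nat
  have ch: "chord 5 R m = [chord 5 R 1, chord 5 R 2] ! col m" if "0 < m" "m < 5" for m R
  proof -
    have "m = 1 \<or> m = 2 \<or> m = 3 \<or> m = 4" using that by linarith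
    then show ?thesis using chord_reflect[of 1 5 R] chord_reflect[of 2 5 R] by (auto simp: col_def)
  qed
  have c2: "col m = 0 \<or> col m = 1" for m by (simp add: col_def)
  have chs: "chord 5 R (i - j) = [chord 5 R 1, chord 5 R 2] ! col (i - j)" "chord 5 R (j - l) = [chord 5 R 1, chord 5 R 2] ! col (j - l)"
     "chord 5 R (i - l) = [chord 5 R 1, chord 5 R 2] ! col (i - l)" if "l < j" "j < i" "i < 5" for i j l R
    by (rule ch; use that in linarith)+
  from ty show ?thesis
  proof
    assume "tri_angles (A, B, C) = {#3 * pi / 5, pi / 5, pi / 5#}"
    then obtain R where R: "0 < R" and s: "perm3 (dist B C) (dist C A) (dist A B) (2 * R * sin (3 * pi / 5)) (2 * R * sin (pi / 5)) (2 * R * sin (pi / 5))"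
      using sides_of_angs[OF tri_sides_dist[OF T]] unfolding tri_angles_angs by blast
    have c: "2 * R * sin (3 * pi / 5) = chord 5 R 2" "2 * R * sin (pi / 5) = chord 5 R 1"
      using chord_reflect[of 2 5 R] by (simp_all add: chord_def mult.commute)
    have "(\<Sum>i<5. \<Sum>j<i. \<Sum>l<j. if col (i - j) + col (j - l) + col (i - l) = 1 then k * k * k else 0) \<le> h (5 * k) (A, B, C)"
    proof (rule h_ge_polygon[OF T R])
      fix i j l :: nat assume h: "col (i - j) + col (j - l) + col (i - l) = 1" "l < j" "j < i" "i < 5"
      have "perm3 (chord 5 R (i - j)) (chord 5 R (j - l)) (chord 5 R (i - l)) (chord 5 R 2) (chord 5 R 1) (chord 5 R 1)"
        using chs[OF h(2-4), of R] c2[of "i - j"] c2[of "j - l"] c2[of "i - l"] h(1)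
        by (elim disjE) (simp_all add: perm3_def)
      then show "perm3 (chord 5 R (i - j)) (chord 5 R (j - l)) (chord 5 R (i - l)) (dist B C) (dist C A) (dist A B)"
        using perm3_trans perm3_sym[OF s[unfolded c]] by blast
    qed
    moreover have "(\<Sum>i<5. \<Sum>j<i. \<Sum>l<j. if col (i - j) + col (j - l) + col (i - l) = 1 then k * k * k else 0) = 5 * k ^ 3"
      by (simp add: numeral_eq_Suc col_def)
    ultimately show ?thesis by (simp only:)
  next
    assume "tri_angles (A, B, C) = {#2 * pi / 5, 2 * pi / 5, pi / 5#}"
    then obtain R where R: "0 < R" and s: "perm3 (dist B C) (dist C A) (dist A B) (2 * R * sin (2 * pi / 5)) (2 * R * sin (2 * pi / 5)) (2 * R * sin (pi / 5))"
      using sides_of_angs[OF tri_sides_dist[OF T]] unfolding tri_angles_angs by blast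
    have c: "2 * R * sin (2 * pi / 5) = chord 5 R 2" "2 * R * sin (pi / 5) = chord 5 R 1"
      by (simp_all add: chord_def mult.commute)
    have "(\<Sum>i<5. \<Sum>j<i. \<Sum>l<j. if col (i - j) + col (j - l) + col (i - l) = 2 then k * k * k else 0) \<le> h (5 * k) (A, B, C)"
    proof (rule h_ge_polygon[OF T R])
      fix i j l :: nat assume h: "col (i - j) + col (j - l) + col (i - l) = 2" "l < j" "j < i" "i < 5"
      have "perm3 (chord 5 R (i - j)) (chord 5 R (j - l)) (chord 5 R (i - l)) (chord 5 R 2) (chord 5 R 2) (chord 5 R 1)"
        using chs[OF h(2-4), of R] c2[of "i - j"] c2[of "j - l"] c2[of "i - l"] h(1)
        by (elim disjE) (simp_all add: perm3_def)
      then show "perm3 (chord 5 R (i - j)) (chord 5 R (j - l)) (chord 5 R (i - l)) (dist B C) (dist C A) (dist A B)"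
        using perm3_trans perm3_sym[OF s[unfolded c]] by blast
    qed
    moreover have "(\<Sum>i<5. \<Sum>j<i. \<Sum>l<j. if col (i - j) + col (j - l) + col (i - l) = 2 then k * k * k else 0) = 5 * k ^ 3"
      by (simp add: numeral_eq_Suc col_def)
    ultimately show ?thesis by (simp only:)
  qed
qed

section \<open>The upper bound in terms of angles\<close>

text \<open>The number \<open>c\<close> is the maximum of the polynomial. The alternatives are
  stated without exclusivity; which of them apply to a given triangle is settled afterwards from its
  angles.\<close>

theorem h_upper:
  assumes T: "is_triangle (A, B, C)" and n: "0 < n"
  shows "\<exists>c. real (h n (A, B, C)) \<le> c * real n ^ 3 \<and>
   (c \<le> 1 / 27 \<or> right_angled (A, B, C) \<and> c \<le> 1 / 16 \<or>
    tri_angles (A, B, C) = {#2 * pi / 3, pi / 6, pi / 6#} \<and> c \<le> 4 / 81 \<or>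
    tri_angles (A, B, C) = {#4 * pi / 7, 2 * pi / 7, pi / 7#} \<and> c \<le> 2 / 49 \<or>
    (tri_angles (A, B, C) = {#3 * pi / 5, pi / 5, pi / 5#} \<or> tri_angles (A, B, C) = {#2 * pi / 5, 2 * pi / 5, pi / 5#}) \<and> c \<le> 1 / 25)"
proof -
  let ?x = "sqd B C" and ?y = "sqd C A" and ?z = "sqd A B"
  let ?a = "dist B C" and ?b = "dist C A" and ?c = "dist A B"
  obtain S E w \<phi> where tc: "triangle_copies (S :: nat set) E w \<phi> ?x ?y ?z"
    and le: "real (h n (A, B, C)) \<le> real n ^ 3 * hsum E w"
    using h_le_hsum[OF T n] by blast
  have t: "tri_sides ?a ?b ?c" by (rule tri_sides_dist[OF T])
  have sq: "sqrt ?x = ?a" "sqrt ?y = ?b" "sqrt ?z = ?c" by (simp_all add: sqd_def)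
  have pos: "0 < ?x" "0 < ?y" "0 < ?z" using t by (auto simp: tri_sides_def sqd_def)
  have roots: "perm3 ?a ?b ?c p q r" if "perm3 ?x ?y ?z (p\<^sup>2) (q\<^sup>2) (r\<^sup>2)" "0 \<le> p" "0 \<le> q" "0 \<le> r" for p q r
    using perm3_sqrt[OF that] by (simp only: sq)
  have case120: "tri_angles (A, B, C) = {#2 * pi / 3, pi / 6, pi / 6#}" if l: "perm3 ?x ?y ?z (3 * l) l l" for l
  proof -
    have l0: "0 < l" using l pos by (auto simp: perm3_def)
    have "perm3 ?a ?b ?c (sqrt 3 * sqrt l) (sqrt l) (sqrt l)"
      using l l0 by (intro roots) (simp_all add: power_mult_distrib)
    then show ?thesis unfolding tri_angles_angs by (rule angs_120[OF t])
  qed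
  have case7: "tri_angles (A, B, C) = {#4 * pi / 7, 2 * pi / 7, pi / 7#}"
    if p: "perm3 p q r ?x ?y ?z" and h: "heptagonal p q r" and sc: "scalene ?x ?y ?z" for p q r
  proof -
    obtain a b c where abc: "perm3 p q r (a\<^sup>2) (b\<^sup>2) (c\<^sup>2)" "0 < a" "0 < b" "0 < c" "b\<^sup>2 = a\<^sup>2 + a * c" "c\<^sup>2 = b\<^sup>2 + b * a"
      using heptagonal_sides[OF h scalene_perm[OF sc p]] by blast
    have "perm3 ?a ?b ?c a b c" using perm3_trans[OF perm3_sym[OF p] abc(1)] abc(2-4) by (intro roots) auto
    moreover from this have "tri_sides a b c" using tri_sides_perm perm3_sym t by blast
    ultimately show ?thesis
      unfolding tri_angles_angs using angs_perm angs_heptagonal abc(5,6) by metis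
  qed
  have case5: "tri_angles (A, B, C) = {#3 * pi / 5, pi / 5, pi / 5#} \<or> tri_angles (A, B, C) = {#2 * pi / 5, 2 * pi / 5, pi / 5#}"
    if bl: "perm3 ?x ?y ?z b l l" and rel: "b\<^sup>2 + l\<^sup>2 = 3 * b * l" for b l
  proof -
    have bl0: "0 < b" "0 < l" using bl pos by (auto simp: perm3_def)
    define s t' where "s = sqrt b" "t' = sqrt l"
    note st_def = s_t'_def
    have st: "0 < s" "0 < t'" "b = s\<^sup>2" "l = t'\<^sup>2" using bl0 by (auto simp: st_def)
    have pm: "perm3 ?a ?b ?c s t' t'" using bl st by (intro roots) auto
    then have ts: "tri_sides s t' t'" using tri_sides_perm perm3_sym t by blast
    \<comment> \<open>The golden relation factors over the side lengths, with one factor for each of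
      the two golden triangles.\<close>
    have "(s\<^sup>2 - t'\<^sup>2 - s * t') * (t'\<^sup>2 - s\<^sup>2 - s * t') = 0" using rel st(3,4) by algebra
    then have "s\<^sup>2 = t'\<^sup>2 + s * t' \<or> t'\<^sup>2 = s\<^sup>2 + s * t'" by auto
    then show ?thesis
      unfolding tri_angles_angs angs_perm[OF pm] using angs_golden_obtuse[OF ts] angs_golden_acute[OF ts] by blast
  qed
  have "hsum E w \<le> 1 / 27 \<or> right_sides ?x ?y ?z \<and> hsum E w \<le> 1 / 16 \<or>
   (\<exists>l. perm3 ?x ?y ?z (3 * l) l l) \<and> hsum E w \<le> 4 / 81 \<or>
   (\<exists>a b c. perm3 a b c ?x ?y ?z \<and> heptagonal a b c) \<and> scalene ?x ?y ?z \<and> hsum E w \<le> 2 / 49 \<or>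
   (\<exists>b l. perm3 ?x ?y ?z b l l \<and> b\<^sup>2 + l\<^sup>2 = 3 * b * l) \<and> hsum E w \<le> 1 / 25"
    by (rule triangle_copies.hsum_bound[OF tc])
  moreover have "real (h n (A, B, C)) \<le> hsum E w * real n ^ 3" using le by (simp add: mult.commute)
  ultimately show ?thesis
    using case120 case7 case5 right_angled_iff[OF T] by (intro exI[of _ "hsum E w"]) blast
qed

section \<open>Separation of the types and the final bounds\<close>

lemma of_type_iff:
  "of_type T \<alpha> \<beta> \<gamma> \<longleftrightarrow> \<alpha> \<ge> \<beta> \<and> \<beta> \<ge> \<gamma> \<and> tri_angles T = {#\<alpha> * pi / 180, \<beta> * pi / 180, \<gamma> * pi / 180#}"
  by (simp add: of_type_def deg_def)

lemma special_types:
  "of_type T 120 30 30 \<longleftrightarrow> tri_angles T = {#2 * pi / 3, pi / 6, pi / 6#}"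
  "of_type T (4 * 180 / 7) (2 * 180 / 7) (180 / 7) \<longleftrightarrow> tri_angles T = {#4 * pi / 7, 2 * pi / 7, pi / 7#}"
  "of_type T 108 36 36 \<longleftrightarrow> tri_angles T = {#3 * pi / 5, pi / 5, pi / 5#}"
  "of_type T 72 72 36 \<longleftrightarrow> tri_angles T = {#2 * pi / 5, 2 * pi / 5, pi / 5#}"
proof -
  have e: "120 * pi / 180 = 2 * pi / 3" "30 * pi / 180 = pi / 6" "4 * 180 / 7 * pi / 180 = 4 * pi / 7" "2 * 180 / 7 * pi / 180 = 2 * pi / 7"
    "180 / 7 * pi / 180 = pi / 7" "108 * pi / 180 = 3 * pi / 5" "36 * pi / 180 = pi / 5" "72 * pi / 180 = 2 * pi / 5" by simp_all
  show "of_type T 120 30 30 \<longleftrightarrow> tri_angles T = {#2 * pi / 3, pi / 6, pi / 6#}"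
    "of_type T (4 * 180 / 7) (2 * 180 / 7) (180 / 7) \<longleftrightarrow> tri_angles T = {#4 * pi / 7, 2 * pi / 7, pi / 7#}"
    "of_type T 108 36 36 \<longleftrightarrow> tri_angles T = {#3 * pi / 5, pi / 5, pi / 5#}"
    "of_type T 72 72 36 \<longleftrightarrow> tri_angles T = {#2 * pi / 5, 2 * pi / 5, pi / 5#}"
    unfolding of_type_iff e by auto
qed

text \<open>The constants decrease in the order right, 120 degrees, heptagonal, pentagonal:
  \<open>1/16 > 4/81 > 2/49 > 1/25\<close>. For each type only those with a larger constant must be
  excluded, and an angle \<open>pi / 6\<close> or \<open>pi / 7\<close> identifies the two middle
  ones.\<close>

lemma angle_types_exclusive:
  assumes "M = {#2 * pi / 3, pi / 6, pi / 6#} \<or> M = {#4 * pi / 7, 2 * pi / 7, pi / 7#} \<or>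
    M = {#3 * pi / 5, pi / 5, pi / 5#} \<or> M = {#2 * pi / 5, 2 * pi / 5, pi / 5#}"
  shows "pi / 2 \<notin># M" "pi / 7 \<in># M \<longleftrightarrow> M = {#4 * pi / 7, 2 * pi / 7, pi / 7#}" "pi / 6 \<in># M \<longleftrightarrow> M = {#2 * pi / 3, pi / 6, pi / 6#}"
proof -
  have ne: "q * pi = r * pi \<longleftrightarrow> q = r" for q r :: real by simp
  have e: "2 * pi / 3 = (2/3) * pi" "pi / 6 = (1/6) * pi" "4 * pi / 7 = (4/7) * pi" "2 * pi / 7 = (2/7) * pi" "pi / 7 = (1/7) * pi"
    "3 * pi / 5 = (3/5) * pi" "pi / 5 = (1/5) * pi" "2 * pi / 5 = (2/5) * pi" "pi / 2 = (1/2) * pi" by simp_all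
  show "pi / 2 \<notin># M"
    using assms unfolding e by (elim disjE; simp only: set_mset_add_mset_insert set_mset_empty insert_iff empty_iff ne; simp)
  show "pi / 7 \<in># M \<longleftrightarrow> M = {#4 * pi / 7, 2 * pi / 7, pi / 7#}"
  proof
    show "M = {#4 * pi / 7, 2 * pi / 7, pi / 7#}" if "pi / 7 \<in># M"
      using assms that unfolding e by (elim disjE; simp only: set_mset_add_mset_insert set_mset_empty insert_iff empty_iff ne; simp)
  qed simp
  show "pi / 6 \<in># M \<longleftrightarrow> M = {#2 * pi / 3, pi / 6, pi / 6#}"
  proof
    show "M = {#2 * pi / 3, pi / 6, pi / 6#}" if "pi / 6 \<in># M"
      using assms that unfolding e by (elim disjE; simp only: set_mset_add_mset_insert set_mset_empty insert_iff empty_iff ne; simp)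
  qed simp
qed

theorem theorem1p2:
  fixes T :: tri and n :: nat
  assumes "is_triangle T" and "n > 0"
  shows
    "(right_angled T \<longrightarrow>
        real (h n T) \<le> real n ^ 3 / 16 \<and> (4 dvd n \<longrightarrow> real (h n T) = real n ^ 3 / 16))
   \<and> (of_type T 120 30 30 \<longrightarrow>
        real (h n T) \<le> 4 / 81 * real n ^ 3 \<and> (9 dvd n \<longrightarrow> real (h n T) = 4 / 81 * real n ^ 3))
   \<and> (of_type T (4 * 180 / 7) (2 * 180 / 7) (180 / 7) \<longrightarrow>
        real (h n T) \<le> 2 / 49 * real n ^ 3 \<and> (7 dvd n \<longrightarrow> real (h n T) = 2 / 49 * real n ^ 3))
   \<and> ((of_type T 108 36 36 \<or> of_type T 72 72 36) \<longrightarrow>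
        real (h n T) \<le> real n ^ 3 / 25 \<and> (5 dvd n \<longrightarrow> real (h n T) = real n ^ 3 / 25))
   \<and> ((\<not> right_angled T \<and> \<not> of_type T 120 30 30 \<and> \<not> of_type T (4 * 180 / 7) (2 * 180 / 7) (180 / 7)
        \<and> \<not> of_type T 108 36 36 \<and> \<not> of_type T 72 72 36) \<longrightarrow>
        real (h n T) \<le> real n ^ 3 / 27 \<and> (3 dvd n \<longrightarrow> real (h n T) = real n ^ 3 / 27))"
proof -
  obtain A B C where T: "T = (A, B, C)" by (metis prod.exhaust)
  have tri: "is_triangle (A, B, C)" using assms(1) T by simp
  let ?M = "tri_angles T"
  have right: "right_angled T \<longleftrightarrow> pi / 2 \<in># ?M" by (simp add: right_angled_def)
  obtain c where c: "real (h n T) \<le> c * real n ^ 3"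
    and cases: "c \<le> 1 / 27 \<or> right_angled T \<and> c \<le> 1 / 16 \<or> ?M = {#2 * pi / 3, pi / 6, pi / 6#} \<and> c \<le> 4 / 81 \<or>
      ?M = {#4 * pi / 7, 2 * pi / 7, pi / 7#} \<and> c \<le> 2 / 49 \<or>
      (?M = {#3 * pi / 5, pi / 5, pi / 5#} \<or> ?M = {#2 * pi / 5, 2 * pi / 5, pi / 5#}) \<and> c \<le> 1 / 25"
    using h_upper[OF tri assms(2)] unfolding T by blast
  have up: "real (h n T) \<le> b * real n ^ 3" if "c \<le> b" for b
    using c mult_right_mono[OF that, of "real n ^ 3"] by simp
  \<comment> \<open>A blow-up of \<open>p * k\<close> points with \<open>a * k ^ 3\<close>
    near-copies has density \<open>q = a / p ^ 3\<close>.\<close>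
  have low: "q * real n ^ 3 \<le> real (h n T)" if "n = p * k" "a * k ^ 3 \<le> h (p * k) T" "q * real p ^ 3 = real a" for p k a q
  proof -
    have "q * real n ^ 3 = real (a * k ^ 3)" using that(1) by (simp add: power_mult_distrib that(3)[symmetric])
    then show ?thesis using that(2) unfolding that(1)[symmetric] by (simp only: of_nat_le_iff)
  qed
  note types = special_types[of T]
  have a: "real (h n T) \<le> 1 / 16 * real n ^ 3 \<and> (4 dvd n \<longrightarrow> real (h n T) = 1 / 16 * real n ^ 3)" if "right_angled T"
  proof -
    have u: "real (h n T) \<le> 1 / 16 * real n ^ 3" using cases by (intro up) auto
    moreover have "1 / 16 * real n ^ 3 \<le> real (h n T)" if d: "4 dvd n"
    proof -
      obtain k where "n = 4 * k" using d by (elim dvdE)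
      then show ?thesis using h_ge_right[OF tri, of k] right_angled_iff[OF tri] \<open>right_angled T\<close> T by (intro low[of 4 k 4]) auto
    qed
    ultimately show ?thesis by fastforce
  qed
  have b: "real (h n T) \<le> 4 / 81 * real n ^ 3 \<and> (9 dvd n \<longrightarrow> real (h n T) = 4 / 81 * real n ^ 3)" if M: "?M = {#2 * pi / 3, pi / 6, pi / 6#}"
  proof -
    have "\<not> right_angled T" unfolding right by (rule angle_types_exclusive(1)) (use M in blast)
    then have u: "real (h n T) \<le> 4 / 81 * real n ^ 3" using cases by (intro up) auto
    moreover have "4 / 81 * real n ^ 3 \<le> real (h n T)" if d: "9 dvd n"
    proof -
      obtain k where "n = 9 * k" using d by (elim dvdE)
      then show ?thesis using h_ge_120[OF tri, of k] M T by (intro low[of 9 k 36]) auto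
    qed
    ultimately show ?thesis by fastforce
  qed
  have c7: "real (h n T) \<le> 2 / 49 * real n ^ 3 \<and> (7 dvd n \<longrightarrow> real (h n T) = 2 / 49 * real n ^ 3)" if M: "?M = {#4 * pi / 7, 2 * pi / 7, pi / 7#}"
  proof -
    have "\<not> right_angled T" unfolding right by (rule angle_types_exclusive(1)) (use M in blast)
    moreover have "?M \<noteq> {#2 * pi / 3, pi / 6, pi / 6#}"
      using angle_types_exclusive(2)[of "{#2 * pi / 3, pi / 6, pi / 6#}"] M by auto
    ultimately have u: "real (h n T) \<le> 2 / 49 * real n ^ 3" using cases by (intro up) auto
    moreover have "2 / 49 * real n ^ 3 \<le> real (h n T)" if d: "7 dvd n"
    proof -
      obtain k where "n = 7 * k" using d by (elim dvdE)
      then show ?thesis using h_ge_heptagon[OF tri, of k] M T by (intro low[of 7 k 14]) auto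
    qed
    ultimately show ?thesis by fastforce
  qed
  have d5: "real (h n T) \<le> 1 / 25 * real n ^ 3 \<and> (5 dvd n \<longrightarrow> real (h n T) = 1 / 25 * real n ^ 3)"
    if M: "?M = {#3 * pi / 5, pi / 5, pi / 5#} \<or> ?M = {#2 * pi / 5, 2 * pi / 5, pi / 5#}"
  proof -
    have M': "?M = {#2 * pi / 3, pi / 6, pi / 6#} \<or> ?M = {#4 * pi / 7, 2 * pi / 7, pi / 7#} \<or>
      ?M = {#3 * pi / 5, pi / 5, pi / 5#} \<or> ?M = {#2 * pi / 5, 2 * pi / 5, pi / 5#}" using M by blast
    have "\<not> right_angled T" unfolding right by (rule angle_types_exclusive(1)[OF M'])
    moreover have "pi / 6 \<notin># ?M" "pi / 7 \<notin># ?M" using M by auto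
    then have "?M \<noteq> {#2 * pi / 3, pi / 6, pi / 6#}" "?M \<noteq> {#4 * pi / 7, 2 * pi / 7, pi / 7#}"
      using angle_types_exclusive(2,3)[OF M'] by blast+
    ultimately have u: "real (h n T) \<le> 1 / 25 * real n ^ 3" using cases by (intro up) auto
    moreover have "1 / 25 * real n ^ 3 \<le> real (h n T)" if d: "5 dvd n"
    proof -
      obtain k where "n = 5 * k" using d by (elim dvdE)
      then show ?thesis using h_ge_pentagon[OF tri, of k] M T by (intro low[of 5 k 5]) auto
    qed
    ultimately show ?thesis by fastforce
  qed
  have e: "real (h n T) \<le> 1 / 27 * real n ^ 3 \<and> (3 dvd n \<longrightarrow> real (h n T) = 1 / 27 * real n ^ 3)"
    if "\<not> right_angled T" "?M \<noteq> {#2 * pi / 3, pi / 6, pi / 6#}" "?M \<noteq> {#4 * pi / 7, 2 * pi / 7, pi / 7#}"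
      "?M \<noteq> {#3 * pi / 5, pi / 5, pi / 5#}" "?M \<noteq> {#2 * pi / 5, 2 * pi / 5, pi / 5#}"
  proof -
    have u: "real (h n T) \<le> 1 / 27 * real n ^ 3" using cases that by (intro up) blast
    moreover have "1 / 27 * real n ^ 3 \<le> real (h n T)" if d: "3 dvd n"
    proof -
      obtain k where "n = 3 * k" using d by (elim dvdE)
      then show ?thesis using h_ge_triangle[OF tri, of k] T by (intro low[of 3 k 1]) auto
    qed
    ultimately show ?thesis by fastforce
  qed
  show ?thesis
    unfolding types using a b c7 d5 e by simp
qed

end
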